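(* Let $n\geq 2$, let $A=C^*(G(n))$, let $T=\mathbb{T}^{\frac12 n(n-1)}$ (identified with $\operatorname{Prim} Z(A)$), and for $\lambda\in T$ let $\pi_\lambda\colon A\to\mathcal{A}_\lambda$ be the canonical surjection onto the noncommutative $n$-torus $\mathcal{A}_\lambda$. For $a\in A$ let $\tilde a$ be the section $T\to\bigsqcup_{\lambda\in T}\mathcal{A}_\lambda$, $\tilde a(\lambda)=\pi_\lambda(a)$, and let $\widetilde{A}=\{\tilde a\mid a\in A\}$. Then the triple $(T,\{\mathcal{A}_\lambda\}_{\lambda\in T},\widetilde{A})$ is a full continuous field of $C^*$-algebras. Moreover, the $C^*$-algebra associated with this continuous field is naturally isomorphic to $A$ (via $a\mapsto\tilde a$).
   Context: $G(n)$ is the free nilpotent group of class $2$ and rank $n$: it is generated by $\{u_i\}_{1\leq i\leq n}$ and $\{v_{jk}\}_{1\leq j<k\leq n}$ subject to $[v_{jk},v_{lm}]=[u_i,v_{jk}]=1$ and $[u_j,u_k]=v_{jk}$, where $[x,y]=xyx^{-1}y^{-1}$. Its group $C^*$-algebra $A=C^*(G(n))$ is the universal $C^*$-algebra generated by unitaries $\{U_i\}_{1\leq i\leq n}$ and $\{V_{jk}\}_{1\leq j<k\leq n}$ with $[V_{jk},V_{lm}]=[U_i,V_{jk}]=I$ and $[U_j,U_k]=V_{jk}$. The center of $A$ is $Z(A)=C^*(\{V_{jk}\})$, whose primitive ideal space is identified with $\mathbb{T}^{\frac12 n(n-1)}$ so that $\lambda=(\lambda_{jk})_{j<k}$ corresponds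 to the ideal of $Z(A)$ generated by $\{V_{jk}-\lambda_{jk}I\}$. For $\lambda=(\lambda_{jk})_{1\leq j<k\leq n}\in\mathbb{T}^{\frac12 n(n-1)}$, the noncommutative $n$-torus $\mathcal{A}_\lambda$ is the universal $C^*$-algebra generated by unitaries $W_1,\dotsc,W_n$ with $[W_i,W_j]=\lambda_{ij}I$ for $1\leq i<j\leq n$. The map $\pi_\lambda\colon A\to\mathcal{A}_\lambda$ is the surjective $^*$-homomorphism with $\pi_\lambda(U_i)=W_i$ and $\pi_\lambda(V_{jk})=\lambda_{jk}I$. A continuous field of $C^*$-algebras over a compact Hausdorff space $T$ with fibers $\mathcal{A}_\lambda$ is given by a $^*$-algebra $\Gamma$ of sections (under pointwise operations) such that $\lambda\mapsto\|x(\lambda)\|$ is continuous for each $x\in\Gamma$, $\{x(\lambda):x\in\Gamma\}$ is dense in $\mathcal{A}_\lambda$ for each $\lambda$, and $\Gamma$ contains every section that is locally uniformly approximable by elements of $\Gamma$. It is full if $\{x(\lambda):x\in\Gamma\}=\mathcal{A}_\lambda$ for each $\lambda\in T$. The associated $C^*$-algebra is $\Gamma$ with the supremum norm. *)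

theory Defs
  imports "HOL-Analysis.Analysis" "HOL-Algebra.Algebraic_Closure_Type"
begin

section \<open>Unital C*-algebras\<close>

record 'a cstar = "(complex, 'a) module" +
  adjoint_of :: "'a \<Rightarrow> 'a"  (\<open>adj\<index> _\<close> [81] 80)
  norm_of :: "'a \<Rightarrow> real"  (\<open>nrm\<index> _\<close> [81] 80)

text \<open>
  All C*-algebras here are unital and all *-homomorphisms preserve the unit: the algebras
  concerned are generated by unitaries. The scalars are the library's ring structure on the
  type \<^typ>\<open>complex\<close>. The zero algebra is allowed.
\<close>

locale cstar_algebra =
  ring A + module "ring_of_type_algebra :: complex ring" A
  for A :: "'a cstar" (structure) +
  assumes smult_mult_left:
      "\<lbrakk>x \<in> carrier A; y \<in> carrier A\<rbrakk> \<Longrightarrow> c \<odot> (x \<otimes> y) = (c \<odot> x) \<otimes> y"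
    and smult_mult_right:
      "\<lbrakk>x \<in> carrier A; y \<in> carrier A\<rbrakk> \<Longrightarrow> c \<odot> (x \<otimes> y) = x \<otimes> (c \<odot> y)"
    and adj_closed: "x \<in> carrier A \<Longrightarrow> adj x \<in> carrier A"
    and adj_adj: "x \<in> carrier A \<Longrightarrow> adj (adj x) = x"
    and adj_add: "\<lbrakk>x \<in> carrier A; y \<in> carrier A\<rbrakk> \<Longrightarrow> adj (x \<oplus> y) = adj x \<oplus> adj y"
    and adj_smult: "x \<in> carrier A \<Longrightarrow> adj (c \<odot> x) = cnj c \<odot> adj x"
    and adj_mult: "\<lbrakk>x \<in> carrier A; y \<in> carrier A\<rbrakk> \<Longrightarrow> adj (x \<otimes> y) = adj y \<otimes> adj x"
    and nrm_eq_0_iff: "x \<in> carrier A \<Longrightarrow> nrm x = 0 \<longleftrightarrow> x = \<zero>"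
    and nrm_triangle: "\<lbrakk>x \<in> carrier A; y \<in> carrier A\<rbrakk> \<Longrightarrow> nrm (x \<oplus> y) \<le> nrm x + nrm y"
    and nrm_smult: "x \<in> carrier A \<Longrightarrow> nrm (c \<odot> x) = cmod c * nrm x"
    and nrm_mult: "\<lbrakk>x \<in> carrier A; y \<in> carrier A\<rbrakk> \<Longrightarrow> nrm (x \<otimes> y) \<le> nrm x * nrm y"
    and cstar_identity: "x \<in> carrier A \<Longrightarrow> nrm (adj x \<otimes> x) = (nrm x)\<^sup>2"
    and nrm_complete:
      "\<lbrakk>range s \<subseteq> carrier A;
        \<And>e. e > 0 \<Longrightarrow> \<exists>N::nat. \<forall>i\<ge>N. \<forall>j\<ge>N. nrm (s i \<ominus> s j) < e\<rbrakk>
       \<Longrightarrow> \<exists>l\<in>carrier A. (\<lambda>i. nrm (s i \<ominus> l)) \<longlonglongrightarrow> 0"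

definition star_hom :: "'a cstar \<Rightarrow> 'b cstar \<Rightarrow> ('a \<Rightarrow> 'b) set" where
  "star_hom A B =
     {h \<in> ring_hom A B.
        (\<forall>c. \<forall>x\<in>carrier A. h (c \<odot>\<^bsub>A\<^esub> x) = c \<odot>\<^bsub>B\<^esub> h x) \<and>
        (\<forall>x\<in>carrier A. h (adj\<^bsub>A\<^esub> x) = adj\<^bsub>B\<^esub> (h x))}"

definition star_iso :: "'a cstar \<Rightarrow> 'b cstar \<Rightarrow> ('a \<Rightarrow> 'b) set" where
  "star_iso A B = {h \<in> star_hom A B. bij_betw h (carrier A) (carrier B)}"

definition cstar_subalgebra :: "'a set \<Rightarrow> 'a cstar \<Rightarrow> bool" where
  "cstar_subalgebra D A \<longleftrightarrow>
     D \<subseteq> carrier A \<and> \<one>\<^bsub>A\<^esub> \<in> D \<and>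
     (\<forall>x\<in>D. \<forall>y\<in>D. x \<oplus>\<^bsub>A\<^esub> y \<in> D \<and> x \<otimes>\<^bsub>A\<^esub> y \<in> D) \<and>
     (\<forall>c. \<forall>x\<in>D. c \<odot>\<^bsub>A\<^esub> x \<in> D) \<and> (\<forall>x\<in>D. adj\<^bsub>A\<^esub> x \<in> D) \<and>
     (\<forall>s. \<forall>l\<in>carrier A.
        range s \<subseteq> D \<and> (\<lambda>i::nat. nrm\<^bsub>A\<^esub> (s i \<ominus>\<^bsub>A\<^esub> l)) \<longlonglongrightarrow> 0 \<longrightarrow> l \<in> D)"

definition cstar_generated :: "'a cstar \<Rightarrow> 'a set \<Rightarrow> bool" where
  "cstar_generated A S \<longleftrightarrow>
     S \<subseteq> carrier A \<and> (\<forall>D. cstar_subalgebra D A \<and> S \<subseteq> D \<longrightarrow> D = carrier A)"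

definition unitary_in :: "'a cstar \<Rightarrow> 'a \<Rightarrow> bool" where
  "unitary_in A u \<longleftrightarrow>
     u \<in> carrier A \<and> adj\<^bsub>A\<^esub> u \<otimes>\<^bsub>A\<^esub> u = \<one>\<^bsub>A\<^esub> \<and> u \<otimes>\<^bsub>A\<^esub> adj\<^bsub>A\<^esub> u = \<one>\<^bsub>A\<^esub>"

text \<open>The commutator $xyx^{-1}y^{-1}$, with inverses taken in the multiplicative monoid of \<open>A\<close>.\<close>

definition commutator :: "'a cstar \<Rightarrow> 'a \<Rightarrow> 'a \<Rightarrow> 'a" where
  "commutator A x y = x \<otimes>\<^bsub>A\<^esub> y \<otimes>\<^bsub>A\<^esub> inv\<^bsub>A\<^esub> x \<otimes>\<^bsub>A\<^esub> inv\<^bsub>A\<^esub> y"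


section \<open>The group C*-algebra of the free nilpotent group and noncommutative tori\<close>

definition pairs :: "nat \<Rightarrow> (nat \<times> nat) set" where
  "pairs n = {(j, k). 1 \<le> j \<and> j < k \<and> k \<le> n}"

text \<open>The points are functions on \<open>pairs n\<close>, extended by \<open>undefined\<close> off \<open>pairs n\<close>.\<close>

definition torus :: "nat \<Rightarrow> (nat \<times> nat \<Rightarrow> complex) topology" where
  "torus n = product_topology (\<lambda>_. top_of_set (sphere 0 1)) (pairs n)"

definition G_relations ::
  "nat \<Rightarrow> 'a cstar \<Rightarrow> (nat \<Rightarrow> 'a) \<Rightarrow> (nat \<times> nat \<Rightarrow> 'a) \<Rightarrow> bool" where
  "G_relations n A U V \<longleftrightarrow>
     (\<forall>i\<in>{1..n}. unitary_in A (U i)) \<and> (\<forall>p\<in>pairs n. unitary_in A (V p)) \<and>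
     (\<forall>p\<in>pairs n. \<forall>q\<in>pairs n. commutator A (V p) (V q) = \<one>\<^bsub>A\<^esub>) \<and>
     (\<forall>i\<in>{1..n}. \<forall>p\<in>pairs n. commutator A (U i) (V p) = \<one>\<^bsub>A\<^esub>) \<and>
     (\<forall>(j, k)\<in>pairs n. commutator A (U j) (U k) = V (j, k))"

definition torus_relations ::
  "nat \<Rightarrow> (nat \<times> nat \<Rightarrow> complex) \<Rightarrow> 'a cstar \<Rightarrow> (nat \<Rightarrow> 'a) \<Rightarrow> bool" where
  "torus_relations n \<theta> A W \<longleftrightarrow>
     (\<forall>i\<in>{1..n}. unitary_in A (W i)) \<and>
     (\<forall>(i, j)\<in>pairs n. commutator A (W i) (W j) = \<theta> (i, j) \<odot>\<^bsub>A\<^esub> \<one>\<^bsub>A\<^esub>)"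

text \<open>
  The universal C*-algebra on given generators and relations is described by its universal
  property, which determines it together with its generators up to a unique *-isomorphism.
  HOL cannot quantify over all types inside a formula, so the target algebras \<open>B\<close> below have
  their elements in the type \<^typ>\<open>nat set\<close>. Nothing is lost: a C*-algebra generated by finitely
  many elements has at most continuum many elements, so for an arbitrary target the
  C*-subalgebra generated by the images of the generators has an isomorphic copy of this kind.
  Uniqueness of the induced homomorphism follows from generation.
\<close>

definition is_group_cstar ::
  "nat \<Rightarrow> 'a cstar \<Rightarrow> (nat \<Rightarrow> 'a) \<Rightarrow> (nat \<times> nat \<Rightarrow> 'a) \<Rightarrow> bool" where
  "is_group_cstar n A U V \<longleftrightarrow>
     cstar_algebra A \<and> G_relations n A U V \<and>
     cstar_generated A (U ` {1..n} \<union> V ` pairs n) \<and>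
     (\<forall>(B :: nat set cstar) U' V'. cstar_algebra B \<and> G_relations n B U' V' \<longrightarrow>
        (\<exists>h\<in>star_hom A B. (\<forall>i\<in>{1..n}. h (U i) = U' i) \<and> (\<forall>p\<in>pairs n. h (V p) = V' p)))"

definition is_nc_torus ::
  "nat \<Rightarrow> (nat \<times> nat \<Rightarrow> complex) \<Rightarrow> 'a cstar \<Rightarrow> (nat \<Rightarrow> 'a) \<Rightarrow> bool" where
  "is_nc_torus n \<theta> A W \<longleftrightarrow>
     cstar_algebra A \<and> torus_relations n \<theta> A W \<and> cstar_generated A (W ` {1..n}) \<and>
     (\<forall>(B :: nat set cstar) W'. cstar_algebra B \<and> torus_relations n \<theta> B W' \<longrightarrow>
        (\<exists>h\<in>star_hom A B. \<forall>i\<in>{1..n}. h (W i) = W' i))"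

text \<open>
  The canonical map from the group C*-algebra to the noncommutative torus at \<open>\<theta>\<close>. Requiring
  extensionality makes it unique as a HOL function; its values on \<open>carrier A\<close> are determined
  by those on the generators.
\<close>

definition canonical_map ::
  "nat \<Rightarrow> 'a cstar \<Rightarrow> (nat \<Rightarrow> 'a) \<Rightarrow> (nat \<times> nat \<Rightarrow> 'a) \<Rightarrow>
   (nat \<times> nat \<Rightarrow> complex) \<Rightarrow> 'b cstar \<Rightarrow> (nat \<Rightarrow> 'b) \<Rightarrow> 'a \<Rightarrow> 'b" where
  "canonical_map n A U V \<theta> B W =
     (THE h. h \<in> star_hom A B \<and> h \<in> extensional (carrier A) \<and>
        (\<forall>i\<in>{1..n}. h (U i) = W i) \<and> (\<forall>p\<in>pairs n. h (V p) = \<theta> p \<odot>\<^bsub>B\<^esub> \<one>\<^bsub>B\<^esub>))"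


section \<open>Continuous fields of C*-algebras\<close>

definition sections :: "'t topology \<Rightarrow> ('t \<Rightarrow> 'b cstar) \<Rightarrow> ('t \<Rightarrow> 'b) set" where
  "sections T F = (\<Pi>\<^sub>E t\<in>topspace T. carrier (F t))"

text \<open>
  The supremum below is only meaningful when the norm functions of the members of \<open>\<Gamma>\<close> are
  bounded, as they are for a continuous field over a compact space.
\<close>

definition field_algebra ::
  "'t topology \<Rightarrow> ('t \<Rightarrow> 'b cstar) \<Rightarrow> ('t \<Rightarrow> 'b) set \<Rightarrow> ('t \<Rightarrow> 'b) cstar" where
  "field_algebra T F \<Gamma> =
     \<lparr>carrier = \<Gamma>,
      mult = (\<lambda>x y. \<lambda>t\<in>topspace T. x t \<otimes>\<^bsub>F t\<^esub> y t),
      one = (\<lambda>t\<in>topspace T. \<one>\<^bsub>F t\<^esub>),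
      zero = (\<lambda>t\<in>topspace T. \<zero>\<^bsub>F t\<^esub>),
      add = (\<lambda>x y. \<lambda>t\<in>topspace T. x t \<oplus>\<^bsub>F t\<^esub> y t),
      smult = (\<lambda>c x. \<lambda>t\<in>topspace T. c \<odot>\<^bsub>F t\<^esub> x t),
      adjoint_of = (\<lambda>x. \<lambda>t\<in>topspace T. adj\<^bsub>F t\<^esub> (x t)),
      norm_of = (\<lambda>x. SUP t\<in>topspace T. nrm\<^bsub>F t\<^esub> (x t))\<rparr>"

locale continuous_field =
  fixes T :: "'t topology" and F :: "'t \<Rightarrow> 'b cstar" and \<Gamma> :: "('t \<Rightarrow> 'b) set"
  assumes base_compact: "compact_space T"
    and base_Hausdorff: "Hausdorff_space T"
    and fiber_cstar: "t \<in> topspace T \<Longrightarrow> cstar_algebra (F t)"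
    and sections: "\<Gamma> \<subseteq> sections T F"
    and zero_section: "(\<lambda>t\<in>topspace T. \<zero>\<^bsub>F t\<^esub>) \<in> \<Gamma>"
    and add_section: "\<lbrakk>x \<in> \<Gamma>; y \<in> \<Gamma>\<rbrakk> \<Longrightarrow> (\<lambda>t\<in>topspace T. x t \<oplus>\<^bsub>F t\<^esub> y t) \<in> \<Gamma>"
    and mult_section: "\<lbrakk>x \<in> \<Gamma>; y \<in> \<Gamma>\<rbrakk> \<Longrightarrow> (\<lambda>t\<in>topspace T. x t \<otimes>\<^bsub>F t\<^esub> y t) \<in> \<Gamma>"
    and smult_section: "x \<in> \<Gamma> \<Longrightarrow> (\<lambda>t\<in>topspace T. c \<odot>\<^bsub>F t\<^esub> x t) \<in> \<Gamma>"
    and adj_section: "x \<in> \<Gamma> \<Longrightarrow> (\<lambda>t\<in>topspace T. adj\<^bsub>F t\<^esub> (x t)) \<in> \<Gamma>"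
    and nrm_continuous: "x \<in> \<Gamma> \<Longrightarrow> continuous_map T euclideanreal (\<lambda>t. nrm\<^bsub>F t\<^esub> (x t))"
    and dense: "\<lbrakk>t \<in> topspace T; b \<in> carrier (F t); e > 0\<rbrakk>
      \<Longrightarrow> \<exists>x\<in>\<Gamma>. nrm\<^bsub>F t\<^esub> (x t \<ominus>\<^bsub>F t\<^esub> b) < e"
    and locally_approximable:
      "\<lbrakk>x \<in> sections T F;
        \<And>t e. \<lbrakk>t \<in> topspace T; e > 0\<rbrakk>
          \<Longrightarrow> \<exists>y\<in>\<Gamma>. \<exists>N. openin T N \<and> t \<in> N \<and> (\<forall>s\<in>N. nrm\<^bsub>F s\<^esub> (x s \<ominus>\<^bsub>F s\<^esub> y s) < e)\<rbrakk>
       \<Longrightarrow> x \<in> \<Gamma>"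

locale full_continuous_field = continuous_field +
  assumes full: "t \<in> topspace T \<Longrightarrow> (\<lambda>x. x t) ` \<Gamma> = carrier (F t)"

end

theory Submission
  imports Defs "HOL-Real_Asymp.Real_Asymp"
begin

text \<open>
  Every element of a dense subalgebra of \<open>A\<close> is a combination of the normal forms
  \<open>v\<^sup>l u\<^sup>k\<close> with exponents in a box of size \<open>r\<close>, and the number of these grows polynomially
  with \<open>r\<close>. The regular representation of the noncommutative torus on square-summable families
  bounds each coefficient of \<open>\<pi>\<^sub>\<theta> x\<close>, a trigonometric polynomial in \<open>\<theta>\<close>, by the norm of
  \<open>\<pi>\<^sub>\<theta> x\<close>, and averaging over roots of unity does the same for the coefficients of \<open>x\<close>. So
  the norm of \<open>x\<close> and the supremum of the norms of the \<open>\<pi>\<^sub>\<theta> x\<close> agree up to a polynomial factor in \<open>r\<close>;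
  applying this to the \<open>2\<^sup>j\<close>-th power of \<open>x\<^sup>* x\<close> and taking roots removes the factor, so that
  \<open>a \<mapsto> \<pi>\<^sub>\<theta> a\<close> is jointly isometric. The same estimate in a single fibre exhibits the norm of
  \<open>\<pi>\<^sub>\<theta> x\<close> as a uniform limit of continuous functions of \<open>\<theta>\<close>. By the Stone--Weierstrass theorem
  the centre of \<open>A\<close> realizes all continuous functions on the torus; multiplying by them gives
  surjectivity onto the fibres, and partitions of unity give completeness under local uniform
  approximation.
\<close>

section \<open>C*-algebras with complex scalars\<close>

text \<open>The norm of \<open>A\<close> comes from a universal property and has no formula, so it
  is compared with quantities that do: the largest modulus among the coefficients of a combination
  of words from below, the sum of the moduli from above, the words being unitary. The two differ by
  at most the number of exponents. Nilpotency of class 2 keeps that number polynomial: reordering a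
  product creates central exponents that are bilinear in the others, hence boxes of size
  \<open>r\<close> for the \<open>u\<close> and of size quadratic in \<open>r\<close> for the
  \<open>v\<close>. Two obstacles shape the rest. The universal properties speak only of targets
  with elements in \<open>nat set\<close>, while the regular representation acts on another type; a
  separable subalgebra of the target is therefore copied to sets of naturals. And an approximate
  preimage in a fibre says nothing about norms in \<open>A\<close>; central functions cut the norm
  of a lift down to a bound valid in the chosen fibre, so that Cauchy sequences lift. Passages to
  the limit rest on contractivity of *-homomorphisms, which is derived from unitaries of prescribed
  real part.\<close>

text \<open>
  Inside the locale of C*-algebras the unqualified ring facts refer to the ring of scalars. This
  variant states the module axioms in terms of the type of complex numbers instead.
\<close>

locale star_algebra = ring A for A :: "'a cstar" (structure) +
  assumes smult_closed [simp, intro]: "x \<in> carrier A \<Longrightarrow> c \<odot> x \<in> carrier A"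
    and smult_add_left: "x \<in> carrier A \<Longrightarrow> (c + d) \<odot> x = c \<odot> x \<oplus> d \<odot> x"
    and smult_add_right:
      "\<lbrakk>x \<in> carrier A; y \<in> carrier A\<rbrakk> \<Longrightarrow> c \<odot> (x \<oplus> y) = c \<odot> x \<oplus> c \<odot> y"
    and smult_smult: "x \<in> carrier A \<Longrightarrow> c \<odot> (d \<odot> x) = (c * d) \<odot> x"
    and smult_one [simp]: "x \<in> carrier A \<Longrightarrow> 1 \<odot> x = x"
    and smult_mult_left:
      "\<lbrakk>x \<in> carrier A; y \<in> carrier A\<rbrakk> \<Longrightarrow> (c \<odot> x) \<otimes> y = c \<odot> (x \<otimes> y)"
    and smult_mult_right:
      "\<lbrakk>x \<in> carrier A; y \<in> carrier A\<rbrakk> \<Longrightarrow> x \<otimes> (c \<odot> y) = c \<odot> (x \<otimes> y)"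
    and adj_closed [simp, intro]: "x \<in> carrier A \<Longrightarrow> adj x \<in> carrier A"
    and adj_adj [simp]: "x \<in> carrier A \<Longrightarrow> adj (adj x) = x"
    and adj_add: "\<lbrakk>x \<in> carrier A; y \<in> carrier A\<rbrakk> \<Longrightarrow> adj (x \<oplus> y) = adj x \<oplus> adj y"
    and adj_smult: "x \<in> carrier A \<Longrightarrow> adj (c \<odot> x) = cnj c \<odot> adj x"
    and adj_mult: "\<lbrakk>x \<in> carrier A; y \<in> carrier A\<rbrakk> \<Longrightarrow> adj (x \<otimes> y) = adj y \<otimes> adj x"
    and nrm_eq_0_iff: "x \<in> carrier A \<Longrightarrow> nrm x = 0 \<longleftrightarrow> x = \<zero>"
    and nrm_triangle: "\<lbrakk>x \<in> carrier A; y \<in> carrier A\<rbrakk> \<Longrightarrow> nrm (x \<oplus> y) \<le> nrm x + nrm y"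
    and nrm_smult: "x \<in> carrier A \<Longrightarrow> nrm (c \<odot> x) = cmod c * nrm x"
    and nrm_mult: "\<lbrakk>x \<in> carrier A; y \<in> carrier A\<rbrakk> \<Longrightarrow> nrm (x \<otimes> y) \<le> nrm x * nrm y"
    and cstar_identity: "x \<in> carrier A \<Longrightarrow> nrm (adj x \<otimes> x) = (nrm x)\<^sup>2"
    and nrm_complete:
      "\<lbrakk>range s \<subseteq> carrier A;
        \<And>e. e > 0 \<Longrightarrow> \<exists>N::nat. \<forall>i\<ge>N. \<forall>j\<ge>N. nrm (s i \<ominus> s j) < e\<rbrakk>
       \<Longrightarrow> \<exists>l\<in>carrier A. (\<lambda>i. nrm (s i \<ominus> l)) \<longlonglongrightarrow> 0"

lemma cstar_algebra_iff_star_algebra: "cstar_algebra A \<longleftrightarrow> star_algebra A"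
proof
  assume C: "cstar_algebra A"
  then interpret C: cstar_algebra A .
  note scalars = ring_of_type_algebra_def
  have m1: "c \<odot>\<^bsub>A\<^esub> x \<in> carrier A" if "x \<in> carrier A" for c x
    using C.smult_closed[of c x] that by (simp add: scalars)
  have m2: "(c + d) \<odot>\<^bsub>A\<^esub> x = c \<odot>\<^bsub>A\<^esub> x \<oplus>\<^bsub>A\<^esub> d \<odot>\<^bsub>A\<^esub> x" if "x \<in> carrier A" for c d x
    using C.smult_l_distr[of c d x] that by (simp add: scalars)
  have m3: "c \<odot>\<^bsub>A\<^esub> (x \<oplus>\<^bsub>A\<^esub> y) = c \<odot>\<^bsub>A\<^esub> x \<oplus>\<^bsub>A\<^esub> c \<odot>\<^bsub>A\<^esub> y"
    if "x \<in> carrier A" "y \<in> carrier A" for c x y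
    using C.smult_r_distr[of c x y] that by (simp add: scalars)
  have m4: "c \<odot>\<^bsub>A\<^esub> (d \<odot>\<^bsub>A\<^esub> x) = (c * d) \<odot>\<^bsub>A\<^esub> x" if "x \<in> carrier A" for c d x
    using C.smult_assoc1[of c d x] that by (simp add: scalars)
  have m5: "1 \<odot>\<^bsub>A\<^esub> x = x" if "x \<in> carrier A" for x
    using C.smult_one[of x] that by (simp add: scalars)
  show "star_algebra A"
  proof (intro star_algebra.intro star_algebra_axioms.intro)
    show "ring A" by (rule cstar_algebra.axioms(1)[OF C])
  qed ((rule m1 m2 m3 m4 m5 C.smult_mult_left[symmetric] C.smult_mult_right[symmetric]
        C.adj_closed C.adj_adj C.adj_add C.adj_smult C.adj_mult C.nrm_eq_0_iff C.nrm_triangle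
        C.nrm_smult C.nrm_mult C.cstar_identity C.nrm_complete; assumption)+)
next
  assume "star_algebra A"
  then interpret C: star_algebra A .
  show "cstar_algebra A"
  proof (intro cstar_algebra.intro cstar_algebra_axioms.intro)
    show "module (ring_of_type_algebra :: complex ring) A"
    proof (rule moduleI)
      show "cring (ring_of_type_algebra :: complex ring)" by (rule cring_from_type_algebra)
      show "abelian_group A" by (rule C.abelian_group_axioms)
    qed (simp_all add: ring_of_type_algebra_def C.smult_add_left C.smult_add_right C.smult_smult)
    show "ring A" by (rule C.ring_axioms)
  qed ((rule C.smult_mult_left[symmetric] C.smult_mult_right[symmetric] C.adj_closed C.adj_adj C.adj_add C.adj_smult
      C.adj_mult C.nrm_eq_0_iff C.nrm_triangle C.nrm_smult C.nrm_mult C.cstar_identity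
      C.nrm_complete; assumption)+)
qed

context star_algebra
begin

lemma smult_zero_left [simp]: "x \<in> carrier A \<Longrightarrow> 0 \<odot> x = \<zero>"
  using smult_add_left[of x 0 0] by (metis add.l_cancel_one' add.one_closed add_0 r_zero smult_closed)

lemma smult_zero_right [simp]: "c \<odot> \<zero> = \<zero>"
  using smult_smult[of \<zero> c 0] by simp

lemma smult_uminus: "x \<in> carrier A \<Longrightarrow> (- c) \<odot> x = \<ominus> (c \<odot> x)"
  using smult_add_left[of x c "-c"] by (metis minus_unique add.inv_comm
      ab_left_minus add.m_comm minus_equality smult_add_left smult_closed smult_zero_left)

lemma smult_minus_one: "x \<in> carrier A \<Longrightarrow> (- 1) \<odot> x = \<ominus> x"
  by (simp add: smult_uminus)

lemma smult_a_inv: "x \<in> carrier A \<Longrightarrow> c \<odot> (\<ominus> x) = \<ominus> (c \<odot> x)"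
  by (metis mult_minus1_right smult_minus_one smult_smult smult_uminus)

lemma smult_diff_right:
  "\<lbrakk>x \<in> carrier A; y \<in> carrier A\<rbrakk> \<Longrightarrow> c \<odot> (x \<ominus> y) = c \<odot> x \<ominus> c \<odot> y"
  by (simp add: minus_eq smult_add_right smult_a_inv)

lemma smult_diff_left: "x \<in> carrier A \<Longrightarrow> (c - d) \<odot> x = c \<odot> x \<ominus> d \<odot> x"
  using smult_add_left[of x c "-d"] by (simp add: minus_eq smult_uminus)

lemma nrm_zero [simp]: "nrm \<zero> = 0"
  by (simp add: nrm_eq_0_iff)

lemma nrm_a_inv [simp]: "x \<in> carrier A \<Longrightarrow> nrm (\<ominus> x) = nrm x"
  using nrm_smult[of x "-1"] by (simp add: smult_minus_one)

lemma nrm_nonneg [simp]: "x \<in> carrier A \<Longrightarrow> 0 \<le> nrm x"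
  using nrm_triangle[of x "\<ominus> x"] by (simp add: r_neg)

lemma nrm_minus_commute: "\<lbrakk>x \<in> carrier A; y \<in> carrier A\<rbrakk> \<Longrightarrow> nrm (x \<ominus> y) = nrm (y \<ominus> x)"
  using nrm_a_inv[of "y \<ominus> x"] by (simp add: minus_eq minus_add a_comm)

lemma diff_add_cancel_middle:
  "\<lbrakk>x \<in> carrier A; y \<in> carrier A; z \<in> carrier A\<rbrakk> \<Longrightarrow> (x \<ominus> y) \<oplus> (y \<ominus> z) = x \<ominus> z"
  by (simp add: minus_eq a_assoc r_neg1)

lemma nrm_triangle_middle:
  "\<lbrakk>x \<in> carrier A; y \<in> carrier A; z \<in> carrier A\<rbrakk> \<Longrightarrow> nrm (x \<ominus> z) \<le> nrm (x \<ominus> y) + nrm (y \<ominus> z)"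
  using nrm_triangle[of "x \<ominus> y" "y \<ominus> z"] by (simp add: diff_add_cancel_middle)

lemma nrm_diff_le: "\<lbrakk>x \<in> carrier A; y \<in> carrier A\<rbrakk> \<Longrightarrow> \<bar>nrm x - nrm y\<bar> \<le> nrm (x \<ominus> y)"
proof -
  assume xy: "x \<in> carrier A" "y \<in> carrier A"
  have "(x \<ominus> y) \<oplus> y = x" "(y \<ominus> x) \<oplus> x = y"
    using xy by (simp_all add: minus_eq a_assoc l_neg)
  then show ?thesis
    using nrm_triangle[of "x \<ominus> y" y] nrm_triangle[of "y \<ominus> x" x] nrm_minus_commute[of x y] xy
    by (simp add: abs_le_iff)
qed

lemma adj_zero [simp]: "adj \<zero> = \<zero>"
  using adj_smult[of \<zero> 0] by simp

lemma adj_a_inv: "x \<in> carrier A \<Longrightarrow> adj (\<ominus> x) = \<ominus> (adj x)"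
  using adj_smult[of x "-1"] by (simp add: smult_minus_one)

lemma adj_diff: "\<lbrakk>x \<in> carrier A; y \<in> carrier A\<rbrakk> \<Longrightarrow> adj (x \<ominus> y) = adj x \<ominus> adj y"
  by (simp add: minus_eq adj_add adj_a_inv)

lemma adj_one [simp]: "adj \<one> = \<one>"
  using adj_mult[of "adj \<one>" \<one>, symmetric] by simp

text \<open>The C*-identity and submultiplicativity bound the square of \<open>nrm y\<close> by
  \<open>nrm (adj y) * nrm y\<close>, and a factor \<open>nrm y\<close> cancels. Applied to
  \<open>adj y\<close> as well, this makes \<open>adj\<close> isometric.\<close>

lemma nrm_le_nrm_adj:
  assumes y: "y \<in> carrier A"
  shows "nrm y \<le> nrm (adj y)"
proof (cases "nrm y = 0")
  case True
  show ?thesis using nrm_nonneg[OF adj_closed[OF y]] unfolding True .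
next
  case False
  then have pos: "nrm y > 0" using nrm_nonneg[OF y] by linarith
  have "(nrm y)\<^sup>2 \<le> nrm (adj y) * nrm y"
    using nrm_mult[OF adj_closed[OF y] y] by (simp only: cstar_identity[OF y])
  then have "nrm y * nrm y \<le> nrm (adj y) * nrm y" by (simp only: power2_eq_square)
  then show ?thesis using pos by (rule mult_right_le_imp_le)
qed

lemma nrm_adj [simp]:
  assumes "x \<in> carrier A"
  shows "nrm (adj x) = nrm x"
proof (rule antisym)
  show "nrm (adj x) \<le> nrm x"
    using nrm_le_nrm_adj[OF adj_closed[OF assms]] by (simp only: adj_adj[OF assms])
  show "nrm x \<le> nrm (adj x)" by (rule nrm_le_nrm_adj[OF assms])
qed

lemma nrm_one_le: "nrm \<one> \<le> 1"
proof -
  have "(nrm \<one>)\<^sup>2 = nrm \<one>" using cstar_identity[of \<one>, symmetric] by simp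
  then have "nrm \<one> = 0 \<or> nrm \<one> = 1" by (simp add: power2_eq_square)
  then show ?thesis by auto
qed

lemma unitary_nrm_le: "unitary_in A u \<Longrightarrow> nrm u \<le> 1"
  using cstar_identity[of u] nrm_one_le power_le_one_iff[of "nrm u" 2] unfolding unitary_in_def
  by auto

lemma nrm_pow_selfadjoint:
  assumes "x \<in> carrier A" "adj x = x"
  shows "nrm (x \<otimes> x) = (nrm x)\<^sup>2"
  using cstar_identity[of x] assms by simp

subsection \<open>Limits\<close>

text \<open>The algebra is a record and not a type with a topology, so convergence is stated through
  \<open>nrm\<close>. Membership in the carrier is built in, which frees the limit laws from side
  conditions.\<close>

definition tends :: "(nat \<Rightarrow> 'a) \<Rightarrow> 'a \<Rightarrow> bool" where
  "tends s l \<longleftrightarrow> range s \<subseteq> carrier A \<and> l \<in> carrier A \<and> (\<lambda>i. nrm (s i \<ominus> l)) \<longlonglongrightarrow> 0"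

lemma tendsI:
  assumes "\<And>i. s i \<in> carrier A" "l \<in> carrier A" "\<And>i. nrm (s i \<ominus> l) \<le> f i" "f \<longlonglongrightarrow> 0"
  shows "tends s l"
proof -
  have "(\<lambda>i. nrm (s i \<ominus> l)) \<longlonglongrightarrow> 0"
    by (rule tendsto_sandwich[OF _ _ tendsto_const assms(4)])
      (use assms in simp_all)
  then show ?thesis using assms unfolding tends_def by blast
qed

lemma tends_carrier: "tends s l \<Longrightarrow> l \<in> carrier A" "tends s l \<Longrightarrow> s i \<in> carrier A"
  by (auto simp: tends_def)

lemma tends_const: "x \<in> carrier A \<Longrightarrow> tends (\<lambda>_. x) x"
  by (auto simp: tends_def r_neg minus_eq)

lemma tends_unique:
  assumes "tends s l" "tends s m"
  shows "l = m"
proof -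
  note c = tends_carrier[OF assms(1)] tends_carrier[OF assms(2)]
  have "(\<lambda>i. nrm (s i \<ominus> l) + nrm (s i \<ominus> m)) \<longlonglongrightarrow> 0 + 0"
    using assms unfolding tends_def by (intro tendsto_add) auto
  moreover have "nrm (l \<ominus> m) \<le> nrm (s i \<ominus> l) + nrm (s i \<ominus> m)" for i
    using nrm_triangle_middle[of l "s i" m] nrm_minus_commute[of l "s i"] c by simp
  ultimately have "nrm (l \<ominus> m) \<le> 0"
    by (intro LIMSEQ_le_const[where X="\<lambda>i. nrm (s i \<ominus> l) + nrm (s i \<ominus> m)"]) auto
  then have "nrm (l \<ominus> m) = 0" using c nrm_nonneg[of "l \<ominus> m"] by fastforce
  then have "l \<ominus> m = \<zero>" using c nrm_eq_0_iff[of "l \<ominus> m"] by simp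
  then show ?thesis using c by simp
qed

lemma tends_add:
  assumes "tends s l" "tends t m"
  shows "tends (\<lambda>i. s i \<oplus> t i) (l \<oplus> m)"
proof (rule tendsI)
  note c[simp] = tends_carrier[OF assms(1)] tends_carrier[OF assms(2)]
  have "(\<lambda>i. nrm (s i \<ominus> l) + nrm (t i \<ominus> m)) \<longlonglongrightarrow> 0 + 0"
    using assms unfolding tends_def by (intro tendsto_add) auto
  then show "(\<lambda>i. nrm (s i \<ominus> l) + nrm (t i \<ominus> m)) \<longlonglongrightarrow> 0" by simp
  fix i
  have "(s i \<oplus> t i) \<ominus> (l \<oplus> m) = (s i \<ominus> l) \<oplus> (t i \<ominus> m)"
    by (simp add: minus_eq minus_add a_ac)
  then show "nrm ((s i \<oplus> t i) \<ominus> (l \<oplus> m)) \<le> nrm (s i \<ominus> l) + nrm (t i \<ominus> m)"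
    by (simp add: nrm_triangle)
qed (use tends_carrier[OF assms(1)] tends_carrier[OF assms(2)] in auto)

lemma tends_smult:
  assumes "tends s l"
  shows "tends (\<lambda>i. c \<odot> s i) (c \<odot> l)"
proof (rule tendsI)
  note c[simp] = tends_carrier[OF assms(1)]
  show "(\<lambda>i. cmod c * nrm (s i \<ominus> l)) \<longlonglongrightarrow> 0"
    using assms unfolding tends_def by (auto intro: tendsto_mult_right_zero)
  show "nrm (c \<odot> s i \<ominus> c \<odot> l) \<le> cmod c * nrm (s i \<ominus> l)" for i
    by (simp add: smult_diff_right[symmetric] nrm_smult)
qed (use tends_carrier[OF assms(1)] in auto)

lemma tends_adj:
  assumes "tends s l"
  shows "tends (\<lambda>i. adj (s i)) (adj l)"
proof (rule tendsI)
  note c[simp] = tends_carrier[OF assms(1)]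
  show "(\<lambda>i. nrm (s i \<ominus> l)) \<longlonglongrightarrow> 0"
    using assms unfolding tends_def by auto
  show "nrm (adj (s i) \<ominus> adj l) \<le> nrm (s i \<ominus> l)" for i
    by (simp add: adj_diff[symmetric])
qed (use tends_carrier[OF assms(1)] in auto)

lemma tends_nrm:
  assumes "tends s l"
  shows "(\<lambda>i. nrm (s i)) \<longlonglongrightarrow> nrm l"
proof (rule LIM_zero_cancel, rule tendsto_rabs_zero_cancel)
  note c[simp] = tends_carrier[OF assms(1)]
  have lim: "(\<lambda>i. nrm (s i \<ominus> l)) \<longlonglongrightarrow> 0" using assms unfolding tends_def by blast
  show "(\<lambda>i. \<bar>nrm (s i) - nrm l\<bar>) \<longlonglongrightarrow> 0"
    by (rule tendsto_sandwich[OF _ _ tendsto_const lim]) (simp_all add: nrm_diff_le)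
qed

text \<open>The telescoping identity behind both the continuity of the product and the contraction
  estimate for the square root.\<close>

lemma diff_mult_eq:
  "\<lbrakk>x \<in> carrier A; y \<in> carrier A; z \<in> carrier A; w \<in> carrier A\<rbrakk>
   \<Longrightarrow> x \<otimes> y \<ominus> z \<otimes> w = x \<otimes> (y \<ominus> w) \<oplus> (x \<ominus> z) \<otimes> w"
  by (simp add: minus_eq r_distr l_distr r_minus l_minus a_assoc r_neg1)

lemma tends_mult:
  assumes "tends s l" "tends t m"
  shows "tends (\<lambda>i. s i \<otimes> t i) (l \<otimes> m)"
proof (rule tendsI)
  note c[simp] = tends_carrier[OF assms(1)] tends_carrier[OF assms(2)]
  have "(\<lambda>i. nrm (s i) * nrm (t i \<ominus> m) + nrm (s i \<ominus> l) * nrm m) \<longlonglongrightarrow> nrm l * 0 + 0 * nrm m"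
    using assms tends_nrm[OF assms(1)] unfolding tends_def
    by (intro tendsto_add tendsto_mult) auto
  then show "(\<lambda>i. nrm (s i) * nrm (t i \<ominus> m) + nrm (s i \<ominus> l) * nrm m) \<longlonglongrightarrow> 0" by simp
  fix i
  show "nrm (s i \<otimes> t i \<ominus> l \<otimes> m) \<le> nrm (s i) * nrm (t i \<ominus> m) + nrm (s i \<ominus> l) * nrm m"
    using nrm_triangle[of "s i \<otimes> (t i \<ominus> m)" "(s i \<ominus> l) \<otimes> m"]
      nrm_mult[of "s i" "t i \<ominus> m"] nrm_mult[of "s i \<ominus> l" m]
    by (simp add: diff_mult_eq)
qed (use tends_carrier[OF assms(1)] tends_carrier[OF assms(2)] in auto)

text \<open>Telescoping bounds the distance from \<open>s i\<close> to any later term by the tail of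
  a geometric series. Limits are produced in this form below: for the square root, for lifts of
  uniform limits and for preimages in a fibre.\<close>

lemma geometric_tends:
  assumes s: "\<And>i. s i \<in> carrier A" and d: "\<And>i. nrm (s (Suc i) \<ominus> s i) \<le> C * q ^ i"
    and q: "0 \<le> q" "q < 1" 
  obtains l where "tends s l"
proof -
  have C: "0 \<le> C" using order_trans[OF nrm_nonneg d[of 0]] s by simp
  have tail: "nrm (s (i + k) \<ominus> s i) \<le> (\<Sum>j<k. C * q ^ (i + j))" for i k
  proof (induction k)
    case 0 then show ?case using s by (simp add: minus_eq r_neg)
  next
    case (Suc k)
    then show ?case
      using nrm_triangle_middle[of "s (i + Suc k)" "s (i + k)" "s i"] d[of "i+k"] s by simp
  qed
  have bound: "nrm (s (i + k) \<ominus> s i) \<le> C * q ^ i / (1 - q)" for i k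
  proof -
    have "(\<Sum>j<k. C * q ^ (i + j)) = C * q ^ i * (\<Sum>j<k. q ^ j)"
      by (simp add: sum_distrib_left power_add mult_ac)
    also have "\<dots> \<le> C * q ^ i * (1 / (1 - q))"
      using q C by (intro mult_left_mono) (auto simp: sum_gp_strict divide_right_mono)
    finally show ?thesis using tail[of i k] by simp
  qed
  have "(\<lambda>i. C * q ^ i / (1 - q)) \<longlonglongrightarrow> C * 0 / (1 - q)"
    using q by (intro tendsto_divide tendsto_mult tendsto_const LIMSEQ_realpow_zero) auto
  then have lim: "(\<lambda>i. C * q ^ i / (1 - q)) \<longlonglongrightarrow> 0" by simp
  have "\<exists>l\<in>carrier A. (\<lambda>i. nrm (s i \<ominus> l)) \<longlonglongrightarrow> 0"
  proof (rule nrm_complete)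
    fix e :: real assume "e > 0"
    then obtain N where N: "\<And>i. i \<ge> N \<Longrightarrow> C * q ^ i / (1 - q) < e / 2"
      using order_tendstoD(2)[OF lim, of "e/2"] by (auto simp: eventually_sequentially)
    show "\<exists>N. \<forall>i\<ge>N. \<forall>j\<ge>N. nrm (s i \<ominus> s j) < e"
    proof (intro exI[of _ N] allI impI)
      fix i j assume "N \<le> i" "N \<le> j"
      then have "nrm (s i \<ominus> s N) < e/2" "nrm (s j \<ominus> s N) < e/2"
        using le_less_trans[OF bound[of N "i-N"] N] le_less_trans[OF bound[of N "j-N"] N] by simp_all
      then show "nrm (s i \<ominus> s j) < e"
        using nrm_triangle_middle[of "s i" "s N" "s j"] nrm_minus_commute[of "s N" "s j"] s by simp
    qed
  qed (use s in auto)
  then show thesis using that s unfolding tends_def by blast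
qed

subsection \<open>Closures\<close>

definition cl :: "'a set \<Rightarrow> 'a set" where
  "cl Q = {x \<in> carrier A. \<forall>e>0. \<exists>q\<in>Q. nrm (q \<ominus> x) < e}"

lemma cl_iff:
  assumes "Q \<subseteq> carrier A"
  shows "x \<in> cl Q \<longleftrightarrow> (\<exists>s. range s \<subseteq> Q \<and> tends s x)"
proof
  assume x: "x \<in> cl Q"
  then have "\<forall>i. \<exists>q\<in>Q. nrm (q \<ominus> x) < 1 / real (Suc i)" unfolding cl_def by simp
  then obtain s where s: "\<And>i. s i \<in> Q" "\<And>i. nrm (s i \<ominus> x) < 1 / real (Suc i)" by metis
  have "tends s x"
    by (rule tendsI[where f="\<lambda>i. 1 / real (Suc i)"])
      (use s x assms LIMSEQ_Suc[OF lim_1_over_n[where 'a=real]] in \<open>auto simp: cl_def less_imp_le\<close>)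
  then show "\<exists>s. range s \<subseteq> Q \<and> tends s x" using s by blast
next
  assume "\<exists>s. range s \<subseteq> Q \<and> tends s x"
  then obtain s where s: "range s \<subseteq> Q" "tends s x" by blast
  have "\<exists>q\<in>Q. nrm (q \<ominus> x) < e" if "e > 0" for e
  proof -
    have "\<forall>\<^sub>F i in sequentially. nrm (s i \<ominus> x) < e"
      using s(2) that unfolding tends_def by (auto intro: order_tendstoD)
    then show ?thesis using s(1) by (auto simp: eventually_sequentially)
  qed
  then show "x \<in> cl Q" using s unfolding cl_def tends_def by auto
qed

lemma cl_superset: "Q \<subseteq> carrier A \<Longrightarrow> Q \<subseteq> cl Q"
  unfolding cl_def by (force simp: r_neg minus_eq)

lemma cl_cl: "Q \<subseteq> carrier A \<Longrightarrow> x \<in> carrier A \<Longrightarrow> (\<And>e. e > 0 \<Longrightarrow> \<exists>q\<in>cl Q. nrm (q \<ominus> x) < e) \<Longrightarrow> x \<in> cl Q"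
  unfolding cl_def
proof (intro CollectI conjI allI impI)
  fix e :: real
  assume Q: "Q \<subseteq> carrier A" and x: "x \<in> carrier A" and e: "e > 0"
    and *: "\<And>e. e > 0 \<Longrightarrow> \<exists>q\<in>{x \<in> carrier A. \<forall>e>0. \<exists>q\<in>Q. nrm (q \<ominus> x) < e}. nrm (q \<ominus> x) < e"
  obtain y where y: "y \<in> carrier A" "\<forall>e>0. \<exists>q\<in>Q. nrm (q \<ominus> y) < e" "nrm (y \<ominus> x) < e/2"
    using *[of "e/2"] e by auto
  obtain q where q: "q \<in> Q" "nrm (q \<ominus> y) < e/2" using y(2) e half_gt_zero by blast
  show "\<exists>q\<in>Q. nrm (q \<ominus> x) < e"
    using nrm_triangle_middle[of q y x] q y x Q by (intro bexI[of _ q]) auto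
qed

text \<open>Limits of sequences carry the operations over to the closure. For scalar multiples the
  closure itself is allowed as the target, because the set of values of countably many algebraic
  terms, one intended \<open>Q\<close>, admits only a dense sequence of scalars.\<close>

lemma cl_subalgebra:
  assumes Q: "Q \<subseteq> carrier A" and one: "\<one> \<in> Q"
    and add: "\<And>x y. \<lbrakk>x \<in> Q; y \<in> Q\<rbrakk> \<Longrightarrow> x \<oplus> y \<in> Q"
    and mult: "\<And>x y. \<lbrakk>x \<in> Q; y \<in> Q\<rbrakk> \<Longrightarrow> x \<otimes> y \<in> Q"
    and adj: "\<And>x. x \<in> Q \<Longrightarrow> adj x \<in> Q"
    and smult: "\<And>c x. x \<in> Q \<Longrightarrow> c \<odot> x \<in> cl Q"
  shows "cstar_subalgebra (cl Q) A"
  unfolding cstar_subalgebra_def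
proof (intro conjI ballI allI impI)
  show "cl Q \<subseteq> carrier A" unfolding cl_def by auto
  show "\<one> \<in> cl Q" using cl_superset[OF Q] one by auto
  show "x \<oplus> y \<in> cl Q" if xy: "x \<in> cl Q" "y \<in> cl Q" for x y
  proof -
    obtain s t where "range s \<subseteq> Q" "tends s x" "range t \<subseteq> Q" "tends t y"
      using xy unfolding cl_iff[OF Q] by blast
    then have "range (\<lambda>i. s i \<oplus> t i) \<subseteq> Q" "tends (\<lambda>i. s i \<oplus> t i) (x \<oplus> y)"
      using add by (simp_all add: image_subset_iff tends_add)
    then show ?thesis unfolding cl_iff[OF Q] by blast
  qed
  show "x \<otimes> y \<in> cl Q" if xy: "x \<in> cl Q" "y \<in> cl Q" for x y
  proof -
    obtain s t where "range s \<subseteq> Q" "tends s x" "range t \<subseteq> Q" "tends t y"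
      using xy unfolding cl_iff[OF Q] by blast
    then have "range (\<lambda>i. s i \<otimes> t i) \<subseteq> Q" "tends (\<lambda>i. s i \<otimes> t i) (x \<otimes> y)"
      using mult by (simp_all add: image_subset_iff tends_mult)
    then show ?thesis unfolding cl_iff[OF Q] by blast
  qed
  show "adj x \<in> cl Q" if xy: "x \<in> cl Q" for x
  proof -
    obtain s where "range s \<subseteq> Q" "tends s x"
      using xy unfolding cl_iff[OF Q] by blast
    then have "range (\<lambda>i. adj (s i)) \<subseteq> Q" "tends (\<lambda>i. adj (s i)) (adj x)"
      using adj by (simp_all add: image_subset_iff tends_adj)
    then show ?thesis unfolding cl_iff[OF Q] by blast
  qed
  have lim: "l \<in> cl Q" if s: "range s \<subseteq> cl Q" "l \<in> carrier A" "(\<lambda>i. nrm (s i \<ominus> l)) \<longlonglongrightarrow> 0" for s l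
  proof (rule cl_cl[OF Q])
    fix e :: real assume "e > 0"
    then have "\<forall>\<^sub>F i in sequentially. nrm (s i \<ominus> l) < e"
      using s(3) by (auto intro: order_tendstoD)
    then show "\<exists>q\<in>cl Q. nrm (q \<ominus> l) < e" using s(1) by (auto simp: eventually_sequentially)
  qed (use s in auto)
  then show "l \<in> cl Q" if "l \<in> carrier A" "range s \<subseteq> cl Q \<and> (\<lambda>i::nat. nrm (s i \<ominus> l)) \<longlonglongrightarrow> 0" for s l
    using that by blast
  show "c \<odot> x \<in> cl Q" if x: "x \<in> cl Q" for c x
  proof -
    obtain s where s: "range s \<subseteq> Q" "tends s x"
      using x unfolding cl_iff[OF Q] by blast
    then have "range (\<lambda>i. c \<odot> s i) \<subseteq> cl Q" using smult by auto
    then show ?thesis using tends_smult[OF s(2)] lim unfolding tends_def by blast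
  qed
qed

end

section \<open>Contractivity of *-homomorphisms\<close>

context star_algebra
begin

lemma two_smult: "x \<in> carrier A \<Longrightarrow> 2 \<odot> x = x \<oplus> x"
  using smult_add_left[of x 1 1] by simp

text \<open>
  The square root of \<open>1 - a\<^sup>2\<close> is \<open>1 - y\<close>, where \<open>y\<close> is the fixed point of
  the contraction \<open>y \<mapsto> (a\<^sup>2 + y\<^sup>2) / 2\<close> on a ball of radius less than 1.
\<close>

lemma sqrt_one_minus_square:
  assumes a: "a \<in> carrier A" "adj a = a" "nrm a < 1"
  obtains r where "r \<in> carrier A" "adj r = r" "r \<otimes> r \<oplus> a \<otimes> a = \<one>" "r \<otimes> a = a \<otimes> r"
proof -
  define t where "t = (nrm a)\<^sup>2"
  \<comment> \<open>The smaller root of \<open>s = (t + s * s) / 2\<close>: the iteration preserves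
    the ball of radius \<open>s\<close>, and since each step multiplies distances there by at most
    \<open>s\<close>, the same number is the contraction factor.\<close>
  define s where "s = 1 - sqrt (1 - t)"
  have t: "0 \<le> t" "t < 1" 
    using a by (simp_all add: t_def power_less_one_iff abs_square_less_1)
  then have s: "0 \<le> s" "s < 1" unfolding s_def by (auto simp: real_sqrt_le_1_iff)
  have st: "(t + s * s) / 2 = s"
  proof -
    have "sqrt (1 - t) * sqrt (1 - t) = 1 - t" using t by simp
    then show ?thesis unfolding s_def by (simp add: algebra_simps)
  qed
  define y where "y = rec_nat \<zero> (\<lambda>_ z. (1/2) \<odot> (a \<otimes> a \<oplus> z \<otimes> z))"
  have y0: "y 0 = \<zero>" and ySuc: "\<And>n. y (Suc n) = (1/2) \<odot> (a \<otimes> a \<oplus> y n \<otimes> y n)"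
    by (simp_all add: y_def)
  have yc[simp]: "y n \<in> carrier A" for n
    by (induction n) (use a in \<open>simp_all add: y0 ySuc\<close>)
  have ysa: "adj (y n) = y n" for n
    by (induction n) (use a in \<open>simp_all add: y0 ySuc adj_smult adj_add adj_mult\<close>)
  have ycomm: "y n \<otimes> a = a \<otimes> y n" for n
  proof (induction n)
    case (Suc n)
    have "y n \<otimes> y n \<otimes> a = a \<otimes> (y n \<otimes> y n)"
      using a Suc by (metis m_assoc yc)
    then show ?case using a
      by (simp add: ySuc smult_mult_left smult_mult_right l_distr r_distr m_assoc)
  qed (use a in \<open>simp add: y0\<close>)
  have aa: "nrm (a \<otimes> a) = t" using nrm_pow_selfadjoint[OF a(1,2)] by (simp add: t_def)
  have ynrm: "nrm (y n) \<le> s" for n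
  proof (induction n)
    case (Suc n)
    have "nrm (y n \<otimes> y n) \<le> nrm (y n) * nrm (y n)" by (simp add: nrm_mult)
    also have "\<dots> \<le> s * s" using Suc s by (intro mult_mono) auto
    finally have "nrm (a \<otimes> a \<oplus> y n \<otimes> y n) \<le> t + s * s"
      using nrm_triangle[of "a \<otimes> a" "y n \<otimes> y n"] a aa by simp
    then show ?case using a st by (simp add: ySuc nrm_smult)
  qed (use s in \<open>simp add: y0\<close>)
  have step: "nrm (y (Suc n) \<ominus> y n) \<le> nrm (y 1 \<ominus> y 0) * s ^ n" for n
  proof (induction n)
    case (Suc n)
    let ?d = "y (Suc n) \<ominus> y n"
    have "y (Suc (Suc n)) \<ominus> y (Suc n) = (1/2) \<odot> ((a \<otimes> a \<oplus> y (Suc n) \<otimes> y (Suc n)) \<ominus> (a \<otimes> a \<oplus> y n \<otimes> y n))"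
      using arg_cong2[OF ySuc[of "Suc n"] ySuc[of n], of "\<lambda>p q. p \<ominus> q"] a
      by (simp only: smult_diff_right m_closed add.m_closed yc)
    also have "(a \<otimes> a \<oplus> y (Suc n) \<otimes> y (Suc n)) \<ominus> (a \<otimes> a \<oplus> y n \<otimes> y n)
        = y (Suc n) \<otimes> y (Suc n) \<ominus> y n \<otimes> y n"
      using a by (simp add: minus_eq minus_add a_ac r_neg2 r_neg1 l_neg)
    also have "\<dots> = y (Suc n) \<otimes> ?d \<oplus> ?d \<otimes> y n" by (simp add: diff_mult_eq)
    finally have "nrm (y (Suc (Suc n)) \<ominus> y (Suc n)) = nrm (y (Suc n) \<otimes> ?d \<oplus> ?d \<otimes> y n) / 2"
      by (simp add: nrm_smult)
    also have "\<dots> \<le> (nrm (y (Suc n) \<otimes> ?d) + nrm (?d \<otimes> y n)) / 2"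
      by (simp add: nrm_triangle)
    also have "\<dots> \<le> (nrm (y (Suc n)) * nrm ?d + nrm ?d * nrm (y n)) / 2"
      using nrm_mult[of "y (Suc n)" ?d] nrm_mult[of ?d "y n"] by simp
    also have "\<dots> \<le> (s * nrm ?d + nrm ?d * s) / 2"
      using ynrm by (intro divide_right_mono add_mono mult_right_mono mult_left_mono) auto
    also have "\<dots> \<le> s * (nrm (y 1 \<ominus> y 0) * s ^ n)"
      using mult_left_mono[OF Suc s(1)] by simp
    finally show ?case by (simp add: mult_ac)
  qed simp
  obtain l where l: "tends y l" using geometric_tends[OF yc step s] by blast
  note lc[simp] = tends_carrier(1)[OF l]
  have lsa: "adj l = l"
    using tends_unique[OF tends_adj[OF l, unfolded ysa] l] .
  have lcomm: "l \<otimes> a = a \<otimes> l"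
    using tends_unique[OF tends_mult[OF l tends_const[OF a(1)], unfolded ycomm]
        tends_mult[OF tends_const[OF a(1)] l]] .
  have "tends (\<lambda>n. y (Suc n)) l"
    using l LIMSEQ_Suc[of "\<lambda>n. nrm (y n \<ominus> l)" 0] unfolding tends_def by auto
  moreover have "tends (\<lambda>n. y (Suc n)) ((1/2) \<odot> (a \<otimes> a \<oplus> l \<otimes> l))"
    unfolding ySuc using a(1) by (intro tends_smult tends_add tends_mult l tends_const) simp
  ultimately have "l = (1/2) \<odot> (a \<otimes> a \<oplus> l \<otimes> l)" by (rule tends_unique)
  then have "2 \<odot> l = 2 \<odot> ((1/2) \<odot> (a \<otimes> a \<oplus> l \<otimes> l))" by (rule arg_cong)
  then have l2: "l \<oplus> l = a \<otimes> a \<oplus> l \<otimes> l"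
    using a(1) by (simp add: smult_smult two_smult)
  \<comment> \<open>The square of \<open>\<one> \<ominus> l\<close> is
    \<open>\<one> \<ominus> (l \<oplus> l) \<oplus> l \<otimes> l\<close>, which the fixed point
    equation turns into \<open>\<one> \<ominus> a \<otimes> a\<close>.\<close>
  define r where "r = \<one> \<ominus> l"
  have rc: "r \<in> carrier A" by (simp add: r_def)
  have "r \<otimes> r \<oplus> a \<otimes> a = (r \<otimes> r \<ominus> l \<otimes> l) \<oplus> (a \<otimes> a \<oplus> l \<otimes> l)"
    using a(1) rc a_lcomm[of "l \<otimes> l" "r \<otimes> r" "\<ominus> (l \<otimes> l)"]
    by (simp add: minus_eq a_ac r_neg1 r_neg2 l_neg r_neg)
  also have "r \<otimes> r \<ominus> l \<otimes> l = r \<ominus> l"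
    by (simp add: r_def minus_eq l_distr r_distr l_minus r_minus minus_add a_ac r_neg1 r_neg2 l_neg r_neg)
  also have "(r \<ominus> l) \<oplus> (a \<otimes> a \<oplus> l \<otimes> l) = \<one>"
    unfolding l2[symmetric] by (simp add: r_def minus_eq a_ac r_neg1 r_neg2 l_neg r_neg)
  finally have sq: "r \<otimes> r \<oplus> a \<otimes> a = \<one>" .
  show thesis
  proof (rule that[OF rc _ sq])
    show "adj r = r" by (simp add: r_def adj_diff lsa)
    show "r \<otimes> a = a \<otimes> r"
      using a(1) lcomm by (simp add: r_def minus_eq l_distr r_distr l_minus r_minus)
  qed
qed

text \<open>The unitary is a + i r with r the square root of 1 minus the square of a; it is unitary
  because a and r commute and are self-adjoint. Norm bounds for self-adjoint elements are thereby
  reduced to the bound 1 for unitaries, which unital *-homomorphisms preserve.\<close>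

lemma unitary_with_real_part:
  assumes a: "a \<in> carrier A" "adj a = a" "nrm a < 1"
  obtains u where "unitary_in A u" "u \<oplus> adj u = 2 \<odot> a"
proof -
  obtain r where r: "r \<in> carrier A" "adj r = r" "r \<otimes> r \<oplus> a \<otimes> a = \<one>" "r \<otimes> a = a \<otimes> r"
    using sqrt_one_minus_square[OF a] .
  define b where "b = \<i> \<odot> r"
  have b: "b \<in> carrier A" "adj b = \<ominus> b" "a \<otimes> b = b \<otimes> a" 
    using r a by (simp_all add: b_def adj_smult smult_uminus smult_mult_left smult_mult_right)
  have bb: "\<ominus> (b \<otimes> b) = r \<otimes> r" 
    using r smult_minus_one[of "r \<otimes> r"]
    by (simp add: b_def smult_mult_left smult_mult_right smult_smult)
  have adj: "adj (a \<oplus> b) = a \<ominus> b" using a b by (simp add: adj_add minus_eq)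
  have one: "a \<otimes> a \<oplus> \<ominus> (b \<otimes> b) = \<one>" using r a by (simp add: bb a_comm)
  have "(a \<ominus> b) \<otimes> (a \<oplus> b) = a \<otimes> a \<oplus> \<ominus> (b \<otimes> b)"
    "(a \<oplus> b) \<otimes> (a \<ominus> b) = a \<otimes> a \<oplus> \<ominus> (b \<otimes> b)"
    using a b by (simp_all add: minus_eq l_distr r_distr l_minus r_minus minus_add a_ac r_neg1 r_neg2 l_neg)
  then have "unitary_in A (a \<oplus> b)" unfolding unitary_in_def adj one using a b by simp
  moreover have "(a \<oplus> b) \<oplus> adj (a \<oplus> b) = 2 \<odot> a"
    unfolding adj using a b by (simp add: two_smult minus_eq a_ac r_neg1 r_neg2 l_neg r_neg)
  ultimately show thesis by (rule that)
qed

end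

locale star_morphism = A: star_algebra A + B: star_algebra B
  for A :: "'a cstar" and B :: "'b cstar" and h +
  assumes star_hom: "h \<in> star_hom A B"
begin

lemma hom_closed [simp, intro]: "x \<in> carrier A \<Longrightarrow> h x \<in> carrier B"
  and hom_add: "\<lbrakk>x \<in> carrier A; y \<in> carrier A\<rbrakk> \<Longrightarrow> h (x \<oplus>\<^bsub>A\<^esub> y) = h x \<oplus>\<^bsub>B\<^esub> h y"
  and hom_mult: "\<lbrakk>x \<in> carrier A; y \<in> carrier A\<rbrakk> \<Longrightarrow> h (x \<otimes>\<^bsub>A\<^esub> y) = h x \<otimes>\<^bsub>B\<^esub> h y"
  and hom_one [simp]: "h \<one>\<^bsub>A\<^esub> = \<one>\<^bsub>B\<^esub>"
  and hom_smult: "x \<in> carrier A \<Longrightarrow> h (c \<odot>\<^bsub>A\<^esub> x) = c \<odot>\<^bsub>B\<^esub> h x"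
  and hom_adj: "x \<in> carrier A \<Longrightarrow> h (adj\<^bsub>A\<^esub> x) = adj\<^bsub>B\<^esub> (h x)"
  using star_hom unfolding star_hom_def by (auto simp: ring_hom_def)

lemma hom_zero [simp]: "h \<zero>\<^bsub>A\<^esub> = \<zero>\<^bsub>B\<^esub>"
  using hom_smult[of "\<zero>\<^bsub>A\<^esub>" 0] by simp

lemma hom_a_inv: "x \<in> carrier A \<Longrightarrow> h (\<ominus>\<^bsub>A\<^esub> x) = \<ominus>\<^bsub>B\<^esub> (h x)"
  using hom_smult[of x "-1"] by (simp add: A.smult_minus_one B.smult_minus_one)

lemma hom_diff: "\<lbrakk>x \<in> carrier A; y \<in> carrier A\<rbrakk> \<Longrightarrow> h (x \<ominus>\<^bsub>A\<^esub> y) = h x \<ominus>\<^bsub>B\<^esub> h y"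
  by (simp add: A.minus_eq B.minus_eq hom_add hom_a_inv)

lemma hom_unitary: "unitary_in A u \<Longrightarrow> unitary_in B (h u)"
  unfolding unitary_in_def by (metis hom_closed hom_adj hom_mult hom_one A.adj_closed)

text \<open>The image of a unitary with real part \<open>a\<close> is a unitary with real part
  \<open>h a\<close>, and the mean of two elements of norm at most 1 has norm at most 1.\<close>

lemma hom_nrm_selfadjoint_le_1:
  assumes a: "a \<in> carrier A" "adj\<^bsub>A\<^esub> a = a" "nrm\<^bsub>A\<^esub> a < 1"
  shows "nrm\<^bsub>B\<^esub> (h a) \<le> 1"
proof -
  obtain u where u: "unitary_in A u" "u \<oplus>\<^bsub>A\<^esub> adj\<^bsub>A\<^esub> u = 2 \<odot>\<^bsub>A\<^esub> a"
    using A.unitary_with_real_part[OF a] .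
  have uc: "u \<in> carrier A" using u(1) by (simp add: unitary_in_def)
  have "nrm\<^bsub>B\<^esub> (h u) \<le> 1" using hom_unitary[OF u(1)] B.unitary_nrm_le by blast
  moreover have "2 \<odot>\<^bsub>B\<^esub> h a = h u \<oplus>\<^bsub>B\<^esub> adj\<^bsub>B\<^esub> (h u)"
    using arg_cong[OF u(2), of h] uc a by (simp add: hom_add hom_smult hom_adj)
  moreover have "nrm\<^bsub>B\<^esub> (h u \<oplus>\<^bsub>B\<^esub> adj\<^bsub>B\<^esub> (h u)) \<le> nrm\<^bsub>B\<^esub> (h u) + nrm\<^bsub>B\<^esub> (h u)"
    using B.nrm_triangle[of "h u" "adj\<^bsub>B\<^esub> (h u)"] uc by simp
  ultimately have "nrm\<^bsub>B\<^esub> (2 \<odot>\<^bsub>B\<^esub> h a) \<le> 2" by simp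
  then show ?thesis using a by (simp add: B.nrm_smult)
qed

text \<open>Division by any \<open>c\<close> above the norm moves \<open>a\<close> into the open
  unit ball, where a unitary with that real part exists; then \<open>c\<close> decreases to the
  norm.\<close>

lemma hom_nrm_selfadjoint_le:
  assumes a: "a \<in> carrier A" "adj\<^bsub>A\<^esub> a = a"
  shows "nrm\<^bsub>B\<^esub> (h a) \<le> nrm\<^bsub>A\<^esub> a"
proof (rule dense_ge)
  fix c assume c: "nrm\<^bsub>A\<^esub> a < c"
  then have c0: "c > 0" using A.nrm_nonneg[OF a(1)] by linarith
  let ?b = "of_real (1/c) \<odot>\<^bsub>A\<^esub> a"
  have "nrm\<^bsub>B\<^esub> (h ?b) \<le> 1"
  proof (rule hom_nrm_selfadjoint_le_1)
    show "adj\<^bsub>A\<^esub> ?b = ?b" using a by (simp add: A.adj_smult)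
    show "nrm\<^bsub>A\<^esub> ?b < 1" using a c c0 by (simp add: A.nrm_smult norm_divide)
  qed (use a in simp)
  then show "nrm\<^bsub>B\<^esub> (h a) \<le> c"
    using a c0 by (simp add: hom_smult B.nrm_smult norm_divide)
qed

text \<open>The C*-identity on both sides reduces the claim to the self-adjoint element
  \<open>adj x\<close> times \<open>x\<close>.\<close>

lemma hom_nrm_le:
  assumes x: "x \<in> carrier A"
  shows "nrm\<^bsub>B\<^esub> (h x) \<le> nrm\<^bsub>A\<^esub> x"
proof -
  have "(nrm\<^bsub>B\<^esub> (h x))\<^sup>2 = nrm\<^bsub>B\<^esub> (h (adj\<^bsub>A\<^esub> x \<otimes>\<^bsub>A\<^esub> x))"
    using x B.cstar_identity[of "h x"] by (simp add: hom_mult hom_adj)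
  also have "\<dots> \<le> nrm\<^bsub>A\<^esub> (adj\<^bsub>A\<^esub> x \<otimes>\<^bsub>A\<^esub> x)"
    by (rule hom_nrm_selfadjoint_le) (use x in \<open>simp_all add: A.adj_mult\<close>)
  also have "\<dots> = (nrm\<^bsub>A\<^esub> x)\<^sup>2" by (rule A.cstar_identity[OF x])
  finally show ?thesis by (rule power2_le_imp_le) (use x in simp)
qed

lemma hom_tends:
  assumes "A.tends s l"
  shows "B.tends (\<lambda>i. h (s i)) (h l)"
proof (rule B.tendsI)
  note c[simp] = A.tends_carrier[OF assms]
  show "(\<lambda>i. nrm\<^bsub>A\<^esub> (s i \<ominus>\<^bsub>A\<^esub> l)) \<longlonglongrightarrow> 0"
    using assms unfolding A.tends_def by blast
  show "nrm\<^bsub>B\<^esub> (h (s i) \<ominus>\<^bsub>B\<^esub> h l) \<le> nrm\<^bsub>A\<^esub> (s i \<ominus>\<^bsub>A\<^esub> l)" for i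
    using hom_nrm_le[of "s i \<ominus>\<^bsub>A\<^esub> l"] by (simp add: hom_diff)
qed (use A.tends_carrier[OF assms] in auto)

end

text \<open>The set where two *-homomorphisms agree is a C*-subalgebra; contractivity makes it
  closed, and generation makes it everything.\<close>

lemma star_hom_eqI:
  assumes "star_morphism A B h" "star_morphism A B k" and S: "cstar_generated A S"
    and eq: "\<And>x. x \<in> S \<Longrightarrow> h x = k x" and x: "x \<in> carrier A"
  shows "h x = k x"
proof -
  interpret h: star_morphism A B h by fact
  interpret k: star_morphism A B k by fact
  let ?D = "{x \<in> carrier A. h x = k x}"
  have "cstar_subalgebra ?D A"
    unfolding cstar_subalgebra_def
  proof (intro conjI ballI allI impI)
    fix s l assume l: "l \<in> carrier A"
      and s: "range s \<subseteq> ?D \<and> (\<lambda>i::nat. nrm\<^bsub>A\<^esub> (s i \<ominus>\<^bsub>A\<^esub> l)) \<longlonglongrightarrow> 0"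
    then have t: "h.A.tends s l" unfolding h.A.tends_def by blast
    have "(\<lambda>i. h (s i)) = (\<lambda>i. k (s i))" using s by blast
    then show "l \<in> ?D"
      using h.B.tends_unique[OF h.hom_tends[OF t]] k.hom_tends[OF t] l by simp
  qed (simp_all add: h.hom_add k.hom_add h.hom_mult k.hom_mult h.hom_smult k.hom_smult
      h.hom_adj k.hom_adj subset_iff)
  moreover have "S \<subseteq> ?D" using S eq unfolding cstar_generated_def by blast
  ultimately have "?D = carrier A" using S unfolding cstar_generated_def by blast
  then show ?thesis using x by blast
qed

section \<open>Normal forms in class-2 nilpotent groups\<close>

lemma (in monoid) commute_mult:
  assumes c: "a \<in> carrier G" "x \<in> carrier G" "y \<in> carrier G"
    and ax: "a \<otimes> x = x \<otimes> a" and ay: "a \<otimes> y = y \<otimes> a"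
  shows "a \<otimes> (x \<otimes> y) = x \<otimes> y \<otimes> a"
proof -
  have "a \<otimes> (x \<otimes> y) = x \<otimes> a \<otimes> y" using c by (simp add: m_assoc[symmetric] ax)
  also have "\<dots> = x \<otimes> y \<otimes> a" using c by (simp add: m_assoc ay)
  finally show ?thesis .
qed

lemma (in group) int_pow_conj:
  assumes "g \<in> carrier G" "x \<in> carrier G"
  shows "(g \<otimes> x \<otimes> inv g) [^] (i::int) = g \<otimes> x [^] i \<otimes> inv g"
proof -
  have "inv g \<otimes> (g \<otimes> y) = y" if "y \<in> carrier G" for y
    using that assms by (simp add: m_assoc[symmetric])
  then have "(\<lambda>y. g \<otimes> y \<otimes> inv g) \<in> hom G G"
    by (intro homI) (use assms in \<open>simp_all add: m_assoc\<close>)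
  from hom_int_pow[OF this _ group_axioms group_axioms] show ?thesis using assms by simp
qed

lemma (in group) int_pow_commute:
  assumes "x \<in> carrier G" "y \<in> carrier G" "x \<otimes> y = y \<otimes> x"
  shows "x [^] (i::int) \<otimes> y = y \<otimes> x [^] i"
proof -
  have "y \<otimes> x \<otimes> inv y = x" using assms by (metis inv_solve_right m_closed)
  then have "y \<otimes> x [^] i \<otimes> inv y = x [^] i" using int_pow_conj[of y x i] assms by simp
  then show ?thesis using assms by (metis inv_solve_right int_pow_closed m_closed)
qed

text \<open>Two conjugations: \<open>y\<close> conjugates the power of \<open>x\<close> to itself
  times \<open>t\<close>, a power of \<open>z\<close>; read from the other side, the inverse of the
  power of \<open>x\<close> conjugates \<open>y\<close> to \<open>t \<otimes> y\<close>, whose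
  powers split because \<open>t\<close> commutes with \<open>y\<close>.\<close>

lemma (in group) int_pow_swap:
  assumes c: "x \<in> carrier G" "y \<in> carrier G" "z \<in> carrier G"
    and zx: "z \<otimes> x = x \<otimes> z" and zy: "z \<otimes> y = y \<otimes> z"
    and rel: "y \<otimes> x = z \<otimes> (x \<otimes> y)"
  shows "y [^] (a::int) \<otimes> x [^] (b::int) = z [^] (a * b) \<otimes> (x [^] b \<otimes> y [^] a)"
proof -
  define w where "w = x [^] b"
  define t where "t = z [^] b"
  have wt: "w \<in> carrier G" "t \<in> carrier G" using c by (simp_all add: w_def t_def)
  have "y \<otimes> x \<otimes> inv y = z \<otimes> x" using c rel by (metis inv_solve_right m_assoc m_closed)
  then have "y \<otimes> w \<otimes> inv y = t \<otimes> w"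
    using int_pow_conj[of y x b] int_pow_mult_distrib[of z x b] c zx by (simp add: w_def t_def)
  then have yw: "y \<otimes> w = t \<otimes> (w \<otimes> y)" using c wt by (metis inv_solve_right m_assoc m_closed)
  have tw: "t \<otimes> w = w \<otimes> t"
    unfolding t_def w_def using c zx by (metis int_pow_closed int_pow_commute)
  have ty: "t \<otimes> y = y \<otimes> t" unfolding t_def using c zy by (metis int_pow_commute)
  have "inv w \<otimes> y \<otimes> inv (inv w) = t \<otimes> y"
    using c wt yw tw by (metis inv_solve_left inv_inv m_assoc m_closed inv_closed)
  then have "inv w \<otimes> y [^] a \<otimes> w = t [^] a \<otimes> y [^] a"
    using int_pow_conj[of "inv w" y a] int_pow_mult_distrib[of t y a] c wt ty by simp
  then have "y [^] a \<otimes> w = w \<otimes> (t [^] a \<otimes> y [^] a)"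
    using c wt by (metis inv_solve_left m_assoc m_closed inv_closed int_pow_closed)
  also have "\<dots> = t [^] a \<otimes> (w \<otimes> y [^] a)"
    using int_pow_commute[of t w a] c wt tw by (metis int_pow_closed m_assoc)
  also have "t [^] a = z [^] (a * b)" using c by (simp add: t_def int_pow_pow mult.commute)
  finally show ?thesis by (simp add: w_def)
qed

text \<open>A product over a list and not over a finite set: the factors commute with each other,
  but the ambient group is not commutative.\<close>

primrec central_word ::
  "('g, 'm) monoid_scheme \<Rightarrow> ('i \<Rightarrow> 'g) \<Rightarrow> ('i \<Rightarrow> int) \<Rightarrow> 'i list \<Rightarrow> 'g" where
  "central_word G v l [] = \<one>\<^bsub>G\<^esub>"
| "central_word G v l (p # ps) = v p [^]\<^bsub>G\<^esub> l p \<otimes>\<^bsub>G\<^esub> central_word G v l ps"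

primrec gen_word ::
  "('g, 'm) monoid_scheme \<Rightarrow> (nat \<Rightarrow> 'g) \<Rightarrow> (nat \<Rightarrow> int) \<Rightarrow> nat \<Rightarrow> 'g" where
  "gen_word G u k 0 = \<one>\<^bsub>G\<^esub>"
| "gen_word G u k (Suc m) = gen_word G u k m \<otimes>\<^bsub>G\<^esub> u (Suc m) [^]\<^bsub>G\<^esub> k (Suc m)"

text \<open>
  Sorting the product of two ordered words moves \<open>u\<^sub>j\<close> past \<open>u\<^sub>i\<close> for \<open>i < j\<close>, which costs the
  central element \<open>v\<^sub>i\<^sub>j\<close> with exponent minus the product of the two exponents.
\<close>

definition cocycle :: "nat \<Rightarrow> (nat \<Rightarrow> int) \<Rightarrow> (nat \<Rightarrow> int) \<Rightarrow> nat \<times> nat \<Rightarrow> int" where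
  "cocycle m k k' = (\<lambda>p. if p \<in> pairs m then - k (snd p) * k' (fst p) else 0)"

text \<open>The share of the cocycle that arises when the power \<open>a\<close> of the generator
  with index \<open>Suc m\<close> is moved past the first \<open>m'\<close> letters of the second
  word. The columns with \<open>m' = m\<close> assemble to the full cocycle.\<close>

definition column :: "nat \<Rightarrow> nat \<Rightarrow> int \<Rightarrow> (nat \<Rightarrow> int) \<Rightarrow> nat \<times> nat \<Rightarrow> int" where
  "column m m' a k' = (\<lambda>p. if snd p = Suc m \<and> fst p \<in> {1..m'} then - a * k' (fst p) else 0)"

type_synonym exponents = "(nat \<times> nat \<Rightarrow> int) \<times> (nat \<Rightarrow> int)"

text \<open>The multiplication of the free nilpotent group of class 2 in the coordinates of the
  normal form: a central extension of the lattice of the \<open>k\<close> by the lattice of the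
  \<open>l\<close>, with a bilinear cocycle. In \<open>exp_inv\<close> the correction cancels the
  cocycle of \<open>k\<close> with its negative.\<close>

definition exp_mult :: "nat \<Rightarrow> exponents \<Rightarrow> exponents \<Rightarrow> exponents" where
  "exp_mult n = (\<lambda>(l, k) (l', k'). (\<lambda>p. l p + l' p + cocycle n k k' p, \<lambda>i. k i + k' i))"

definition exp_inv :: "nat \<Rightarrow> exponents \<Rightarrow> exponents" where
  "exp_inv n = (\<lambda>(l, k). (\<lambda>p. - l p - cocycle n k (\<lambda>i. - k i) p, \<lambda>i. - k i))"

text \<open>Existence of normal forms follows from the relations alone. The role of their uniqueness
  is taken over later by the coefficient functionals on the fibres.\<close>

locale nilpotent_generators = group G for G (structure) +
  fixes n :: nat and u :: "nat \<Rightarrow> 'a" and v :: "nat \<times> nat \<Rightarrow> 'a" and ps :: "(nat \<times> nat) list"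
  assumes u_closed: "i \<in> {1..n} \<Longrightarrow> u i \<in> carrier G"
    and v_closed: "p \<in> pairs n \<Longrightarrow> v p \<in> carrier G"
    and v_commute: "\<lbrakk>p \<in> pairs n; q \<in> pairs n\<rbrakk> \<Longrightarrow> v p \<otimes> v q = v q \<otimes> v p"
    and v_u_commute: "\<lbrakk>p \<in> pairs n; i \<in> {1..n}\<rbrakk> \<Longrightarrow> v p \<otimes> u i = u i \<otimes> v p"
    and u_u: "(i, j) \<in> pairs n \<Longrightarrow> u i \<otimes> u j = v (i, j) \<otimes> (u j \<otimes> u i)"
    and ps: "distinct ps" "set ps = pairs n"
begin

abbreviation "Z \<equiv> central_word G v"
abbreviation "Xw \<equiv> gen_word G u"

lemma Z_closed: "set qs \<subseteq> pairs n \<Longrightarrow> Z l qs \<in> carrier G"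
  by (induction qs) (auto simp: v_closed)

lemma X_closed: "m \<le> n \<Longrightarrow> Xw k m \<in> carrier G"
  by (induction m) (auto simp: u_closed)

lemma Z_commute:
  assumes x: "x \<in> carrier G" "\<And>p. p \<in> pairs n \<Longrightarrow> v p \<otimes> x = x \<otimes> v p"
  shows "set qs \<subseteq> pairs n \<Longrightarrow> Z l qs \<otimes> x = x \<otimes> Z l qs"
proof (induction qs)
  case (Cons q qs)
  have c: "v q \<in> carrier G" "Z l qs \<in> carrier G" using Cons.prems by (auto simp: v_closed Z_closed)
  have "v q [^] l q \<otimes> x = x \<otimes> v q [^] l q"
    by (rule int_pow_commute) (use c x Cons.prems in auto)
  moreover have "Z l qs \<otimes> x = x \<otimes> Z l qs" using Cons by auto
  ultimately show ?case
    using c x(1) commute_mult[of x "v q [^] l q" "Z l qs"] by simp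
qed (use x in simp)

lemma Z_v_pow_commute:
  assumes "set qs \<subseteq> pairs n" "p \<in> pairs n"
  shows "Z l qs \<otimes> v p [^] (i::int) = v p [^] i \<otimes> Z l qs"
proof (rule Z_commute)
  show "v q \<otimes> v p [^] i = v p [^] i \<otimes> v q" if "q \<in> pairs n" for q
    using int_pow_commute[of "v p" "v q" i] v_commute[of p q] v_closed that assms by auto
qed (use assms v_closed in auto)

lemma Z_u_pow_commute:
  assumes "set qs \<subseteq> pairs n" "j \<in> {1..n}"
  shows "Z l qs \<otimes> u j [^] (i::int) = u j [^] i \<otimes> Z l qs"
proof (rule Z_commute)
  show "v q \<otimes> u j [^] i = u j [^] i \<otimes> v q" if "q \<in> pairs n" for q
    using int_pow_commute[of "u j" "v q" i] v_u_commute[of q j] v_closed u_closed that assms by auto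
qed (use assms u_closed in auto)

lemma Z_X_commute: "set qs \<subseteq> pairs n \<Longrightarrow> m \<le> n \<Longrightarrow> Z l qs \<otimes> Xw k m = Xw k m \<otimes> Z l qs"
proof (induction m)
  case (Suc m)
  have c: "Xw k m \<in> carrier G" "u (Suc m) \<in> carrier G" "Z l qs \<in> carrier G"
    using Suc.prems by (auto simp: X_closed u_closed Z_closed)
  have "Z l qs \<otimes> u (Suc m) [^] k (Suc m) = u (Suc m) [^] k (Suc m) \<otimes> Z l qs"
    by (rule Z_u_pow_commute) (use Suc.prems in auto)
  moreover have "Z l qs \<otimes> Xw k m = Xw k m \<otimes> Z l qs" using Suc by auto
  ultimately show ?case using c commute_mult[of "Z l qs" "Xw k m" "u (Suc m) [^] k (Suc m)"] by simp
qed (simp add: Z_closed)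

lemma Z_add: "set qs \<subseteq> pairs n \<Longrightarrow> Z (\<lambda>p. l p + l' p) qs = Z l qs \<otimes> Z l' qs"
proof (induction qs)
  case (Cons q qs)
  have c: "v q \<in> carrier G" "Z l qs \<in> carrier G" "Z l' qs \<in> carrier G"
    using Cons.prems by (auto simp: v_closed Z_closed)
  have "Z l qs \<otimes> v q [^] l' q = v q [^] l' q \<otimes> Z l qs"
    by (rule Z_v_pow_commute) (use Cons.prems in auto)
  then have "Z l qs \<otimes> (v q [^] l' q \<otimes> Z l' qs) = v q [^] l' q \<otimes> (Z l qs \<otimes> Z l' qs)"
    using c by (simp add: m_assoc[symmetric])
  then show ?case using c Cons by (simp add: int_pow_mult m_assoc)
qed simp

lemma Z_zero: "set qs \<subseteq> pairs n \<Longrightarrow> (\<And>p. p \<in> set qs \<Longrightarrow> l p = 0) \<Longrightarrow> Z l qs = \<one>"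
  by (induction qs) (auto simp: v_closed)

lemma Z_single: 
  "\<lbrakk>set qs \<subseteq> pairs n; distinct qs; p \<in> set qs\<rbrakk> \<Longrightarrow> Z (\<lambda>q. if q = p then a else 0) qs = v p [^] (a::int)"
proof (induction qs)
  case (Cons q qs)
  show ?case
  proof (cases "q = p")
    case True
    then have "Z (\<lambda>q. if q = p then a else 0) qs = \<one>"
      using Cons.prems by (intro Z_zero) auto
    then show ?thesis using True Cons.prems v_closed by simp
  next
    case False
    then show ?thesis using Cons v_closed[of p] by auto
  qed
qed simp

lemma X_zero: "m \<le> n \<Longrightarrow> Xw (\<lambda>_. 0) m = \<one>"
  by (induction m) (auto simp: u_closed)

lemma X_single: "m \<le> n \<Longrightarrow> Xw (\<lambda>j. if j = i then 1 else 0) m = (if i \<in> {1..m} then u i else \<one>)"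
proof (induction m)
  case (Suc m)
  show ?case
  proof (cases "i = Suc m")
    case True
    then show ?thesis using Suc u_closed[of "Suc m"] by simp
  next
    case False
    then have "i \<in> {1..Suc m} \<longleftrightarrow> i \<in> {1..m}" by auto
    then show ?thesis using Suc u_closed False by auto
  qed
qed simp

lemma u_X_swap:
  assumes m: "Suc m \<le> n"
  shows "m' \<le> m \<Longrightarrow> u (Suc m) [^] a \<otimes> Xw k' m' = Z (column m m' a k') ps \<otimes> (Xw k' m' \<otimes> u (Suc m) [^] a)"
proof (induction m')
  case 0
  have "Z (column m 0 a k') ps = \<one>" by (rule Z_zero) (simp_all add: ps column_def)
  then show ?case using m u_closed by simp
next
  case (Suc m')
  let ?y = "u (Suc m)" and ?x = "u (Suc m')" and ?v = "v (Suc m', Suc m)" and ?b = "k' (Suc m')"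
  have p: "(Suc m', Suc m) \<in> pairs n" using Suc.prems m by (simp add: pairs_def)
  have c: "?y \<in> carrier G" "?x \<in> carrier G" "?v \<in> carrier G" "Xw k' m' \<in> carrier G"
    using u_closed v_closed[OF p] X_closed m Suc.prems by auto
  let ?Z = "Z (column m m' a k') ps" and ?s = "\<lambda>q. if q = (Suc m', Suc m) then - a * ?b else 0"
  have Zc: "?Z \<in> carrier G" "Z ?s ps \<in> carrier G" using Z_closed ps by auto
  \<comment> \<open>The larger index moves to the right past the smaller one, opposite to the
    direction of the relation, so the central factor is the inverse of \<open>?v\<close>; this is
    the origin of the minus sign in the cocycle.\<close>
  have rel: "?y \<otimes> ?x = inv ?v \<otimes> (?x \<otimes> ?y)" using u_u[OF p] c by (metis inv_solve_left m_closed)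
  have "inv ?v \<otimes> ?x = ?x \<otimes> inv ?v" "inv ?v \<otimes> ?y = ?y \<otimes> inv ?v"
    using v_u_commute[OF p, of "Suc m'"] v_u_commute[OF p, of "Suc m"] m Suc.prems c
    by (auto intro!: inv_comm) (metis inv_solve_left inv_solve_right m_assoc m_closed inv_closed)+
  from int_pow_swap[OF _ _ _ this rel, of a ?b] have "?y [^] a \<otimes> ?x [^] ?b = inv ?v [^] (a * ?b) \<otimes> (?x [^] ?b \<otimes> ?y [^] a)"
    using c by simp
  also have "inv ?v [^] (a * ?b) = Z ?s ps"
    using Z_single[of ps "(Suc m', Suc m)" "- a * ?b"] ps p c by (simp add: int_pow_inv int_pow_neg)
  finally have swap: "?y [^] a \<otimes> ?x [^] ?b = Z ?s ps \<otimes> (?x [^] ?b \<otimes> ?y [^] a)" .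
  have ZX: "Z ?s ps \<otimes> Xw k' m' = Xw k' m' \<otimes> Z ?s ps" using Z_X_commute[of ps m'] ps m Suc.prems by simp
  have "column m (Suc m') a k' = (\<lambda>p. column m m' a k' p + ?s p)"
    by (auto simp: fun_eq_iff prod_eq_iff column_def)
  then have ZZ: "Z (column m (Suc m') a k') ps = ?Z \<otimes> Z ?s ps" using Z_add[of ps] ps by simp
  have "?y [^] a \<otimes> Xw k' (Suc m') = (?y [^] a \<otimes> Xw k' m') \<otimes> ?x [^] ?b"
    using c by (simp add: m_assoc)
  also have "\<dots> = ?Z \<otimes> (Xw k' m' \<otimes> (?y [^] a \<otimes> ?x [^] ?b))"
    using Suc c Zc by (simp add: m_assoc)
  also have "\<dots> = ?Z \<otimes> (Xw k' m' \<otimes> Z ?s ps \<otimes> (?x [^] ?b \<otimes> ?y [^] a))"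
    using c Zc by (simp add: swap m_assoc)
  also have "\<dots> = ?Z \<otimes> Z ?s ps \<otimes> (Xw k' (Suc m') \<otimes> ?y [^] a)"
    using c Zc by (simp add: ZX[symmetric] m_assoc)
  finally show ?case unfolding ZZ .
qed

text \<open>Induction on the number of letters: the last letter of the first word crosses the whole
  second word except its last letter, at the price of one column, meets its own kind and merges with
  it; the shorter words are left to the induction hypothesis.\<close>

lemma X_mult: "m \<le> n \<Longrightarrow> Xw k m \<otimes> Xw k' m = Z (cocycle m k k') ps \<otimes> Xw (\<lambda>i. k i + k' i) m"
proof (induction m)
  case 0
  have "Z (cocycle 0 k k') ps = \<one>" by (rule Z_zero) (auto simp: ps cocycle_def pairs_def)
  then show ?case by simp
next
  case (Suc m)
  let ?y = "u (Suc m)" and ?a = "k (Suc m)" and ?b = "k' (Suc m)"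
  let ?Z1 = "Z (column m m ?a k') ps" and ?Z2 = "Z (cocycle m k k') ps"
  let ?Xw = "Xw (\<lambda>i. k i + k' i) m"
  have c: "?y \<in> carrier G" "Xw k m \<in> carrier G" "Xw k' m \<in> carrier G" "?Xw \<in> carrier G"
    "?Z1 \<in> carrier G" "?Z2 \<in> carrier G"
    using u_closed X_closed Z_closed ps Suc.prems by auto
  have ZX: "?Z1 \<otimes> Xw k m = Xw k m \<otimes> ?Z1" using Z_X_commute[of ps m] ps Suc.prems by simp
  have "cocycle (Suc m) k k' = (\<lambda>p. column m m ?a k' p + cocycle m k k' p)"
    by (auto simp: fun_eq_iff cocycle_def pairs_def column_def)
  then have ZZ: "Z (cocycle (Suc m) k k') ps = ?Z1 \<otimes> ?Z2" using Z_add[of ps] ps by simp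
  have "Xw k (Suc m) \<otimes> Xw k' (Suc m) = Xw k m \<otimes> (?y [^] ?a \<otimes> Xw k' m) \<otimes> ?y [^] ?b"
    using c by (simp add: m_assoc)
  also have "\<dots> = Xw k m \<otimes> ?Z1 \<otimes> (Xw k' m \<otimes> (?y [^] ?a \<otimes> ?y [^] ?b))"
    using u_X_swap[OF Suc.prems, of m ?a k'] c by (simp add: m_assoc)
  also have "\<dots> = ?Z1 \<otimes> (Xw k m \<otimes> Xw k' m) \<otimes> ?y [^] (?a + ?b)"
    using c by (simp add: ZX[symmetric] m_assoc int_pow_mult)
  also have "\<dots> = ?Z1 \<otimes> ?Z2 \<otimes> Xw (\<lambda>i. k i + k' i) (Suc m)"
    using Suc c by (simp add: m_assoc)
  finally show ?case unfolding ZZ .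
qed

definition word :: "exponents \<Rightarrow> 'a" where
  "word g = Z (fst g) ps \<otimes> Xw (snd g) n"

lemma word_closed: "word g \<in> carrier G"
  using Z_closed X_closed ps by (simp add: word_def)

lemma word_mult: "word g \<otimes> word h = word (exp_mult n g h)"
proof -
  obtain l k l' k' where gh: "g = (l, k)" "h = (l', k')" by (cases g, cases h)
  have c: "Z l ps \<in> carrier G" "Z l' ps \<in> carrier G" "Xw k n \<in> carrier G" "Xw k' n \<in> carrier G"
    "Z (cocycle n k k') ps \<in> carrier G" "Xw (\<lambda>i. k i + k' i) n \<in> carrier G"
    using Z_closed X_closed ps by simp_all
  have ZX: "Z l' ps \<otimes> Xw k n = Xw k n \<otimes> Z l' ps" using Z_X_commute[of ps n] ps by simp
  have "word g \<otimes> word h = Z l ps \<otimes> (Xw k n \<otimes> Z l' ps) \<otimes> Xw k' n"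
    using c by (simp add: gh word_def m_assoc)
  also have "\<dots> = Z l ps \<otimes> Z l' ps \<otimes> (Xw k n \<otimes> Xw k' n)"
    using c by (simp add: ZX[symmetric] m_assoc)
  also have "\<dots> = Z l ps \<otimes> Z l' ps \<otimes> Z (cocycle n k k') ps \<otimes> Xw (\<lambda>i. k i + k' i) n"
    using c by (simp add: X_mult m_assoc)
  also have "\<dots> = word (exp_mult n g h)"
    using ps by (simp add: gh word_def exp_mult_def Z_add[symmetric])
  finally show ?thesis .
qed

lemma word_zero: "word (\<lambda>_. 0, \<lambda>_. 0) = \<one>"
  using X_zero Z_zero[of ps "\<lambda>_. 0"] ps by (simp add: word_def)

lemma word_inv: "inv (word g) = word (exp_inv n g)"
proof -
  obtain l k where g: "g = (l, k)" by (cases g)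
  have "word g \<otimes> word (exp_inv n g) = \<one>"
    by (simp add: g word_mult exp_mult_def exp_inv_def word_zero)
  then show ?thesis
    by (intro inv_equality inv_comm[of "word g"] word_closed)
qed

lemma word_v: "p \<in> pairs n \<Longrightarrow> word (\<lambda>q. if q = p then 1 else 0, \<lambda>_. 0) = v p"
  using X_zero Z_single[of ps p 1] ps v_closed by (simp add: word_def)

lemma word_u: "i \<in> {1..n} \<Longrightarrow> word (\<lambda>_. 0, \<lambda>j. if j = i then 1 else 0) = u i"
  using X_single[of n i] Z_zero[of ps "\<lambda>_. 0"] ps u_closed by (simp add: word_def)

end

section \<open>Unitaries and the defining relations\<close>

text \<open>Integer exponents need a group, and \<open>A\<close> is only a ring. Product and unit
  are those of \<open>A\<close>, so equations pass freely between the two structures; the inverse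
  becomes \<open>adj\<close>.\<close>

definition unitary_group :: "'a cstar \<Rightarrow> 'a monoid" where
  "unitary_group A = \<lparr>carrier = {u. unitary_in A u}, mult = mult A, one = one A\<rparr>"

lemma unitary_group_simps [simp]:
  "carrier (unitary_group A) = {u. unitary_in A u}"
  "x \<otimes>\<^bsub>unitary_group A\<^esub> y = x \<otimes>\<^bsub>A\<^esub> y"
  "\<one>\<^bsub>unitary_group A\<^esub> = \<one>\<^bsub>A\<^esub>"
  by (simp_all add: unitary_group_def)

context star_algebra
begin

lemma unitary_closed: "unitary_in A u \<Longrightarrow> u \<in> carrier A"
  by (simp add: unitary_in_def)

lemma unitary_one: "unitary_in A \<one>"
  by (simp add: unitary_in_def)

lemma unitary_adj: "unitary_in A u \<Longrightarrow> unitary_in A (adj u)"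
  by (simp add: unitary_in_def)

lemma unitary_mult:
  assumes "unitary_in A u" "unitary_in A w"
  shows "unitary_in A (u \<otimes> w)"
proof -
  note c = unitary_closed[OF assms(1)] unitary_closed[OF assms(2)]
  have "adj w \<otimes> adj u \<otimes> (u \<otimes> w) = adj w \<otimes> (adj u \<otimes> u) \<otimes> w"
    "u \<otimes> w \<otimes> (adj w \<otimes> adj u) = u \<otimes> (w \<otimes> adj w) \<otimes> adj u"
    using c by (simp_all add: m_assoc)
  then show ?thesis using assms c by (simp add: unitary_in_def adj_mult)
qed

lemma unitary_scalar: "cmod c = 1 \<Longrightarrow> unitary_in A (c \<odot> \<one>)"
  using complex_norm_square[of c]
  by (simp add: unitary_in_def adj_smult smult_mult_left smult_mult_right smult_smult mult.commute)

lemma group_unitary_group: "group (unitary_group A)"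
proof (rule groupI)
  fix x assume "x \<in> carrier (unitary_group A)"
  then show "\<exists>y\<in>carrier (unitary_group A). y \<otimes>\<^bsub>unitary_group A\<^esub> x = \<one>\<^bsub>unitary_group A\<^esub>"
    by (intro bexI[of _ "adj x"]) (auto simp: unitary_adj, simp add: unitary_in_def)
qed (auto simp: unitary_mult unitary_one unitary_closed m_assoc)

lemma inv_unitary_group: "unitary_in A u \<Longrightarrow> inv\<^bsub>unitary_group A\<^esub> u = adj u"
  by (rule group.inv_equality[OF group_unitary_group])
    (simp_all add: unitary_adj, simp add: unitary_in_def)

lemma inv_unitary: "unitary_in A u \<Longrightarrow> inv u = adj u"
  by (rule inv_char) (auto simp: unitary_in_def)

text \<open>Clears the inverses from the commutator. In the product form the relations are plain
  equations between products, which *-homomorphisms preserve and injective ones reflect.\<close>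

lemma commutator_eq_iff:
  assumes "unitary_in A x" "unitary_in A y" "z \<in> carrier A"
  shows "commutator A x y = z \<longleftrightarrow> x \<otimes> y = z \<otimes> (y \<otimes> x)"
proof -
  note c = unitary_closed[OF assms(1)] unitary_closed[OF assms(2)] assms(3)
  have u: "adj x \<otimes> x = \<one>" "x \<otimes> adj x = \<one>" "adj y \<otimes> y = \<one>" "y \<otimes> adj y = \<one>"
    using assms by (simp_all add: unitary_in_def)
  have w: "y \<otimes> x \<otimes> (adj x \<otimes> adj y) = \<one>" "adj x \<otimes> adj y \<otimes> (y \<otimes> x) = \<one>"
  proof -
    have "y \<otimes> x \<otimes> (adj x \<otimes> adj y) = y \<otimes> (x \<otimes> adj x) \<otimes> adj y"
      "adj x \<otimes> adj y \<otimes> (y \<otimes> x) = adj x \<otimes> (adj y \<otimes> y) \<otimes> x"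
      using c by (simp_all add: m_assoc)
    then show "y \<otimes> x \<otimes> (adj x \<otimes> adj y) = \<one>" "adj x \<otimes> adj y \<otimes> (y \<otimes> x) = \<one>"
      using c u by simp_all
  qed
  have eq: "commutator A x y = (x \<otimes> y) \<otimes> (adj x \<otimes> adj y)"
    using c by (simp add: commutator_def inv_unitary assms m_assoc)
  show ?thesis
  proof
    assume "commutator A x y = z"
    then have "z \<otimes> (y \<otimes> x) = (x \<otimes> y) \<otimes> (adj x \<otimes> adj y) \<otimes> (y \<otimes> x)" by (simp add: eq)
    also have "\<dots> = (x \<otimes> y) \<otimes> (adj x \<otimes> adj y \<otimes> (y \<otimes> x))" using c by (simp add: m_assoc)
    finally show "x \<otimes> y = z \<otimes> (y \<otimes> x)" using c by (simp add: w)
  next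
    assume h: "x \<otimes> y = z \<otimes> (y \<otimes> x)"
    have "commutator A x y = z \<otimes> (y \<otimes> x \<otimes> (adj x \<otimes> adj y))"
      unfolding eq h using c by (simp add: m_assoc)
    then show "commutator A x y = z" using c by (simp add: w)
  qed
qed

lemma G_relations_iff:
  "G_relations n A U V \<longleftrightarrow>
     (\<forall>i\<in>{1..n}. unitary_in A (U i)) \<and> (\<forall>p\<in>pairs n. unitary_in A (V p)) \<and>
     (\<forall>p\<in>pairs n. \<forall>q\<in>pairs n. V p \<otimes> V q = V q \<otimes> V p) \<and>
     (\<forall>i\<in>{1..n}. \<forall>p\<in>pairs n. U i \<otimes> V p = V p \<otimes> U i) \<and>
     (\<forall>(j, k)\<in>pairs n. U j \<otimes> U k = V (j, k) \<otimes> (U k \<otimes> U j))"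
proof (cases "(\<forall>i\<in>{1..n}. unitary_in A (U i)) \<and> (\<forall>p\<in>pairs n. unitary_in A (V p))")
  case True
  then have 1: "\<And>p q. p \<in> pairs n \<Longrightarrow> q \<in> pairs n \<Longrightarrow>
      commutator A (V p) (V q) = \<one> \<longleftrightarrow> V p \<otimes> V q = V q \<otimes> V p"
    and 2: "\<And>i p. i \<in> {1..n} \<Longrightarrow> p \<in> pairs n \<Longrightarrow>
      commutator A (U i) (V p) = \<one> \<longleftrightarrow> U i \<otimes> V p = V p \<otimes> U i"
    by (simp_all add: commutator_eq_iff unitary_closed)
  have 3: "commutator A (U j) (U k) = V (j, k) \<longleftrightarrow> U j \<otimes> U k = V (j, k) \<otimes> (U k \<otimes> U j)"
    if "(j, k) \<in> pairs n" for j k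
    using True that by (intro commutator_eq_iff) (auto simp: pairs_def unitary_closed)
  show ?thesis unfolding G_relations_def using True 1 2 3 by (auto split: prod.splits)
next
  case False
  then show ?thesis unfolding G_relations_def by blast
qed

lemma torus_relations_iff:
  "torus_relations n \<theta> A W \<longleftrightarrow>
     (\<forall>i\<in>{1..n}. unitary_in A (W i)) \<and>
     (\<forall>(i, j)\<in>pairs n. W i \<otimes> W j = \<theta> (i, j) \<odot> (W j \<otimes> W i))"
proof (cases "\<forall>i\<in>{1..n}. unitary_in A (W i)")
  case True
  have "commutator A (W i) (W j) = \<theta> (i, j) \<odot> \<one> \<longleftrightarrow> W i \<otimes> W j = \<theta> (i, j) \<odot> (W j \<otimes> W i)"
    if "(i, j) \<in> pairs n" for i j
  proof -
    have "unitary_in A (W i)" "unitary_in A (W j)" using True that by (auto simp: pairs_def)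
    then show ?thesis by (simp add: commutator_eq_iff smult_mult_left unitary_closed)
  qed
  then show ?thesis unfolding torus_relations_def using True by (auto split: prod.splits)
next
  case False
  then show ?thesis unfolding torus_relations_def by blast
qed

text \<open>Scalars of modulus 1 are central unitaries, so the generators of a torus satisfy the
  relations of the group. The canonical maps owe their existence to this.\<close>

lemma torus_relations_imp_G_relations:
  assumes W: "torus_relations n \<theta> A W" and \<theta>: "\<And>p. p \<in> pairs n \<Longrightarrow> cmod (\<theta> p) = 1"
  shows "G_relations n A W (\<lambda>p. \<theta> p \<odot> \<one>)"
proof -
  have u: "\<And>i. i \<in> {1..n} \<Longrightarrow> unitary_in A (W i)"
    and r: "\<And>i j. (i, j) \<in> pairs n \<Longrightarrow> W i \<otimes> W j = \<theta> (i, j) \<odot> (W j \<otimes> W i)"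
    using W unfolding torus_relations_iff by auto
  have c: "\<And>i. i \<in> {1..n} \<Longrightarrow> W i \<in> carrier A" using u unitary_closed by blast
  have "W j \<otimes> W k = (\<theta> (j, k) \<odot> \<one>) \<otimes> (W k \<otimes> W j)" if jk: "(j, k) \<in> pairs n" for j k
  proof -
    have "j \<in> {1..n}" "k \<in> {1..n}" using jk by (auto simp: pairs_def)
    then show ?thesis using r[OF jk] c by (simp add: smult_mult_left)
  qed
  then show ?thesis unfolding G_relations_iff using u \<theta>
    by (auto simp: unitary_scalar smult_mult_left smult_mult_right smult_smult mult.commute c)
qed

end

context star_morphism
begin

lemma inj_unitary:
  assumes "inj_on h (carrier A)" "x \<in> carrier A" "unitary_in B (h x)"
  shows "unitary_in A x"
proof -
  have "h (adj\<^bsub>A\<^esub> x \<otimes>\<^bsub>A\<^esub> x) = h \<one>\<^bsub>A\<^esub>" "h (x \<otimes>\<^bsub>A\<^esub> adj\<^bsub>A\<^esub> x) = h \<one>\<^bsub>A\<^esub>"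
    using assms by (simp_all add: hom_mult hom_adj unitary_in_def)
  then show ?thesis
    unfolding unitary_in_def by (intro conjI assms(2); intro inj_onD[OF assms(1)]) (use assms(2) in simp_all)
qed

text \<open>The relations are equations and can be tested after an injective *-homomorphism. This
  pulls them back from a given target to its copy on sets of naturals.\<close>

lemma inj_G_relations:
  assumes inj: "inj_on h (carrier A)"
    and U: "\<And>i. i \<in> {1..n} \<Longrightarrow> U i \<in> carrier A \<and> h (U i) = U' i"
    and V: "\<And>p. p \<in> pairs n \<Longrightarrow> V p \<in> carrier A \<and> h (V p) = V' p"
    and G: "G_relations n B U' V'"
  shows "G_relations n A U V"
proof -
  have eqI: "x = y" if "h x = h y" "x \<in> carrier A" "y \<in> carrier A" for x y
    using inj that by (auto dest: inj_onD)
  have jk: "j \<in> {1..n}" "k \<in> {1..n}" if "(j, k) \<in> pairs n" for j k using that by (auto simp: pairs_def)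
  show ?thesis
    unfolding A.G_relations_iff
  proof (intro conjI ballI, safe)
    show "unitary_in A (U i)" if "i \<in> {1..n}" for i
      using U[OF that] inj_unitary[OF inj] G that unfolding B.G_relations_iff by simp
    show "unitary_in A (V (j, k))" if "(j, k) \<in> pairs n" for j k
      using V[OF that] inj_unitary[OF inj] G that unfolding B.G_relations_iff by simp
    show "V (j, k) \<otimes>\<^bsub>A\<^esub> V (l, m) = V (l, m) \<otimes>\<^bsub>A\<^esub> V (j, k)" if "(j, k) \<in> pairs n" "(l, m) \<in> pairs n" for j k l m
      by (rule eqI) (use V[OF that(1)] V[OF that(2)] G that in \<open>simp_all add: hom_mult B.G_relations_iff\<close>)
    show "U i \<otimes>\<^bsub>A\<^esub> V (j, k) = V (j, k) \<otimes>\<^bsub>A\<^esub> U i" if "i \<in> {1..n}" "(j, k) \<in> pairs n" for i j k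
      by (rule eqI) (use U[OF that(1)] V[OF that(2)] G that in \<open>simp_all add: hom_mult B.G_relations_iff\<close>)
    show "U j \<otimes>\<^bsub>A\<^esub> U k = V (j, k) \<otimes>\<^bsub>A\<^esub> (U k \<otimes>\<^bsub>A\<^esub> U j)" if "(j, k) \<in> pairs n" for j k
    proof (rule eqI)
      have "U' j \<otimes>\<^bsub>B\<^esub> U' k = V' (j, k) \<otimes>\<^bsub>B\<^esub> (U' k \<otimes>\<^bsub>B\<^esub> U' j)"
        using G that unfolding B.G_relations_iff by auto
      then show "h (U j \<otimes>\<^bsub>A\<^esub> U k) = h (V (j, k) \<otimes>\<^bsub>A\<^esub> (U k \<otimes>\<^bsub>A\<^esub> U j))"
        using U[OF jk(1)[OF that]] U[OF jk(2)[OF that]] V[OF that] by (simp add: hom_mult)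
    qed (use U[OF jk(1)[OF that]] U[OF jk(2)[OF that]] V[OF that] in simp_all)
  qed
qed

lemma inj_torus_relations:
  assumes inj: "inj_on h (carrier A)"
    and W: "\<And>i. i \<in> {1..n} \<Longrightarrow> W i \<in> carrier A \<and> h (W i) = W' i"
    and T: "torus_relations n \<theta> B W'"
  shows "torus_relations n \<theta> A W"
proof -
  have jk: "j \<in> {1..n}" "k \<in> {1..n}" if "(j, k) \<in> pairs n" for j k using that by (auto simp: pairs_def)
  show ?thesis
    unfolding A.torus_relations_iff
  proof (intro conjI ballI, safe)
    show "unitary_in A (W i)" if "i \<in> {1..n}" for i
      using W[OF that] inj_unitary[OF inj] T that unfolding B.torus_relations_iff by simp
    show "W j \<otimes>\<^bsub>A\<^esub> W k = \<theta> (j, k) \<odot>\<^bsub>A\<^esub> (W k \<otimes>\<^bsub>A\<^esub> W j)" if "(j, k) \<in> pairs n" for j k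
    proof (rule inj_onD[OF inj])
      have "W' j \<otimes>\<^bsub>B\<^esub> W' k = \<theta> (j, k) \<odot>\<^bsub>B\<^esub> (W' k \<otimes>\<^bsub>B\<^esub> W' j)"
        using T that unfolding B.torus_relations_iff by auto
      then show "h (W j \<otimes>\<^bsub>A\<^esub> W k) = h (\<theta> (j, k) \<odot>\<^bsub>A\<^esub> (W k \<otimes>\<^bsub>A\<^esub> W j))"
        using W[OF jk(1)[OF that]] W[OF jk(2)[OF that]] by (simp add: hom_mult hom_smult)
    qed (use W[OF jk(1)[OF that]] W[OF jk(2)[OF that]] in simp_all)
  qed
qed

end

lemma star_morphism_comp:
  assumes "star_morphism A B h" "star_morphism B C k"
  shows "star_morphism A C (k \<circ> h)"
proof -
  interpret h: star_morphism A B h by fact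
  interpret k: star_morphism B C k by fact
  have "k \<circ> h \<in> star_hom A C"
    unfolding star_hom_def ring_hom_def
    by (auto simp: h.hom_add k.hom_add h.hom_mult k.hom_mult h.hom_smult k.hom_smult
        h.hom_adj k.hom_adj)
  then show ?thesis
    by (intro star_morphism.intro h.A.star_algebra_axioms k.B.star_algebra_axioms
        star_morphism_axioms.intro)
qed

section \<open>Transport of structure\<close>

text \<open>
  A structure with operations only is a C*-algebra as soon as some injection into a C*-algebra
  respects the operations and has a C*-subalgebra as its image.
\<close>

lemma star_algebra_transport:
  fixes B :: "'b cstar" and C :: "'c cstar" and \<psi> :: "'c \<Rightarrow> 'b"
  assumes B: "star_algebra B" and inj: "inj_on \<psi> (carrier C)"
    and sub: "cstar_subalgebra (\<psi> ` carrier C) B"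
    and one: "\<one>\<^bsub>C\<^esub> \<in> carrier C" "\<psi> \<one>\<^bsub>C\<^esub> = \<one>\<^bsub>B\<^esub>"
    and zero: "\<zero>\<^bsub>C\<^esub> \<in> carrier C" "\<psi> \<zero>\<^bsub>C\<^esub> = \<zero>\<^bsub>B\<^esub>"
    and add: "\<And>x y. \<lbrakk>x \<in> carrier C; y \<in> carrier C\<rbrakk> \<Longrightarrow> x \<oplus>\<^bsub>C\<^esub> y \<in> carrier C"
      "\<And>x y. \<lbrakk>x \<in> carrier C; y \<in> carrier C\<rbrakk> \<Longrightarrow> \<psi> (x \<oplus>\<^bsub>C\<^esub> y) = \<psi> x \<oplus>\<^bsub>B\<^esub> \<psi> y"
    and mult: "\<And>x y. \<lbrakk>x \<in> carrier C; y \<in> carrier C\<rbrakk> \<Longrightarrow> x \<otimes>\<^bsub>C\<^esub> y \<in> carrier C"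
      "\<And>x y. \<lbrakk>x \<in> carrier C; y \<in> carrier C\<rbrakk> \<Longrightarrow> \<psi> (x \<otimes>\<^bsub>C\<^esub> y) = \<psi> x \<otimes>\<^bsub>B\<^esub> \<psi> y"
    and smult: "\<And>c x. x \<in> carrier C \<Longrightarrow> c \<odot>\<^bsub>C\<^esub> x \<in> carrier C"
      "\<And>c x. x \<in> carrier C \<Longrightarrow> \<psi> (c \<odot>\<^bsub>C\<^esub> x) = c \<odot>\<^bsub>B\<^esub> \<psi> x"
    and adj: "\<And>x. x \<in> carrier C \<Longrightarrow> adj\<^bsub>C\<^esub> x \<in> carrier C"
      "\<And>x. x \<in> carrier C \<Longrightarrow> \<psi> (adj\<^bsub>C\<^esub> x) = adj\<^bsub>B\<^esub> (\<psi> x)"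
    and nrm: "\<And>x. x \<in> carrier C \<Longrightarrow> nrm\<^bsub>C\<^esub> x = nrm\<^bsub>B\<^esub> (\<psi> x)"
  shows "star_morphism C B \<psi>"
proof -
  interpret B: star_algebra B by fact
  have c[simp]: "\<psi> x \<in> carrier B" if "x \<in> carrier C" for x
    using sub that unfolding cstar_subalgebra_def by auto
  have eqI: "x = y" if "\<psi> x = \<psi> y" "x \<in> carrier C" "y \<in> carrier C" for x y
    using inj that by (auto dest: inj_onD)
  note [simp] = one zero add mult smult adj
  have ab: "abelian_group C"
  proof (rule abelian_groupI)
    show "\<exists>y\<in>carrier C. y \<oplus>\<^bsub>C\<^esub> x = \<zero>\<^bsub>C\<^esub>" if "x \<in> carrier C" for x
      by (rule bexI[of _ "(-1) \<odot>\<^bsub>C\<^esub> x"], rule eqI) (use that in \<open>simp_all add: B.smult_minus_one B.l_neg\<close>)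
  qed (simp_all, (rule eqI; simp add: B.a_ac)+)
  have mon: "monoid C"
    by (rule monoidI) (simp_all, (rule eqI; simp add: B.m_assoc)+)
  have ring: "ring C"
    by (rule ringI[OF ab mon]) (rule eqI; simp add: B.l_distr B.r_distr)+
  then interpret C: ring C .
  have neg: "\<psi> (\<ominus>\<^bsub>C\<^esub> x) = \<ominus>\<^bsub>B\<^esub> \<psi> x" if "x \<in> carrier C" for x
  proof -
    have "\<psi> (\<ominus>\<^bsub>C\<^esub> x) \<oplus>\<^bsub>B\<^esub> \<psi> x = \<zero>\<^bsub>B\<^esub>"
      using add(2)[of "\<ominus>\<^bsub>C\<^esub> x" x] that by (simp add: C.l_neg)
    then show ?thesis using that by (intro B.minus_equality[symmetric]) simp_all
  qed
  have diff: "\<psi> (x \<ominus>\<^bsub>C\<^esub> y) = \<psi> x \<ominus>\<^bsub>B\<^esub> \<psi> y" if "x \<in> carrier C" "y \<in> carrier C" for x y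
    using that by (simp add: C.minus_eq B.minus_eq neg)
  have "star_algebra C"
  proof (intro star_algebra.intro star_algebra_axioms.intro ring)
    fix s :: "nat \<Rightarrow> 'c"
    assume s: "range s \<subseteq> carrier C"
      and cauchy: "\<And>e. e > 0 \<Longrightarrow> \<exists>N. \<forall>i\<ge>N. \<forall>j\<ge>N. nrm\<^bsub>C\<^esub> (s i \<ominus>\<^bsub>C\<^esub> s j) < e"
    have sc[simp]: "s i \<in> carrier C" for i using s by blast
    have "\<exists>l\<in>carrier B. (\<lambda>i. nrm\<^bsub>B\<^esub> (\<psi> (s i) \<ominus>\<^bsub>B\<^esub> l)) \<longlonglongrightarrow> 0"
    proof (rule B.nrm_complete)
      fix e :: real assume "e > 0"
      from cauchy[OF this] show "\<exists>N. \<forall>i\<ge>N. \<forall>j\<ge>N. nrm\<^bsub>B\<^esub> (\<psi> (s i) \<ominus>\<^bsub>B\<^esub> \<psi> (s j)) < e"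
        by (simp add: nrm diff)
    qed auto
    then obtain l where l: "l \<in> carrier B" "(\<lambda>i. nrm\<^bsub>B\<^esub> (\<psi> (s i) \<ominus>\<^bsub>B\<^esub> l)) \<longlonglongrightarrow> 0" by blast
    have "range (\<lambda>i. \<psi> (s i)) \<subseteq> \<psi> ` carrier C" by auto
    then have "l \<in> \<psi> ` carrier C" using l sub unfolding cstar_subalgebra_def by blast
    then obtain m where m: "m \<in> carrier C" "l = \<psi> m" by blast
    then have "(\<lambda>i. nrm\<^bsub>C\<^esub> (s i \<ominus>\<^bsub>C\<^esub> m)) \<longlonglongrightarrow> 0" using l(2) by (simp add: nrm diff)
    then show "\<exists>l\<in>carrier C. (\<lambda>i. nrm\<^bsub>C\<^esub> (s i \<ominus>\<^bsub>C\<^esub> l)) \<longlonglongrightarrow> 0" using m(1) by blast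
  next
    show "(nrm\<^bsub>C\<^esub> x = 0) = (x = \<zero>\<^bsub>C\<^esub>)" if "x \<in> carrier C" for x
      using that eqI[of x "\<zero>\<^bsub>C\<^esub>"] by (auto simp: nrm B.nrm_eq_0_iff)
  next
    show "nrm\<^bsub>C\<^esub> (x \<oplus>\<^bsub>C\<^esub> y) \<le> nrm\<^bsub>C\<^esub> x + nrm\<^bsub>C\<^esub> y" "nrm\<^bsub>C\<^esub> (x \<otimes>\<^bsub>C\<^esub> y) \<le> nrm\<^bsub>C\<^esub> x * nrm\<^bsub>C\<^esub> y"
      if "x \<in> carrier C" "y \<in> carrier C" for x y
      using that by (simp_all add: nrm B.nrm_triangle B.nrm_mult)
  next
    show "nrm\<^bsub>C\<^esub> (c \<odot>\<^bsub>C\<^esub> x) = cmod c * nrm\<^bsub>C\<^esub> x" if "x \<in> carrier C" for c x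
      using that by (simp add: nrm B.nrm_smult)
    show "nrm\<^bsub>C\<^esub> (adj\<^bsub>C\<^esub> x \<otimes>\<^bsub>C\<^esub> x) = (nrm\<^bsub>C\<^esub> x)\<^sup>2" if "x \<in> carrier C" for x
      using that by (simp add: nrm B.cstar_identity)
  qed (simp_all, (rule eqI; simp add: B.smult_add_left B.smult_add_right B.smult_smult
        B.smult_mult_left B.smult_mult_right B.adj_add B.adj_smult B.adj_mult)+)
  moreover have "\<psi> \<in> star_hom C B" by (simp add: star_hom_def ring_hom_def)
  ultimately show ?thesis
    by (intro star_morphism.intro star_morphism_axioms.intro B.star_algebra_axioms)
qed

section \<open>Separable C*-subalgebras and their copies on sets of natural numbers\<close>

datatype alg_term =
  Gen nat | Unit | Sum alg_term alg_term | Product alg_term alg_term | Adjoint alg_term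
  | Scaled nat alg_term

instance alg_term :: countable by countable_datatype

primrec term_value :: "'a cstar \<Rightarrow> (nat \<Rightarrow> 'a) \<Rightarrow> (nat \<Rightarrow> complex) \<Rightarrow> alg_term \<Rightarrow> 'a" where
  "term_value A g d (Gen i) = g i"
| "term_value A g d Unit = \<one>\<^bsub>A\<^esub>"
| "term_value A g d (Sum s t) = term_value A g d s \<oplus>\<^bsub>A\<^esub> term_value A g d t"
| "term_value A g d (Product s t) = term_value A g d s \<otimes>\<^bsub>A\<^esub> term_value A g d t"
| "term_value A g d (Adjoint s) = adj\<^bsub>A\<^esub> (term_value A g d s)"
| "term_value A g d (Scaled i s) = d i \<odot>\<^bsub>A\<^esub> term_value A g d s"

lemma dense_complex_sequence:
  obtains d :: "nat \<Rightarrow> complex" where "\<And>c e. e > 0 \<Longrightarrow> \<exists>i. cmod (d i - c) < e"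
proof -
  obtain D :: "complex set" where D: "countable D" "\<And>N. open N \<Longrightarrow> N \<noteq> {} \<Longrightarrow> \<exists>d\<in>D. d \<in> N"
    using countable_dense_setE by blast
  have "D \<noteq> {}" using D(2)[of UNIV] by auto
  have "\<exists>i. cmod (from_nat_into D i - c) < e" if "e > 0" for c e
  proof -
    have "\<exists>x\<in>D. x \<in> ball c e" by (rule D(2)) (use that in auto)
    then obtain x where "x \<in> D" "x \<in> ball c e" by blast
    moreover obtain i where "from_nat_into D i = x"
      using range_from_nat_into[OF \<open>D \<noteq> {}\<close> D(1)] \<open>x \<in> D\<close> by (metis imageE)
    ultimately show ?thesis by (auto simp: dist_norm norm_minus_commute)
  qed
  then show thesis by (rule that)
qed

text \<open>Terms in the given elements form a countable type because \<open>Scaled\<close> refers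
  to a scalar by its index in a dense sequence. Their values are closed under the algebraic
  operations, and the closure supplies the remaining scalars.\<close>

lemma (in star_algebra) separable_subalgebra:
  assumes "countable S" "S \<subseteq> carrier A"
  obtains q :: "nat \<Rightarrow> 'a" where "range q \<subseteq> carrier A" "cstar_subalgebra (cl (range q)) A" 
    "S \<subseteq> cl (range q)"
proof -
  obtain d :: "nat \<Rightarrow> complex" where d: "\<And>c e. e > 0 \<Longrightarrow> \<exists>i. cmod (d i - c) < e"
    using dense_complex_sequence by blast
  define g where "g = from_nat_into (insert \<one> S)"
  have rg: "range g = insert \<one> S" unfolding g_def using assms(1) by (intro range_from_nat_into) auto
  then have gc: "g i \<in> carrier A" for i using assms(2) rangeI[of g i] by auto
  let ?v = "term_value A g d"
  have vc: "?v t \<in> carrier A" for t by (induction t) (simp_all add: gc)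
  then have Q: "range ?v \<subseteq> carrier A" by blast
  have "cstar_subalgebra (cl (range ?v)) A"
  proof (rule cl_subalgebra[OF Q])
    show "\<one> \<in> range ?v" by (rule range_eqI[of _ _ Unit]) simp
    show "x \<oplus> y \<in> range ?v" "x \<otimes> y \<in> range ?v" if "x \<in> range ?v" "y \<in> range ?v" for x y
      using that by (auto simp flip: term_value.simps)
    show "adj x \<in> range ?v" if "x \<in> range ?v" for x using that by (auto simp flip: term_value.simps)
    show "c \<odot> x \<in> cl (range ?v)" if "x \<in> range ?v" for c x
      unfolding cl_def
    proof (intro CollectI conjI allI impI)
      show "c \<odot> x \<in> carrier A" using that vc by auto
      fix e :: real assume e: "e > 0"
      obtain t where t: "x = ?v t" using \<open>x \<in> range ?v\<close> by blast
      \<comment> \<open>The added 1 keeps the denominator positive when \<open>x\<close> is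
        zero.\<close>
      have pos: "0 < nrm x + 1" using nrm_nonneg[OF vc[of t]] t by simp
      then obtain i where i: "cmod (d i - c) < e / (nrm x + 1)" using d[of "e / (nrm x + 1)" c] e by auto
      have "d i \<odot> x \<ominus> c \<odot> x = (d i - c) \<odot> x" using vc t by (simp add: smult_diff_left)
      then have "nrm (d i \<odot> x \<ominus> c \<odot> x) = cmod (d i - c) * nrm x" using vc t by (simp add: nrm_smult)
      also have "\<dots> \<le> cmod (d i - c) * (nrm x + 1)" by (intro mult_left_mono) auto
      also have "\<dots> < e" using i pos by (simp add: pos_less_divide_eq)
      finally have "nrm (d i \<odot> x \<ominus> c \<odot> x) < e" .
      moreover have "d i \<odot> x \<in> range ?v" unfolding t by (rule range_eqI[of _ _ "Scaled i t"]) simp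
      ultimately show "\<exists>q\<in>range ?v. nrm (q \<ominus> c \<odot> x) < e" by blast
    qed
  qed
  moreover have "S \<subseteq> cl (range ?v)"
  proof
    fix x assume "x \<in> S"
    then obtain i where "x = ?v (Gen i)" using rg by (metis insertI2 imageE term_value.simps(1))
    then show "x \<in> cl (range ?v)" using cl_superset[OF Q] by blast
  qed
  moreover have "range (\<lambda>i. ?v (from_nat i)) = range ?v"
    by (metis surj_from_nat image_image)
  ultimately show thesis using that[of "\<lambda>i. ?v (from_nat i)"] Q by simp
qed

text \<open>An element is coded by which members of the dense sequence lie how close to it. Two
  elements with the same code share an approximant at every precision, so the triangle inequality
  makes their distance zero.\<close>

lemma (in star_algebra) code_inj_on:
  assumes q: "range q \<subseteq> carrier A"
  shows "inj_on (\<lambda>x. {prod_encode (i, j) | i j. nrm (q i \<ominus> x) < 1 / real (Suc j)}) (cl (range q))"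
proof (rule inj_onI)
  fix x y
  assume x: "x \<in> cl (range q)" and y: "y \<in> cl (range q)"
    and eq: "{prod_encode (i, j) | i j. nrm (q i \<ominus> x) < 1 / real (Suc j)} =
      {prod_encode (i, j) | i j. nrm (q i \<ominus> y) < 1 / real (Suc j)}"
  have c: "x \<in> carrier A" "y \<in> carrier A" "\<And>i. q i \<in> carrier A" using x y q by (auto simp: cl_def)
  have "nrm (x \<ominus> y) \<le> 0 + e" if e: "e > 0" for e
  proof -
    obtain j where j: "1 / real (Suc j) < e / 2" using nat_approx_posE[of "e/2"] e by auto
    obtain i where i: "nrm (q i \<ominus> x) < 1 / real (Suc j)"
      using x unfolding cl_def by (auto dest!: spec[of _ "1 / real (Suc j)"])
    then have "prod_encode (i, j) \<in> {prod_encode (i, j) | i j. nrm (q i \<ominus> y) < 1 / real (Suc j)}"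
      unfolding eq[symmetric] by blast
    then have "nrm (q i \<ominus> y) < 1 / real (Suc j)" by auto
    then show ?thesis
      using i j nrm_triangle_middle[of x "q i" y] nrm_minus_commute[of x "q i"] c by simp
  qed
  then have "nrm (x \<ominus> y) \<le> 0" by (rule field_le_epsilon)
  then have "nrm (x \<ominus> y) = 0" using nrm_nonneg[OF minus_closed[OF c(1,2)]] by linarith
  then show "x = y" using c by (simp add: nrm_eq_0_iff)
qed

text \<open>The codes serve as elements and every operation is carried out after decoding by
  \<open>\<psi>\<close>. This bridges the gap between the universal properties, whose targets have
  elements in \<open>nat set\<close>, and targets of arbitrary type.\<close>

lemma nat_set_copy:
  fixes B :: "'b cstar"
  assumes B: "star_algebra B" and S: "countable S" "S \<subseteq> carrier B"
  obtains C :: "nat set cstar" and \<psi> where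
    "star_morphism C B \<psi>" "inj_on \<psi> (carrier C)" "S \<subseteq> \<psi> ` carrier C"
proof -
  interpret B: star_algebra B by fact
  obtain q :: "nat \<Rightarrow> 'b" where q: "range q \<subseteq> carrier B" 
    "cstar_subalgebra (B.cl (range q)) B" "S \<subseteq> B.cl (range q)"
    using B.separable_subalgebra[OF S] .
  define D where "D = B.cl (range q)"
  define \<phi> where "\<phi> x = {prod_encode (i, j) | i j. nrm\<^bsub>B\<^esub> (q i \<ominus>\<^bsub>B\<^esub> x) < 1 / real (Suc j)}" for x
  have inj: "inj_on \<phi> D" unfolding \<phi>_def D_def by (rule B.code_inj_on[OF q(1)])
  define \<psi> where "\<psi> = inv_into D \<phi>"
  have \<psi>\<phi>[simp]: "\<psi> (\<phi> x) = x" if "x \<in> D" for x using inj that by (simp add: \<psi>_def)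
  have im: "\<psi> ` \<phi> ` D = D" by (force simp: image_image)
  have sub: "cstar_subalgebra D B" using q(2) by (simp add: D_def)
  then have D[simp]: "\<one>\<^bsub>B\<^esub> \<in> D" "\<And>x y. x \<in> D \<Longrightarrow> y \<in> D \<Longrightarrow> x \<oplus>\<^bsub>B\<^esub> y \<in> D"
    "\<And>x y. x \<in> D \<Longrightarrow> y \<in> D \<Longrightarrow> x \<otimes>\<^bsub>B\<^esub> y \<in> D" "\<And>c x. x \<in> D \<Longrightarrow> c \<odot>\<^bsub>B\<^esub> x \<in> D"
    "\<And>x. x \<in> D \<Longrightarrow> adj\<^bsub>B\<^esub> x \<in> D" "\<And>x. x \<in> D \<Longrightarrow> x \<in> carrier B"
    unfolding cstar_subalgebra_def by auto
  have [simp]: "\<zero>\<^bsub>B\<^esub> \<in> D" using D(4)[OF D(1), of 0] by simp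
  define C :: "nat set cstar" where "C = \<lparr>carrier = \<phi> ` D, mult = (\<lambda>x y. \<phi> (\<psi> x \<otimes>\<^bsub>B\<^esub> \<psi> y)),
    one = \<phi> \<one>\<^bsub>B\<^esub>, zero = \<phi> \<zero>\<^bsub>B\<^esub>, add = (\<lambda>x y. \<phi> (\<psi> x \<oplus>\<^bsub>B\<^esub> \<psi> y)),
    smult = (\<lambda>c x. \<phi> (c \<odot>\<^bsub>B\<^esub> \<psi> x)), adjoint_of = (\<lambda>x. \<phi> (adj\<^bsub>B\<^esub> (\<psi> x))),
    norm_of = (\<lambda>x. nrm\<^bsub>B\<^esub> (\<psi> x))\<rparr>"
  have "star_morphism C B \<psi>"
  proof (rule star_algebra_transport[OF B])
    show "inj_on \<psi> (carrier C)" by (auto simp: C_def inj_on_def)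
    show "cstar_subalgebra (\<psi> ` carrier C) B" using sub by (simp add: C_def im)
  qed (auto simp: C_def)
  moreover have "inj_on \<psi> (carrier C)" by (auto simp: C_def inj_on_def)
  moreover have "S \<subseteq> \<psi> ` carrier C" using q(3) by (simp add: C_def im D_def[symmetric])
  ultimately show thesis by (rule that)
qed

section \<open>Universal properties for targets of arbitrary type\<close>

lemma finite_pairs: "finite (pairs n)"
  by (rule finite_subset[of _ "{1..n} \<times> {1..n}"]) (auto simp: pairs_def)

text \<open>The relations are pulled back along \<open>\<psi>\<close> to a copy \<open>C\<close> of
  a separable subalgebra containing the prescribed images; the universal property gives a map into
  \<open>C\<close>, and \<open>\<psi>\<close> leads back to \<open>B\<close>.\<close>

lemma group_cstar_universal:
  fixes B :: "'b cstar"
  assumes A: "is_group_cstar n A U V" and B: "star_algebra B" and G: "G_relations n B U' V'"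
  obtains h where "star_morphism A B h" "\<And>i. i \<in> {1..n} \<Longrightarrow> h (U i) = U' i"
    "\<And>p. p \<in> pairs n \<Longrightarrow> h (V p) = V' p"
proof -
  have sA: "star_algebra A" using A by (simp add: is_group_cstar_def cstar_algebra_iff_star_algebra)
  interpret B: star_algebra B by fact
  let ?S = "U' ` {1..n} \<union> V' ` pairs n"
  have sub: "?S \<subseteq> carrier B" using G unfolding B.G_relations_iff by (auto simp: unitary_in_def)
  obtain C :: "nat set cstar" and \<psi> where C:
    "star_morphism C B \<psi>" "inj_on \<psi> (carrier C)" "?S \<subseteq> \<psi> ` carrier C"
    by (rule nat_set_copy[OF B _ sub]) (simp add: countable_finite finite_pairs)
  interpret \<psi>: star_morphism C B \<psi> by (rule C(1))
  define u where "u i = inv_into (carrier C) \<psi> (U' i)" for i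
  define v where "v p = inv_into (carrier C) \<psi> (V' p)" for p
  have u: "u i \<in> carrier C \<and> \<psi> (u i) = U' i" if "i \<in> {1..n}" for i
    unfolding u_def using C(3) that by (intro conjI inv_into_into f_inv_into_f) auto
  have v: "v p \<in> carrier C \<and> \<psi> (v p) = V' p" if "p \<in> pairs n" for p
    unfolding v_def using C(3) that by (intro conjI inv_into_into f_inv_into_f) auto
  have "G_relations n C u v" using \<psi>.inj_G_relations[OF C(2) u v G] by blast
  moreover have "\<forall>(B :: nat set cstar) U' V'. cstar_algebra B \<and> G_relations n B U' V' \<longrightarrow>
      (\<exists>h\<in>star_hom A B. (\<forall>i\<in>{1..n}. h (U i) = U' i) \<and> (\<forall>p\<in>pairs n. h (V p) = V' p))"
    using A unfolding is_group_cstar_def by (elim conjE)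
  ultimately have "\<exists>h\<in>star_hom A C. (\<forall>i\<in>{1..n}. h (U i) = u i) \<and> (\<forall>p\<in>pairs n. h (V p) = v p)"
    using \<psi>.A.star_algebra_axioms cstar_algebra_iff_star_algebra[of C] by simp
  then obtain h where h: "h \<in> star_hom A C" "\<forall>i\<in>{1..n}. h (U i) = u i" "\<forall>p\<in>pairs n. h (V p) = v p"
    by blast
  have "star_morphism A C h"
    using h(1) sA \<psi>.A.star_algebra_axioms by (simp add: star_morphism_def star_morphism_axioms_def)
  then have "star_morphism A B (\<psi> \<circ> h)" using C(1) by (rule star_morphism_comp)
  then show thesis by (rule that) (use h u v in auto)
qed

lemma nc_torus_universal:
  fixes B :: "'b cstar"
  assumes A: "is_nc_torus n \<theta> A W" and B: "star_algebra B" and T: "torus_relations n \<theta> B W'"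
  obtains h where "star_morphism A B h" "\<And>i. i \<in> {1..n} \<Longrightarrow> h (W i) = W' i"
proof -
  have sA: "star_algebra A" using A by (simp add: is_nc_torus_def cstar_algebra_iff_star_algebra)
  interpret B: star_algebra B by fact
  let ?S = "W' ` {1..n}"
  have sub: "?S \<subseteq> carrier B" using T unfolding B.torus_relations_iff by (auto simp: unitary_in_def)
  obtain C :: "nat set cstar" and \<psi> where C:
    "star_morphism C B \<psi>" "inj_on \<psi> (carrier C)" "?S \<subseteq> \<psi> ` carrier C"
    by (rule nat_set_copy[OF B _ sub]) (simp add: countable_finite)
  interpret \<psi>: star_morphism C B \<psi> by (rule C(1))
  define w where "w i = inv_into (carrier C) \<psi> (W' i)" for i
  have w: "w i \<in> carrier C \<and> \<psi> (w i) = W' i" if "i \<in> {1..n}" for i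
    unfolding w_def using C(3) that by (intro conjI inv_into_into f_inv_into_f) auto
  have "torus_relations n \<theta> C w" using \<psi>.inj_torus_relations[OF C(2) w T] by blast
  moreover have "\<forall>(B :: nat set cstar) W'. cstar_algebra B \<and> torus_relations n \<theta> B W' \<longrightarrow>
      (\<exists>h\<in>star_hom A B. \<forall>i\<in>{1..n}. h (W i) = W' i)"
    using A unfolding is_nc_torus_def by (elim conjE)
  ultimately have "\<exists>h\<in>star_hom A C. \<forall>i\<in>{1..n}. h (W i) = w i"
    using \<psi>.A.star_algebra_axioms cstar_algebra_iff_star_algebra[of C] by simp
  then obtain h where h: "h \<in> star_hom A C" "\<forall>i\<in>{1..n}. h (W i) = w i" by blast
  have "star_morphism A C h"
    using h(1) sA \<psi>.A.star_algebra_axioms by (simp add: star_morphism_def star_morphism_axioms_def)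
  then have "star_morphism A B (\<psi> \<circ> h)" using C(1) by (rule star_morphism_comp)
  then show thesis by (rule that) (use h w in auto)
qed

section \<open>Square-summable families\<close>

text \<open>The Hilbert space of the regular representation. The type classes provide only its real
  structure, with the real part of the Hermitian form as inner product; complex scalars are added by
  \<open>scale_ell2\<close>.\<close>

typedef 'i ell2 = "{f :: 'i \<Rightarrow> complex. (\<lambda>i. (cmod (f i))\<^sup>2) summable_on UNIV}"
  by (rule exI[of _ "\<lambda>_. 0"]) simp

setup_lifting type_definition_ell2

lemma ell2_summable: "(\<lambda>i. (cmod (Rep_ell2 f i))\<^sup>2) summable_on UNIV"
  using Rep_ell2 by auto

lemma square_summable_add:
  fixes f g :: "'i \<Rightarrow> complex"
  assumes "(\<lambda>i. (cmod (f i))\<^sup>2) summable_on UNIV" "(\<lambda>i. (cmod (g i))\<^sup>2) summable_on UNIV"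
  shows "(\<lambda>i. (cmod (f i + g i))\<^sup>2) summable_on UNIV"
proof (rule summable_on_comparison_test)
  show "(\<lambda>i. 2 * (cmod (f i))\<^sup>2 + 2 * (cmod (g i))\<^sup>2) summable_on UNIV"
    using assms by (intro summable_on_add summable_on_cmult_right)
  fix i
  have "(cmod (f i + g i))\<^sup>2 \<le> (cmod (f i) + cmod (g i))\<^sup>2"
    by (intro power_mono norm_triangle_ineq) simp
  also have "\<dots> \<le> 2 * (cmod (f i))\<^sup>2 + 2 * (cmod (g i))\<^sup>2"
    using zero_le_power2[of "cmod (f i) - cmod (g i)"] by (simp add: power2_sum power2_diff)
  finally show "(cmod (f i + g i))\<^sup>2 \<le> 2 * (cmod (f i))\<^sup>2 + 2 * (cmod (g i))\<^sup>2" .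
qed simp

lemma square_summable_mult:
  fixes f :: "'i \<Rightarrow> complex"
  assumes "(\<lambda>i. (cmod (f i))\<^sup>2) summable_on UNIV"
  shows "(\<lambda>i. (cmod (c * f i))\<^sup>2) summable_on UNIV"
  using summable_on_cmult_right[OF assms, of "(cmod c)\<^sup>2"] by (simp add: norm_mult power_mult_distrib)

lemma square_summable_inner:
  fixes f g :: "'i \<Rightarrow> complex"
  assumes "(\<lambda>i. (cmod (f i))\<^sup>2) summable_on UNIV" "(\<lambda>i. (cmod (g i))\<^sup>2) summable_on UNIV"
  shows "(\<lambda>i. f i \<bullet> g i) summable_on UNIV"
proof (rule abs_summable_summable, rule summable_on_comparison_test)
  show "(\<lambda>i. (cmod (f i))\<^sup>2 + (cmod (g i))\<^sup>2) summable_on UNIV"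
    using assms by (intro summable_on_add)
  fix i
  have "norm (f i \<bullet> g i) \<le> cmod (f i) * cmod (g i)" by (simp add: Cauchy_Schwarz_ineq2)
  also have "\<dots> \<le> (cmod (f i))\<^sup>2 + (cmod (g i))\<^sup>2"
    using zero_le_power2[of "cmod (f i) - cmod (g i)"] zero_le_power2[of "cmod (f i)"]
      zero_le_power2[of "cmod (g i)"] unfolding power2_diff by linarith
  finally show "norm (f i \<bullet> g i) \<le> (cmod (f i))\<^sup>2 + (cmod (g i))\<^sup>2" .
qed simp

instantiation ell2 :: (type) real_vector
begin

lift_definition zero_ell2 :: "'a ell2" is "\<lambda>_. 0" by simp
lift_definition plus_ell2 :: "'a ell2 \<Rightarrow> 'a ell2 \<Rightarrow> 'a ell2" is "\<lambda>f g i. f i + g i"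
  by (rule square_summable_add)
lift_definition uminus_ell2 :: "'a ell2 \<Rightarrow> 'a ell2" is "\<lambda>f i. - f i" by simp
lift_definition minus_ell2 :: "'a ell2 \<Rightarrow> 'a ell2 \<Rightarrow> 'a ell2" is "\<lambda>f g i. f i - g i"
  using square_summable_add[of _ "\<lambda>i. - _ i"] by fastforce
lift_definition scaleR_ell2 :: "real \<Rightarrow> 'a ell2 \<Rightarrow> 'a ell2" is "\<lambda>r f i. r *\<^sub>R f i"
  using square_summable_mult[of _ "of_real _"] by (simp add: scaleR_conv_of_real)

instance
  by standard (transfer; simp add: algebra_simps)+

end

instantiation ell2 :: (type) real_inner
begin

definition inner_ell2 :: "'a ell2 \<Rightarrow> 'a ell2 \<Rightarrow> real" where
  "inner_ell2 f g = (\<Sum>\<^sub>\<infinity>i. Rep_ell2 f i \<bullet> Rep_ell2 g i)"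
definition norm_ell2 :: "'a ell2 \<Rightarrow> real" where "norm_ell2 f = sqrt (f \<bullet> f)"
definition sgn_ell2 :: "'a ell2 \<Rightarrow> 'a ell2" where "sgn_ell2 f = f /\<^sub>R norm f"
definition dist_ell2 :: "'a ell2 \<Rightarrow> 'a ell2 \<Rightarrow> real" where "dist_ell2 f g = norm (f - g)"
definition uniformity_ell2 :: "('a ell2 \<times> 'a ell2) filter" where
  "uniformity_ell2 = (INF e\<in>{0 <..}. principal {(x, y). dist x y < e})"
definition open_ell2 :: "'a ell2 set \<Rightarrow> bool" where
  "open_ell2 S = (\<forall>x\<in>S. \<forall>\<^sub>F (x', y) in uniformity. x' = x \<longrightarrow> y \<in> S)"

instance
proof
  fix x y z :: "'a ell2" and r :: real and S :: "'a ell2 set"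
  show "dist x y = norm (x - y)" "sgn x = x /\<^sub>R norm x"
    "uniformity = (INF e\<in>{0 <..}. principal {(x :: 'a ell2, y). dist x y < e})"
    "open S = (\<forall>x\<in>S. \<forall>\<^sub>F (x', y) in uniformity. x' = x \<longrightarrow> y \<in> S)"
    "norm x = sqrt (x \<bullet> x)"
    by (fact dist_ell2_def sgn_ell2_def uniformity_ell2_def open_ell2_def norm_ell2_def)+
  show "x \<bullet> y = y \<bullet> x" by (simp add: inner_ell2_def inner_commute)
  show "(x + y) \<bullet> z = x \<bullet> z + y \<bullet> z"
    using infsum_add[OF square_summable_inner square_summable_inner, OF ell2_summable ell2_summable
        ell2_summable ell2_summable, of x z y z]
    by (simp add: inner_ell2_def plus_ell2.rep_eq inner_add_left)
  show "(r *\<^sub>R x) \<bullet> y = r * (x \<bullet> y)"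
    by (simp add: inner_ell2_def scaleR_ell2.rep_eq infsum_cmult_right')
  show "0 \<le> x \<bullet> x" by (simp add: inner_ell2_def infsum_nonneg)
  show "x \<bullet> x = 0 \<longleftrightarrow> x = 0"
  proof
    assume "x \<bullet> x = 0"
    then have "Rep_ell2 x i \<bullet> Rep_ell2 x i = 0" for i
      unfolding inner_ell2_def
      by (intro nonneg_infsum_le_0D[OF _ square_summable_inner, OF _ ell2_summable ell2_summable]) auto
    then have "Rep_ell2 x = Rep_ell2 0" by (simp add: fun_eq_iff zero_ell2.rep_eq)
    then show "x = 0" by (simp add: Rep_ell2_inject)
  qed (simp add: inner_ell2_def zero_ell2.rep_eq)
qed

end

lemma norm_ell2_square: "(norm f)\<^sup>2 = (\<Sum>\<^sub>\<infinity>i. (cmod (Rep_ell2 f i))\<^sup>2)"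
  by (simp add: power2_norm_eq_inner inner_ell2_def)

lemma sum_le_norm_ell2_square:
  assumes "finite F"
  shows "(\<Sum>i\<in>F. (cmod (Rep_ell2 f i))\<^sup>2) \<le> (norm f)\<^sup>2"
  unfolding norm_ell2_square using assms by (intro finite_sum_le_infsum ell2_summable) auto

lemma norm_coord_ell2: "cmod (Rep_ell2 f i) \<le> norm f"
  by (rule power2_le_imp_le[OF _ norm_ge_zero]) (use sum_le_norm_ell2_square[of "{i}" f] in simp)

text \<open>A Cauchy sequence has a coordinatewise limit \<open>L\<close>. Sums over a finite set of
  coordinates are bounded by the norms of differences and pass to the limit; the bound is uniform in
  the finite set, so it holds for the infinite sum.\<close>

instance ell2 :: (type) complete_space
proof
  fix s :: "nat \<Rightarrow> 'a ell2"
  assume s: "Cauchy s"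
  have "Cauchy (\<lambda>n. Rep_ell2 (s n) i)" for i
  proof (rule CauchyI)
    fix e :: real assume "e > 0"
    then obtain M where M: "\<forall>m\<ge>M. \<forall>n\<ge>M. norm (s m - s n) < e" using CauchyD[OF s] by blast
    have "norm (Rep_ell2 (s m) i - Rep_ell2 (s n) i) \<le> norm (s m - s n)" for m n
      using norm_coord_ell2[of "s m - s n" i] by (simp add: minus_ell2.rep_eq)
    then show "\<exists>M. \<forall>m\<ge>M. \<forall>n\<ge>M. norm (Rep_ell2 (s m) i - Rep_ell2 (s n) i) < e"
      using M order.strict_trans1 by blast
  qed
  then have "\<forall>i. \<exists>l. (\<lambda>n. Rep_ell2 (s n) i) \<longlonglongrightarrow> l"
    using Cauchy_convergent unfolding convergent_def by blast
  then obtain L where L: "\<And>i. (\<lambda>n. Rep_ell2 (s n) i) \<longlonglongrightarrow> L i" by metis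
  have near: "(\<lambda>i. (cmod (Rep_ell2 (s m) i - L i))\<^sup>2) summable_on UNIV \<and>
      (\<Sum>\<^sub>\<infinity>i. (cmod (Rep_ell2 (s m) i - L i))\<^sup>2) \<le> e\<^sup>2"
    if M: "\<forall>m\<ge>M. \<forall>n\<ge>M. norm (s m - s n) < e" and m: "m \<ge> M" for e M m
  proof -
    have fin: "(\<Sum>i\<in>F. (cmod (Rep_ell2 (s m) i - L i))\<^sup>2) \<le> e\<^sup>2" if F: "finite F" for F
    proof (rule LIMSEQ_le_const2)
      show "(\<lambda>n. \<Sum>i\<in>F. (cmod (Rep_ell2 (s m) i - Rep_ell2 (s n) i))\<^sup>2)
          \<longlonglongrightarrow> (\<Sum>i\<in>F. (cmod (Rep_ell2 (s m) i - L i))\<^sup>2)"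
        by (intro tendsto_intros L)
      have "(\<Sum>i\<in>F. (cmod (Rep_ell2 (s m) i - Rep_ell2 (s n) i))\<^sup>2) \<le> e\<^sup>2" if "n \<ge> M" for n
      proof -
        have "(\<Sum>i\<in>F. (cmod (Rep_ell2 (s m) i - Rep_ell2 (s n) i))\<^sup>2) \<le> (norm (s m - s n))\<^sup>2"
          using sum_le_norm_ell2_square[OF F, of "s m - s n"] by (simp add: minus_ell2.rep_eq)
        also have "\<dots> \<le> e\<^sup>2" using M m that by (intro power_mono norm_ge_zero less_imp_le) blast
        finally show ?thesis .
      qed
      then show "\<exists>N. \<forall>n\<ge>N. (\<Sum>i\<in>F. (cmod (Rep_ell2 (s m) i - Rep_ell2 (s n) i))\<^sup>2) \<le> e\<^sup>2" by blast
    qed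
    have summ: "(\<lambda>i. (cmod (Rep_ell2 (s m) i - L i))\<^sup>2) summable_on UNIV"
      by (rule nonneg_bdd_above_summable_on) (use fin in \<open>auto intro!: bdd_aboveI2[where M="e\<^sup>2"]\<close>)
    then show ?thesis using fin by (auto intro: infsum_le_finite_sums)
  qed
  \<comment> \<open>A single member at finite distance from \<open>L\<close> suffices:
    \<open>L\<close> is that member minus a square-summable difference.\<close>
  obtain M1 where "\<forall>m\<ge>M1. \<forall>n\<ge>M1. norm (s m - s n) < 1" using CauchyD[OF s, of 1] by auto
  from near[OF this, of M1] have "(\<lambda>i. (cmod (Rep_ell2 (s M1) i - L i))\<^sup>2) summable_on UNIV" by simp
  from square_summable_add[OF ell2_summable[of "s M1"] square_summable_mult[OF this, of "-1"]]
  have "(\<lambda>i. (cmod (L i))\<^sup>2) summable_on UNIV" by simp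
  then have L': "Rep_ell2 (Abs_ell2 L) = L" by (simp add: Abs_ell2_inverse)
  have "s \<longlonglongrightarrow> Abs_ell2 L"
  proof (rule LIMSEQ_I)
    fix r :: real assume r: "r > 0"
    then obtain M where M: "\<forall>m\<ge>M. \<forall>n\<ge>M. norm (s m - s n) < r / 2" using CauchyD[OF s, of "r/2"] by auto
    have "norm (s m - Abs_ell2 L) < r" if m: "m \<ge> M" for m
    proof -
      have "(norm (s m - Abs_ell2 L))\<^sup>2 \<le> (r / 2)\<^sup>2"
        using near[OF M m] by (simp add: norm_ell2_square minus_ell2.rep_eq L')
      then have "norm (s m - Abs_ell2 L) \<le> r / 2" by (rule power2_le_imp_le) (use r in simp)
      then show ?thesis using r by simp
    qed
    then show "\<exists>N. \<forall>n\<ge>N. norm (s n - Abs_ell2 L) < r" by blast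
  qed
  then show "convergent s" by (auto simp: convergent_def)
qed

instance ell2 :: (type) banach ..

lift_definition delta :: "'i \<Rightarrow> 'i ell2" is "\<lambda>k i. if i = k then 1 else 0"
proof -
  fix k :: 'i
  have "finite {i. i = k}" by simp
  then show "(\<lambda>i. (cmod (if i = k then 1 else 0))\<^sup>2) summable_on UNIV"
    by (intro summable_on_cong_neutral[THEN iffD1, OF _ _ _ summable_on_finite[of "{k}"]]) auto
qed

lemma norm_delta: "norm (delta k) = 1"
proof -
  have "(norm (delta k))\<^sup>2 = (\<Sum>\<^sub>\<infinity>i. if i = k then 1 else 0)"
    unfolding norm_ell2_square by (rule infsum_cong) (simp add: delta.rep_eq)
  also have "\<dots> = (\<Sum>\<^sub>\<infinity>i\<in>{k}. 1 :: real)" by (rule infsum_cong_neutral) auto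
  finally show ?thesis by (simp add: power2_eq_1_iff) (use norm_ge_zero[of "delta k"] in linarith)
qed

section \<open>Operators on square-summable families\<close>

lift_definition scale_ell2 :: "complex \<Rightarrow> 'i ell2 \<Rightarrow> 'i ell2" is "\<lambda>c f i. c * f i"
  by (rule square_summable_mult)

lemma ell2_eqI: "(\<And>i. Rep_ell2 f i = Rep_ell2 g i) \<Longrightarrow> f = g"
  using Rep_ell2_inject by blast

lemma norm_scale_ell2: "norm (scale_ell2 c f) = cmod c * norm f"
proof -
  have "(norm (scale_ell2 c f))\<^sup>2 = (\<Sum>\<^sub>\<infinity>i. (cmod c)\<^sup>2 * (cmod (Rep_ell2 f i))\<^sup>2)"
    by (simp add: norm_ell2_square scale_ell2.rep_eq norm_mult power_mult_distrib)
  also have "\<dots> = (cmod c * norm f)\<^sup>2"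
    by (simp add: infsum_cmult_right' power_mult_distrib norm_ell2_square)
  finally show ?thesis by (rule power2_eq_imp_eq) simp_all
qed

lemma inner_scale_ell2: "scale_ell2 c f \<bullet> g = f \<bullet> scale_ell2 (cnj c) g"
  unfolding inner_ell2_def
  by (rule infsum_cong) (simp add: scale_ell2.rep_eq inner_complex_def algebra_simps)

lemma scale_ell2_simps:
  "scale_ell2 c (f + g) = scale_ell2 c f + scale_ell2 c g"
  "scale_ell2 (c + d) f = scale_ell2 c f + scale_ell2 d f"
  "scale_ell2 c (scale_ell2 d f) = scale_ell2 (c * d) f"
  "scale_ell2 1 f = f"
  by (rule ell2_eqI; simp add: scale_ell2.rep_eq plus_ell2.rep_eq algebra_simps)+

lemma bounded_linear_scale_ell2: "bounded_linear (scale_ell2 c)"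
proof (rule bounded_linear_intro)
  show "scale_ell2 c (r *\<^sub>R f) = r *\<^sub>R scale_ell2 c f" for r f
    by (rule ell2_eqI) (simp add: scale_ell2.rep_eq scaleR_ell2.rep_eq)
  show "norm (scale_ell2 c f) \<le> norm f * cmod c" for f by (simp add: norm_scale_ell2)
qed (rule scale_ell2_simps)

definition scale_op :: "complex \<Rightarrow> 'i ell2 \<Rightarrow>\<^sub>L 'i ell2" where
  "scale_op c = Blinfun (scale_ell2 c)"

lemma scale_op_apply [simp]: "blinfun_apply (scale_op c) f = scale_ell2 c f"
  by (simp add: scale_op_def bounded_linear_Blinfun_apply bounded_linear_scale_ell2)

text \<open>
  An operator is paired with its adjoint, so that taking adjoints is swapping the components.
\<close>

type_synonym 'i operator_pair = "('i ell2 \<Rightarrow>\<^sub>L 'i ell2) \<times> ('i ell2 \<Rightarrow>\<^sub>L 'i ell2)"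

abbreviation fwd :: "'i operator_pair \<Rightarrow> 'i ell2 \<Rightarrow> 'i ell2" where
  "fwd p \<equiv> blinfun_apply (fst p)"

abbreviation bwd :: "'i operator_pair \<Rightarrow> 'i ell2 \<Rightarrow> 'i ell2" where
  "bwd p \<equiv> blinfun_apply (snd p)"

text \<open>Commuting with \<open>scale_ell2\<close> singles out the complex-linear operators. For
  these, the identity between real parts of the Hermitian form implies the identity of the forms
  themselves, on replacing \<open>f\<close> by its multiple by \<i>, so the pairs are genuine
  Hilbert space adjoints.\<close>

definition adjoint_pairs :: "'i operator_pair set" where
  "adjoint_pairs = {p :: 'i operator_pair. (\<forall>c f. fwd p (scale_ell2 c f) = scale_ell2 c (fwd p f)) \<and>
     (\<forall>c f. bwd p (scale_ell2 c f) = scale_ell2 c (bwd p f)) \<and>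
     (\<forall>f g. fwd p f \<bullet> g = f \<bullet> bwd p g)}"

definition operator_algebra :: "'i operator_pair cstar" where
  "operator_algebra = \<lparr>carrier = adjoint_pairs, mult = (\<lambda>p q. (fst p o\<^sub>L fst q, snd q o\<^sub>L snd p)),
    one = (id_blinfun, id_blinfun), zero = 0, add = (+),
    smult = (\<lambda>c p. (scale_op c o\<^sub>L fst p, scale_op (cnj c) o\<^sub>L snd p)),
    adjoint_of = prod.swap, norm_of = (\<lambda>p. norm (fst p))\<rparr>"

lemma adjoint_pairsD:
  assumes "p \<in> adjoint_pairs"
  shows "fwd p (scale_ell2 c f) = scale_ell2 c (fwd p f)"
    "bwd p (scale_ell2 c f) = scale_ell2 c (bwd p f)" "fwd p f \<bullet> g = f \<bullet> bwd p g"
    "bwd p f \<bullet> g = f \<bullet> fwd p g"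
  using assms unfolding adjoint_pairs_def by (auto simp: inner_commute)

lemma adjoint_pairs_swap: "p \<in> adjoint_pairs \<Longrightarrow> prod.swap p \<in> adjoint_pairs"
  unfolding adjoint_pairs_def by (auto simp: inner_commute)

text \<open>The squared norm of \<open>bwd p f\<close> is the inner product of
  \<open>fwd p (bwd p f)\<close> with \<open>f\<close>; Cauchy-Schwarz applies and one factor
  cancels. Swapping the components yields equality.\<close>

lemma norm_snd_le_norm_fst:
  assumes p: "p \<in> adjoint_pairs"
  shows "norm (snd p) \<le> norm (fst p)"
proof (rule norm_blinfun_bound)
  fix f
  have "norm (bwd p f) * norm (bwd p f) = fwd p (bwd p f) \<bullet> f"
    using adjoint_pairsD(3)[OF p, of "bwd p f" f] by (simp add: power2_norm_eq_inner flip: power2_eq_square)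
  also have "\<dots> \<le> norm (fwd p (bwd p f)) * norm f" by (rule norm_cauchy_schwarz)
  also have "\<dots> \<le> norm (fst p) * norm (bwd p f) * norm f"
    by (intro mult_right_mono norm_blinfun norm_ge_zero)
  finally have "norm (bwd p f) * norm (bwd p f) \<le> (norm (fst p) * norm f) * norm (bwd p f)"
    by (simp add: mult_ac)
  then show "norm (bwd p f) \<le> norm (fst p) * norm f"
    by (cases "bwd p f = 0") (auto simp: mult_le_cancel_right)
qed simp

lemma norm_adjoint_pair: "p \<in> adjoint_pairs \<Longrightarrow> norm (snd p) = norm (fst p)"
  using norm_snd_le_norm_fst[of p] norm_snd_le_norm_fst[of "prod.swap p"] adjoint_pairs_swap[of p] by simp

text \<open>An adjoint is determined by its operator, so equations in
  \<open>operator_algebra\<close> may be checked on first components.\<close>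

lemma adjoint_pairs_eqI:
  assumes "p \<in> adjoint_pairs" "q \<in> adjoint_pairs" "\<And>f. fwd p f = fwd q f"
  shows "p = q"
proof -
  have "(bwd p g - bwd q g) \<bullet> (bwd p g - bwd q g) = 0" for g
    using adjoint_pairsD(3)[OF assms(1), of "bwd p g - bwd q g" g]
      adjoint_pairsD(3)[OF assms(2), of "bwd p g - bwd q g" g] assms(3)
    by (simp add: inner_diff_right)
  then have "bwd p g = bwd q g" for g by simp
  then show ?thesis using assms(3) by (intro prod_eqI blinfun_eqI)
qed

text \<open>The C*-identity for operators: the squared norm of \<open>fwd p f\<close> is the inner
  product of \<open>f\<close> with \<open>bwd p (fwd p f)\<close>.\<close>

lemma norm_adjoint_comp:
  assumes p: "p \<in> adjoint_pairs"
  shows "norm (snd p o\<^sub>L fst p) = (norm (fst p))\<^sup>2"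
proof (rule antisym)
  show "norm (snd p o\<^sub>L fst p) \<le> (norm (fst p))\<^sup>2"
    using norm_blinfun_compose[of "snd p" "fst p"] by (simp add: norm_adjoint_pair[OF p] power2_eq_square)
  have "norm (fwd p f) \<le> sqrt (norm (snd p o\<^sub>L fst p)) * norm f" for f
  proof -
    have "(norm (fwd p f))\<^sup>2 = f \<bullet> (snd p o\<^sub>L fst p) f"
      using adjoint_pairsD(3)[OF p, of f "fwd p f"] by (simp add: power2_norm_eq_inner)
    also have "\<dots> \<le> norm f * norm ((snd p o\<^sub>L fst p) f)" by (rule norm_cauchy_schwarz)
    also have "\<dots> \<le> norm f * (norm (snd p o\<^sub>L fst p) * norm f)"
      by (intro mult_left_mono norm_blinfun norm_ge_zero)
    also have "\<dots> = (sqrt (norm (snd p o\<^sub>L fst p)) * norm f)\<^sup>2"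
      by (simp add: power_mult_distrib power2_eq_square mult_ac)
    finally show ?thesis by (rule power2_le_imp_le) simp
  qed
  then have "norm (fst p) \<le> sqrt (norm (snd p o\<^sub>L fst p))" by (intro norm_blinfun_bound) auto
  then have "(norm (fst p))\<^sup>2 \<le> (sqrt (norm (snd p o\<^sub>L fst p)))\<^sup>2" by (intro power_mono) auto
  then show "(norm (fst p))\<^sup>2 \<le> norm (snd p o\<^sub>L fst p)" by simp
qed

lemma adjoint_pairs_closed:
  assumes s: "\<And>i::nat. s i \<in> adjoint_pairs" and T: "(\<lambda>i. fst (s i)) \<longlonglongrightarrow> T" and R: "(\<lambda>i. snd (s i)) \<longlonglongrightarrow> R"
  shows "(T, R) \<in> adjoint_pairs"
proof -
  have Tf: "(\<lambda>i. fwd (s i) f) \<longlonglongrightarrow> T f" and Rf: "(\<lambda>i. bwd (s i) f) \<longlonglongrightarrow> R f" for f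
    by (intro blinfun.tendsto T R tendsto_const)+
  have sc: "(\<lambda>i. scale_ell2 c (g i)) \<longlonglongrightarrow> scale_ell2 c l" if "g \<longlonglongrightarrow> l" for c g and l :: "'a ell2"
    by (rule bounded_linear.tendsto[OF bounded_linear_scale_ell2 that])
  have "T (scale_ell2 c f) = scale_ell2 c (T f)" for c f
    using LIMSEQ_unique[OF Tf[of "scale_ell2 c f"], unfolded adjoint_pairsD(1)[OF s], OF sc[OF Tf]] .
  moreover have "R (scale_ell2 c f) = scale_ell2 c (R f)" for c f
    using LIMSEQ_unique[OF Rf[of "scale_ell2 c f"], unfolded adjoint_pairsD(2)[OF s], OF sc[OF Rf]] .
  moreover have "T f \<bullet> g = f \<bullet> R g" for f g
    using LIMSEQ_unique[OF tendsto_inner[OF Tf tendsto_const], unfolded adjoint_pairsD(3)[OF s],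
        OF tendsto_inner[OF tendsto_const Rf]] .
  ultimately show ?thesis by (simp add: adjoint_pairs_def)
qed

lemma scale_ell2_zero_uminus [simp]:
  "scale_ell2 c 0 = 0" "scale_ell2 c (- f) = - scale_ell2 c f"
  by (rule ell2_eqI; simp add: scale_ell2.rep_eq zero_ell2.rep_eq uminus_ell2.rep_eq)+

lemma adjoint_pairs_zero: "0 \<in> adjoint_pairs"
  by (simp add: adjoint_pairs_def)

lemma adjoint_pairs_uminus: "p \<in> adjoint_pairs \<Longrightarrow> - p \<in> adjoint_pairs"
  by (simp add: adjoint_pairs_def blinfun.minus_left)

lemma adjoint_pairs_add: "p \<in> adjoint_pairs \<Longrightarrow> q \<in> adjoint_pairs \<Longrightarrow> p + q \<in> adjoint_pairs"
  by (simp add: adjoint_pairs_def blinfun.add_left scale_ell2_simps inner_add_left inner_add_right)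

lemma ring_operator_algebra: "ring (operator_algebra :: 'i operator_pair cstar)"
proof (rule ringI)
  show "abelian_group (operator_algebra :: 'i operator_pair cstar)"
  proof (rule abelian_groupI)
    show "\<exists>y\<in>carrier operator_algebra. y \<oplus>\<^bsub>operator_algebra\<^esub> x = \<zero>\<^bsub>operator_algebra\<^esub>"
      if "x \<in> carrier operator_algebra" for x :: "'i operator_pair"
      using that by (intro bexI[of _ "- x"]) (simp_all add: operator_algebra_def adjoint_pairs_uminus)
  qed (simp_all add: operator_algebra_def adjoint_pairs_add adjoint_pairs_zero algebra_simps)
  show "Group.monoid (operator_algebra :: 'i operator_pair cstar)"
    by (rule monoidI)
      (auto simp: operator_algebra_def adjoint_pairs_def intro!: blinfun_eqI)
qed (auto simp: operator_algebra_def blinfun.add_left blinfun.add_right intro!: blinfun_eqI)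

lemma star_algebra_operator_algebra: "star_algebra (operator_algebra :: 'i operator_pair cstar)"
proof -
  interpret ring "operator_algebra :: 'i operator_pair cstar" by (rule ring_operator_algebra)
  have carrier: "carrier operator_algebra = (adjoint_pairs :: 'i operator_pair set)"
    by (simp add: operator_algebra_def)
  have diff: "x \<ominus>\<^bsub>operator_algebra\<^esub> y = x - y"
    if "x \<in> carrier operator_algebra" "y \<in> carrier operator_algebra" for x y :: "'i operator_pair"
  proof -
    have "(x \<ominus>\<^bsub>operator_algebra\<^esub> y) \<oplus>\<^bsub>operator_algebra\<^esub> y = x"
      using that by (simp add: minus_eq a_assoc l_neg)
    then have "(x \<ominus>\<^bsub>operator_algebra\<^esub> y) + y = x" by (simp add: operator_algebra_def)
    then show ?thesis by (simp add: eq_diff_eq)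
  qed
  have lim: "\<exists>l\<in>carrier operator_algebra. (\<lambda>i. nrm\<^bsub>operator_algebra\<^esub> (s i \<ominus>\<^bsub>operator_algebra\<^esub> l)) \<longlonglongrightarrow> 0"
    if s: "range s \<subseteq> carrier operator_algebra"
      and cauchy: "\<And>e. e > 0 \<Longrightarrow> \<exists>N::nat. \<forall>i\<ge>N. \<forall>j\<ge>N. nrm\<^bsub>operator_algebra\<^esub> (s i \<ominus>\<^bsub>operator_algebra\<^esub> s j) < e"
    for s :: "nat \<Rightarrow> 'i operator_pair"
  proof -
    have sc: "s i \<in> carrier operator_algebra" for i using s by blast
    have c: "\<exists>N. \<forall>i\<ge>N. \<forall>j\<ge>N. norm (fst (s i) - fst (s j)) < e" if "e > 0" for e
      using cauchy[OF that] by (simp only: diff[OF sc sc]) (simp add: operator_algebra_def)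
    have snd: "norm (snd (s i) - snd (s j)) = norm (fst (s i) - fst (s j))" for i j
      using norm_adjoint_pair[of "s i - s j"] minus_closed[OF sc[of i] sc[of j]] diff[OF sc sc]
      by (simp add: carrier)
    have "Cauchy (\<lambda>i. fst (s i))" using c by (intro CauchyI) blast
    then obtain T where T: "(\<lambda>i. fst (s i)) \<longlonglongrightarrow> T" using Cauchy_convergent convergent_def by blast
    have "Cauchy (\<lambda>i. snd (s i))" using c by (intro CauchyI) (simp add: snd)
    then obtain R where R: "(\<lambda>i. snd (s i)) \<longlonglongrightarrow> R" using Cauchy_convergent convergent_def by blast
    have TR: "(T, R) \<in> carrier operator_algebra"
      using adjoint_pairs_closed[OF _ T R] sc by (simp add: carrier)
    have "(\<lambda>i. norm (fst (s i) - T)) \<longlonglongrightarrow> 0" using T by (simp add: LIM_zero tendsto_norm_zero)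
    then have "(\<lambda>i. nrm\<^bsub>operator_algebra\<^esub> (s i \<ominus>\<^bsub>operator_algebra\<^esub> (T, R))) \<longlonglongrightarrow> 0"
      by (simp add: diff[OF sc TR]) (simp add: operator_algebra_def)
    then show ?thesis using TR by blast
  qed
  show ?thesis
  proof (intro star_algebra.intro star_algebra_axioms.intro ring_operator_algebra)
    fix x :: "'i operator_pair" assume x: "x \<in> carrier operator_algebra"
    then have x': "x \<in> adjoint_pairs" by (simp add: carrier)
    note D = adjoint_pairsD[OF x']
    show "c \<odot>\<^bsub>operator_algebra\<^esub> x \<in> carrier operator_algebra" for c
    proof -
      have "scale_ell2 c (fwd x f) \<bullet> g = f \<bullet> scale_ell2 (cnj c) (bwd x g)" for f g
        by (simp add: inner_scale_ell2 D)
      then show ?thesis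
        by (simp add: operator_algebra_def adjoint_pairs_def D scale_ell2_simps mult.commute)
    qed
    show "(c + d) \<odot>\<^bsub>operator_algebra\<^esub> x = c \<odot>\<^bsub>operator_algebra\<^esub> x \<oplus>\<^bsub>operator_algebra\<^esub> d \<odot>\<^bsub>operator_algebra\<^esub> x" for c d
      by (auto simp: operator_algebra_def blinfun.add_left scale_ell2_simps intro!: blinfun_eqI)
    show "c \<odot>\<^bsub>operator_algebra\<^esub> (d \<odot>\<^bsub>operator_algebra\<^esub> x) = (c * d) \<odot>\<^bsub>operator_algebra\<^esub> x" for c d
      by (auto simp: operator_algebra_def scale_ell2_simps intro!: blinfun_eqI)
    show "1 \<odot>\<^bsub>operator_algebra\<^esub> x = x"
      by (auto simp: operator_algebra_def scale_ell2_simps prod_eq_iff intro!: blinfun_eqI)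
    show "adj\<^bsub>operator_algebra\<^esub> x \<in> carrier operator_algebra"
      using adjoint_pairs_swap[OF x'] by (simp add: operator_algebra_def)
    show "adj\<^bsub>operator_algebra\<^esub> (adj\<^bsub>operator_algebra\<^esub> x) = x" by (simp add: operator_algebra_def)
    show "adj\<^bsub>operator_algebra\<^esub> (c \<odot>\<^bsub>operator_algebra\<^esub> x) = cnj c \<odot>\<^bsub>operator_algebra\<^esub> adj\<^bsub>operator_algebra\<^esub> x" for c
      by (simp add: operator_algebra_def)
    show "(nrm\<^bsub>operator_algebra\<^esub> x = 0) = (x = \<zero>\<^bsub>operator_algebra\<^esub>)"
      using norm_adjoint_pair[OF x'] by (auto simp: operator_algebra_def prod_eq_iff)
    show "nrm\<^bsub>operator_algebra\<^esub> (c \<odot>\<^bsub>operator_algebra\<^esub> x) = cmod c * nrm\<^bsub>operator_algebra\<^esub> x" for c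
    proof -
      have le: "norm (scale_op d o\<^sub>L y) \<le> cmod d * norm y" for d and y :: "'i ell2 \<Rightarrow>\<^sub>L 'i ell2"
        by (rule norm_blinfun_bound)
          (auto simp: norm_scale_ell2 mult.assoc intro!: mult_left_mono norm_blinfun)
      have "cmod c * norm (fst x) \<le> norm (scale_op c o\<^sub>L fst x)"
      proof (cases "c = 0")
        case False
        have "scale_op (inverse c) o\<^sub>L (scale_op c o\<^sub>L fst x) = fst x"
          using False by (intro blinfun_eqI) (simp add: scale_ell2_simps)
        then have "norm (fst x) \<le> norm (scale_op c o\<^sub>L fst x) / cmod c"
          using le[of "inverse c" "scale_op c o\<^sub>L fst x"] by (simp add: norm_inverse divide_inverse mult.commute)
        then show ?thesis using False by (simp add: pos_le_divide_eq mult.commute)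
      qed simp
      then show ?thesis using le[of c "fst x"] by (simp add: operator_algebra_def)
    qed
    show "nrm\<^bsub>operator_algebra\<^esub> (adj\<^bsub>operator_algebra\<^esub> x \<otimes>\<^bsub>operator_algebra\<^esub> x) = (nrm\<^bsub>operator_algebra\<^esub> x)\<^sup>2"
      using norm_adjoint_comp[OF x'] by (simp add: operator_algebra_def)
    fix y :: "'i operator_pair" assume y: "y \<in> carrier operator_algebra"
    then have y': "y \<in> adjoint_pairs" by (simp add: carrier)
    show "c \<odot>\<^bsub>operator_algebra\<^esub> (x \<oplus>\<^bsub>operator_algebra\<^esub> y) = c \<odot>\<^bsub>operator_algebra\<^esub> x \<oplus>\<^bsub>operator_algebra\<^esub> c \<odot>\<^bsub>operator_algebra\<^esub> y" for c
      by (auto simp: operator_algebra_def blinfun.add_left scale_ell2_simps intro!: blinfun_eqI)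
    show "(c \<odot>\<^bsub>operator_algebra\<^esub> x) \<otimes>\<^bsub>operator_algebra\<^esub> y = c \<odot>\<^bsub>operator_algebra\<^esub> (x \<otimes>\<^bsub>operator_algebra\<^esub> y)" for c
      by (auto simp: operator_algebra_def adjoint_pairsD[OF y'] intro!: blinfun_eqI)
    show "x \<otimes>\<^bsub>operator_algebra\<^esub> (c \<odot>\<^bsub>operator_algebra\<^esub> y) = c \<odot>\<^bsub>operator_algebra\<^esub> (x \<otimes>\<^bsub>operator_algebra\<^esub> y)" for c
      by (auto simp: operator_algebra_def D intro!: blinfun_eqI)
    show "adj\<^bsub>operator_algebra\<^esub> (x \<oplus>\<^bsub>operator_algebra\<^esub> y) = adj\<^bsub>operator_algebra\<^esub> x \<oplus>\<^bsub>operator_algebra\<^esub> adj\<^bsub>operator_algebra\<^esub> y"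
      by (simp add: operator_algebra_def prod_eq_iff)
    show "adj\<^bsub>operator_algebra\<^esub> (x \<otimes>\<^bsub>operator_algebra\<^esub> y) = adj\<^bsub>operator_algebra\<^esub> y \<otimes>\<^bsub>operator_algebra\<^esub> adj\<^bsub>operator_algebra\<^esub> x"
      by (simp add: operator_algebra_def)
    show "nrm\<^bsub>operator_algebra\<^esub> (x \<oplus>\<^bsub>operator_algebra\<^esub> y) \<le> nrm\<^bsub>operator_algebra\<^esub> x + nrm\<^bsub>operator_algebra\<^esub> y"
      by (simp add: operator_algebra_def norm_triangle_ineq)
    show "nrm\<^bsub>operator_algebra\<^esub> (x \<otimes>\<^bsub>operator_algebra\<^esub> y) \<le> nrm\<^bsub>operator_algebra\<^esub> x * nrm\<^bsub>operator_algebra\<^esub> y"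
      by (simp add: operator_algebra_def norm_blinfun_compose)
  qed (rule lim)
qed

section \<open>Weighted shifts and the regular representation of noncommutative tori\<close>

definition wshift :: "('i \<Rightarrow> complex) \<Rightarrow> ('i \<Rightarrow> 'i) \<Rightarrow> 'i ell2 \<Rightarrow> 'i ell2" where
  "wshift \<phi> \<sigma> f = Abs_ell2 (\<lambda>i. \<phi> i * Rep_ell2 f (\<sigma> i))"

text \<open>For weights of modulus 1 and a bijection \<open>\<sigma>\<close> the adjoint is the
  inverse, that is, the shift along the inverse bijection with conjugate weights.\<close>

definition wshift_pair :: "('i \<Rightarrow> complex) \<Rightarrow> ('i \<Rightarrow> 'i) \<Rightarrow> 'i operator_pair" where
  "wshift_pair \<phi> \<sigma> = (Blinfun (wshift \<phi> \<sigma>), Blinfun (wshift (\<lambda>j. cnj (\<phi> (inv_into UNIV \<sigma> j))) (inv_into UNIV \<sigma>)))"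

context
  fixes \<phi> :: "'i \<Rightarrow> complex" and \<sigma> :: "'i \<Rightarrow> 'i"
  assumes bij: "bij \<sigma>" and phase: "\<And>i. cmod (\<phi> i) = 1"
begin

lemma wshift_rep: "Rep_ell2 (wshift \<phi> \<sigma> f) i = \<phi> i * Rep_ell2 f (\<sigma> i)"
proof -
  have "(\<lambda>i. (cmod (Rep_ell2 f (\<sigma> i)))\<^sup>2) summable_on UNIV"
    using summable_on_reindex_bij_betw[OF bij, of "\<lambda>i. (cmod (Rep_ell2 f i))\<^sup>2"] ell2_summable[of f] by simp
  then show ?thesis unfolding wshift_def by (subst Abs_ell2_inverse) (simp_all add: norm_mult phase)
qed

lemma norm_wshift: "norm (wshift \<phi> \<sigma> f) = norm f"
proof -
  have "(norm (wshift \<phi> \<sigma> f))\<^sup>2 = (\<Sum>\<^sub>\<infinity>i. (cmod (Rep_ell2 f (\<sigma> i)))\<^sup>2)"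
    by (simp add: norm_ell2_square wshift_rep norm_mult phase)
  also have "\<dots> = (norm f)\<^sup>2"
    using infsum_reindex_bij_betw[OF bij, of "\<lambda>i. (cmod (Rep_ell2 f i))\<^sup>2"] by (simp add: norm_ell2_square)
  finally show ?thesis by (rule power2_eq_imp_eq) simp_all
qed

lemma bounded_linear_wshift: "bounded_linear (wshift \<phi> \<sigma>)"
proof (rule bounded_linear_intro)
  show "norm (wshift \<phi> \<sigma> f) \<le> norm f * 1" for f by (simp add: norm_wshift)
qed (rule ell2_eqI; simp add: wshift_rep plus_ell2.rep_eq scaleR_ell2.rep_eq algebra_simps)+

end

context
  fixes \<phi> :: "'i \<Rightarrow> complex" and \<sigma> :: "'i \<Rightarrow> 'i"
  assumes bij: "bij \<sigma>" and phase: "\<And>i. cmod (\<phi> i) = 1"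
begin

private lemma inv_data: "bij (inv_into UNIV \<sigma>)" "cmod (cnj (\<phi> (inv_into UNIV \<sigma> j))) = 1"
  using bij by (simp_all add: bij_imp_bij_inv phase)

private lemma mult_cnj_phase: "\<phi> i * cnj (\<phi> i) = 1"
  using complex_norm_square[of "\<phi> i"] by (simp add: phase)

lemma wshift_pair_apply:
  "Rep_ell2 (fwd (wshift_pair \<phi> \<sigma>) f) i = \<phi> i * Rep_ell2 f (\<sigma> i)"
  "Rep_ell2 (bwd (wshift_pair \<phi> \<sigma>) f) i = cnj (\<phi> (inv_into UNIV \<sigma> i)) * Rep_ell2 f (inv_into UNIV \<sigma> i)"
  using wshift_rep[OF bij phase, where f = f and i = i] wshift_rep[OF inv_data, where f = f and i = i]
  by (simp_all add: wshift_pair_def bounded_linear_Blinfun_apply bounded_linear_wshift[OF bij phase]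
      bounded_linear_wshift[OF inv_data])

lemma wshift_pair_closed: "wshift_pair \<phi> \<sigma> \<in> adjoint_pairs"
proof -
  have "fwd (wshift_pair \<phi> \<sigma>) f \<bullet> g = f \<bullet> bwd (wshift_pair \<phi> \<sigma>) g" for f g
  proof -
    have "f \<bullet> bwd (wshift_pair \<phi> \<sigma>) g = (\<Sum>\<^sub>\<infinity>i. Rep_ell2 f (\<sigma> i) \<bullet> (cnj (\<phi> i) * Rep_ell2 g i))"
      using infsum_reindex_bij_betw[OF bij, of "\<lambda>i. Rep_ell2 f i \<bullet> (cnj (\<phi> (inv_into UNIV \<sigma> i)) * Rep_ell2 g (inv_into UNIV \<sigma> i))"]
        bij by (simp add: inner_ell2_def wshift_pair_apply bij_is_inj)
    also have "\<dots> = fwd (wshift_pair \<phi> \<sigma>) f \<bullet> g"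
      unfolding inner_ell2_def
      by (rule infsum_cong) (simp add: wshift_pair_apply inner_complex_def algebra_simps)
    finally show ?thesis by simp
  qed
  then show ?thesis unfolding adjoint_pairs_def
    by (auto simp: wshift_pair_apply scale_ell2.rep_eq mult_ac intro!: ell2_eqI)
qed

lemma wshift_pair_unitary: "unitary_in operator_algebra (wshift_pair \<phi> \<sigma>)"
proof -
  have "bwd (wshift_pair \<phi> \<sigma>) (fwd (wshift_pair \<phi> \<sigma>) f) = f"
    "fwd (wshift_pair \<phi> \<sigma>) (bwd (wshift_pair \<phi> \<sigma>) f) = f" for f
    using bij mult_cnj_phase
    by (auto intro!: ell2_eqI simp: wshift_pair_apply bij_is_surj surj_f_inv_f bij_is_inj mult_ac
        simp flip: mult.assoc)
  then show ?thesis
    unfolding unitary_in_def using wshift_pair_closed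
    by (auto simp: operator_algebra_def intro!: blinfun_eqI)
qed

lemma wshift_pair_delta: "fwd (wshift_pair \<phi> \<sigma>) (delta (\<sigma> b)) = scale_ell2 (\<phi> b) (delta b)"
  using bij by (intro ell2_eqI) (simp add: wshift_pair_apply delta.rep_eq scale_ell2.rep_eq bij_is_inj inj_eq)

end

text \<open>Basis vector \<open>k\<close> stands for the ordered monomial with exponents
  \<open>k\<close>. Multiplying it by the generator \<open>j\<close> from the left means moving that
  generator to its place past the generators \<open>i < j\<close>, and each passage costs the
  inverse of \<open>\<theta> (i, j)\<close>. Coordinate \<open>j\<close> itself does not enter, so
  the phase is the same before and after the shift.\<close>

definition torus_phase :: "(nat \<times> nat \<Rightarrow> complex) \<Rightarrow> nat \<Rightarrow> (nat \<Rightarrow> int) \<Rightarrow> complex" where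
  "torus_phase \<theta> j k = (\<Prod>i\<in>{1..<j}. \<theta> (i, j) powi (- k i))"

definition regular_unitary :: "(nat \<times> nat \<Rightarrow> complex) \<Rightarrow> nat \<Rightarrow> (nat \<Rightarrow> int) operator_pair" where
  "regular_unitary \<theta> j = wshift_pair (torus_phase \<theta> j) (\<lambda>k. k(j := k j - 1))"

lemma bij_coordinate_shift: "bij (\<lambda>k :: nat \<Rightarrow> int. k(j := k j - 1))"
  by (rule o_bij[where g = "\<lambda>k. k(j := k j + 1)"]) (auto simp: fun_eq_iff)

lemma (in star_algebra) gen_word_unitary:
  assumes "\<And>i. i \<in> {1..n} \<Longrightarrow> unitary_in A (W i)" "m \<le> n"
  shows "unitary_in A (gen_word (unitary_group A) W k m)"
  using assms(2)
proof (induction m)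
  case (Suc m)
  interpret G: group "unitary_group A" by (rule group_unitary_group)
  have "W (Suc m) [^]\<^bsub>unitary_group A\<^esub> k (Suc m) \<in> carrier (unitary_group A)"
    using assms(1)[of "Suc m"] Suc.prems by (intro G.int_pow_closed) simp
  then show ?case using Suc by (simp add: unitary_mult)
qed (simp add: unitary_one)

lemma (in star_morphism) hom_unitary_group: "h \<in> hom (unitary_group A) (unitary_group B)"
  by (rule homI) (auto simp: hom_unitary hom_mult A.unitary_closed)

lemma (in star_morphism) hom_unitary_pow:
  assumes "unitary_in A u"
  shows "h (u [^]\<^bsub>unitary_group A\<^esub> (i::int)) = h u [^]\<^bsub>unitary_group B\<^esub> i"
  using hom_int_pow[OF hom_unitary_group _ A.group_unitary_group B.group_unitary_group] assms by simp

lemma (in star_morphism) hom_gen_word: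
  assumes "\<And>i. i \<in> {1..n} \<Longrightarrow> unitary_in A (W i)" "\<And>i. i \<in> {1..n} \<Longrightarrow> h (W i) = W' i" "m \<le> n"
  shows "h (gen_word (unitary_group A) W k m) = gen_word (unitary_group B) W' k m"
  using assms(3)
proof (induction m)
  case (Suc m)
  interpret G: group "unitary_group A" by (rule A.group_unitary_group)
  have m: "Suc m \<in> {1..n}" using Suc.prems by simp
  have "unitary_in A (W (Suc m) [^]\<^bsub>unitary_group A\<^esub> k (Suc m))"
    using G.int_pow_closed[of "W (Suc m)" "k (Suc m)"] assms(1)[OF m] by simp
  moreover have "unitary_in A (gen_word (unitary_group A) W k m)"
    using A.gen_word_unitary[of n W m k] assms(1) Suc.prems by simp
  ultimately show ?case
    using Suc assms(2)[OF m] hom_unitary_pow[OF assms(1)[OF m], of "k (Suc m)"]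
    by (simp add: hom_mult A.unitary_closed)
qed simp

text \<open>The phase is hidden and only its modulus recorded: the coefficient functional needs the
  destination of a basis vector and the fact that its length survives.\<close>

definition moves :: "(nat \<Rightarrow> int) operator_pair \<Rightarrow> (nat \<Rightarrow> int) \<Rightarrow> (nat \<Rightarrow> int) \<Rightarrow> bool" where
  "moves p b b' \<longleftrightarrow> (\<exists>c. cmod c = 1 \<and> fwd p (delta b) = scale_ell2 c (delta b'))"

context
  fixes n :: nat and \<theta> :: "nat \<times> nat \<Rightarrow> complex"
  assumes \<theta>: "\<And>p. p \<in> pairs n \<Longrightarrow> cmod (\<theta> p) = 1"
begin

lemma torus_phase_norm:
  assumes "j \<in> {1..n}"
  shows "cmod (torus_phase \<theta> j k) = 1"
proof -
  have "cmod (\<theta> (i, j) powi (- k i)) = 1" if "i \<in> {1..<j}" for i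
  proof -
    have "(i, j) \<in> pairs n" using that assms by (auto simp: pairs_def)
    then show ?thesis by (simp add: norm_power_int \<theta>)
  qed
  then show ?thesis unfolding torus_phase_def prod_norm[symmetric] by simp
qed

lemma torus_phase_shift_le:
  assumes "j \<le> m"
  shows "torus_phase \<theta> j (k(m := a)) = torus_phase \<theta> j k"
  unfolding torus_phase_def using assms by (intro prod.cong) auto

text \<open>For \<open>j < m\<close> the phase of \<open>m\<close> sees a step in coordinate
  \<open>j\<close>, while the phase of \<open>j\<close> does not see coordinate \<open>m\<close>.
  This asymmetry leaves exactly one factor \<open>\<theta> (j, m)\<close> in the commutation
  relation.\<close>

lemma torus_phase_shift:
  assumes "(j, m) \<in> pairs n"
  shows "torus_phase \<theta> m (k(j := k j - 1)) = torus_phase \<theta> m k * \<theta> (j, m)"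
proof -
  have nz: "\<theta> (j, m) \<noteq> 0" using \<theta>[OF assms] by auto
  have j: "j \<in> {1..<m}" using assms by (auto simp: pairs_def)
  have "torus_phase \<theta> m (k(j := k j - 1)) =
      (\<Prod>i\<in>{1..<m}. \<theta> (i, m) powi (- k i) * (if i = j then \<theta> (j, m) else 1))"
    unfolding torus_phase_def
  proof (rule prod.cong)
    fix i
    have "\<theta> (j, m) powi (1 - k j) = \<theta> (j, m) powi (- k j) * \<theta> (j, m)"
      using power_int_add[of "\<theta> (j, m)" "- k j" 1] nz by (simp add: algebra_simps)
    then show "\<theta> (i, m) powi - (k(j := k j - 1)) i =
        \<theta> (i, m) powi - k i * (if i = j then \<theta> (j, m) else 1)" by simp
  qed simp
  also have "\<dots> = torus_phase \<theta> m k * \<theta> (j, m)"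
    using j by (simp add: torus_phase_def prod.distrib prod.delta)
  finally show ?thesis .
qed

lemma regular_apply:
  "j \<in> {1..n} \<Longrightarrow> Rep_ell2 (fwd (regular_unitary \<theta> j) f) k = torus_phase \<theta> j k * Rep_ell2 f (k(j := k j - 1))"
  unfolding regular_unitary_def by (rule wshift_pair_apply[OF bij_coordinate_shift torus_phase_norm])

lemma regular_unitary: "j \<in> {1..n} \<Longrightarrow> unitary_in operator_algebra (regular_unitary \<theta> j)"
  unfolding regular_unitary_def by (rule wshift_pair_unitary[OF bij_coordinate_shift torus_phase_norm])

lemma torus_relations_regular: "torus_relations n \<theta> operator_algebra (regular_unitary \<theta>)"
proof -
  interpret star_algebra "operator_algebra :: (nat \<Rightarrow> int) operator_pair cstar"
    by (rule star_algebra_operator_algebra)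
  let ?W = "regular_unitary \<theta>"
  have carrier: "carrier operator_algebra = (adjoint_pairs :: (nat \<Rightarrow> int) operator_pair set)"
    by (simp add: operator_algebra_def)
  have "?W j \<otimes>\<^bsub>operator_algebra\<^esub> ?W m =
      \<theta> (j, m) \<odot>\<^bsub>operator_algebra\<^esub> (?W m \<otimes>\<^bsub>operator_algebra\<^esub> ?W j)"
    if jm: "(j, m) \<in> pairs n" for j m
  proof (rule adjoint_pairs_eqI)
    have c: "j \<in> {1..n}" "m \<in> {1..n}" "j < m" using jm by (auto simp: pairs_def)
    note u = unitary_closed[OF regular_unitary[OF c(1)]] unitary_closed[OF regular_unitary[OF c(2)]]
    show "?W j \<otimes>\<^bsub>operator_algebra\<^esub> ?W m \<in> adjoint_pairs"
      "\<theta> (j, m) \<odot>\<^bsub>operator_algebra\<^esub> (?W m \<otimes>\<^bsub>operator_algebra\<^esub> ?W j) \<in> adjoint_pairs"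
      using u unfolding carrier[symmetric] by auto
    show "fwd (?W j \<otimes>\<^bsub>operator_algebra\<^esub> ?W m) f =
        fwd (\<theta> (j, m) \<odot>\<^bsub>operator_algebra\<^esub> (?W m \<otimes>\<^bsub>operator_algebra\<^esub> ?W j)) f" for f
    proof (rule ell2_eqI)
      fix k :: "nat \<Rightarrow> int"
      have swap: "k(j := k j - 1, m := k m - 1) = k(m := k m - 1, j := k j - 1)"
        using c by (simp add: fun_upd_twist)
      have "Rep_ell2 (fwd (?W j \<otimes>\<^bsub>operator_algebra\<^esub> ?W m) f) k =
          torus_phase \<theta> j k * (torus_phase \<theta> m k * \<theta> (j, m)) * Rep_ell2 f (k(j := k j - 1, m := k m - 1))"
        using c by (simp add: operator_algebra_def regular_apply torus_phase_shift[OF jm])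
      moreover have "Rep_ell2 (fwd (\<theta> (j, m) \<odot>\<^bsub>operator_algebra\<^esub> (?W m \<otimes>\<^bsub>operator_algebra\<^esub> ?W j)) f) k =
          \<theta> (j, m) * (torus_phase \<theta> m k * (torus_phase \<theta> j k * Rep_ell2 f (k(m := k m - 1, j := k j - 1))))"
        using c by (simp add: operator_algebra_def regular_apply torus_phase_shift_le scale_ell2.rep_eq)
      ultimately show "Rep_ell2 (fwd (?W j \<otimes>\<^bsub>operator_algebra\<^esub> ?W m) f) k =
        Rep_ell2 (fwd (\<theta> (j, m) \<odot>\<^bsub>operator_algebra\<^esub> (?W m \<otimes>\<^bsub>operator_algebra\<^esub> ?W j)) f) k"
        by (simp add: swap)
    qed
  qed
  then show ?thesis unfolding torus_relations_iff using regular_unitary by auto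
qed

lemma moves_mult:
  assumes "p \<in> adjoint_pairs" "moves q b b'" "moves p b' b''"
  shows "moves (p \<otimes>\<^bsub>operator_algebra\<^esub> q) b b''"
proof -
  obtain c d where c: "cmod c = 1" "fwd q (delta b) = scale_ell2 c (delta b')"
    and d: "cmod d = 1" "fwd p (delta b') = scale_ell2 d (delta b'')"
    using assms unfolding moves_def by blast
  have "fwd (p \<otimes>\<^bsub>operator_algebra\<^esub> q) (delta b) = scale_ell2 (c * d) (delta b'')"
    using c d by (simp add: operator_algebra_def adjoint_pairsD(1)[OF assms(1)] scale_ell2_simps)
  then show ?thesis unfolding moves_def using c(1) d(1) by (intro exI[of _ "c * d"]) (simp add: norm_mult)
qed

lemma moves_regular:
  assumes "j \<in> {1..n}"
  shows "moves (regular_unitary \<theta> j) b (b(j := b j + 1))"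
proof -
  have "fwd (regular_unitary \<theta> j) (delta ((\<lambda>k. k(j := k j - 1)) (b(j := b j + 1)))) =
      scale_ell2 (torus_phase \<theta> j (b(j := b j + 1))) (delta (b(j := b j + 1)))"
    unfolding regular_unitary_def
    by (rule wshift_pair_delta[OF bij_coordinate_shift torus_phase_norm[OF assms]])
  then show ?thesis unfolding moves_def using torus_phase_norm[OF assms] by auto
qed

lemma moves_adj:
  assumes u: "unitary_in operator_algebra p" and m: "moves p b b'"
  shows "moves (prod.swap p) b' b"
proof -
  obtain c where c: "cmod c = 1" "fwd p (delta b) = scale_ell2 c (delta b')"
    using m unfolding moves_def by blast
  have p: "p \<in> adjoint_pairs" and uu: "snd p o\<^sub>L fst p = id_blinfun"
    using u by (auto simp: unitary_in_def operator_algebra_def)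
  have "bwd p (fwd p (delta b)) = delta b"
    using uu by (metis blinfun_apply_blinfun_compose blinfun_apply_id_blinfun)
  then have "scale_ell2 (cnj c) (scale_ell2 c (bwd p (delta b'))) = scale_ell2 (cnj c) (delta b)"
    by (simp add: c adjoint_pairsD(2)[OF p])
  moreover have "cnj c * c = 1" using complex_norm_square[of c] c by (simp add: mult.commute)
  ultimately have "bwd p (delta b') = scale_ell2 (cnj c) (delta b)" by (simp add: scale_ell2_simps)
  then show ?thesis unfolding moves_def using c(1) by (intro exI[of _ "cnj c"]) simp
qed

lemma moves_regular_pow:
  assumes j: "j \<in> {1..n}"
  shows "moves (regular_unitary \<theta> j [^]\<^bsub>unitary_group operator_algebra\<^esub> (a::int)) b (b(j := b j + a))"
proof -
  interpret star_algebra "operator_algebra :: (nat \<Rightarrow> int) operator_pair cstar"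
    by (rule star_algebra_operator_algebra)
  interpret G: group "unitary_group (operator_algebra :: (nat \<Rightarrow> int) operator_pair cstar)"
    by (rule group_unitary_group)
  let ?u = "regular_unitary \<theta> j"
  have u: "?u \<in> carrier (unitary_group operator_algebra)" using regular_unitary[OF j] by simp
  have nat: "moves (?u [^]\<^bsub>unitary_group operator_algebra\<^esub> (i::nat)) b (b(j := b j + int i))" for i b
  proof (induction i arbitrary: b)
    case 0
    have "fwd \<one>\<^bsub>operator_algebra\<^esub> (delta b) = scale_ell2 1 (delta b)"
      by (simp add: operator_algebra_def scale_ell2_simps)
    then show ?case unfolding moves_def by (simp add: exI[of _ "1::complex"])
  next
    case (Suc i)
    have "?u [^]\<^bsub>unitary_group operator_algebra\<^esub> i \<in> carrier (unitary_group operator_algebra)"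
      using G.nat_pow_closed[OF u] .
    then have c: "?u [^]\<^bsub>unitary_group operator_algebra\<^esub> i \<in> adjoint_pairs"
      by (simp add: unitary_in_def) (simp add: operator_algebra_def)
    have "moves (?u [^]\<^bsub>unitary_group operator_algebra\<^esub> Suc i) b
        (b(j := b j + 1, j := (b(j := b j + 1)) j + int i))"
      unfolding G.nat_pow_Suc unitary_group_simps by (rule moves_mult[OF c moves_regular[OF j] Suc])
    moreover have "b(j := b j + 1, j := (b(j := b j + 1)) j + int i) = b(j := b j + int (Suc i))"
      by (simp add: algebra_simps)
    ultimately show ?case by (simp only:)
  qed
  show ?thesis
  proof (cases "a \<ge> 0")
    case True
    then obtain i where "a = int i" using nonneg_int_cases by blast
    then show ?thesis using nat[of i b] by (simp add: int_pow_int)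
  next
    case False
    then have "a = - int (nat (- a))" by simp
    then obtain i where i: "a = - int i" by blast
    have c: "?u [^]\<^bsub>unitary_group operator_algebra\<^esub> i \<in> carrier (unitary_group operator_algebra)"
      using G.nat_pow_closed[OF u] .
    have "?u [^]\<^bsub>unitary_group operator_algebra\<^esub> a = prod.swap (?u [^]\<^bsub>unitary_group operator_algebra\<^esub> i)"
      using c inv_unitary_group[of "?u [^]\<^bsub>unitary_group operator_algebra\<^esub> i"] G.int_pow_neg_int[OF u, of i]
      by (simp add: i) (simp add: operator_algebra_def)
    moreover have "moves (?u [^]\<^bsub>unitary_group operator_algebra\<^esub> i) (b(j := b j + a)) b"
      using nat[of i "b(j := b j + a)"] by (simp add: i)
    ultimately show ?thesis using moves_adj c by simp
  qed
qed

lemma moves_gen_word: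
  "m \<le> n \<Longrightarrow> moves (gen_word (unitary_group operator_algebra) (regular_unitary \<theta>) k m) b
     (\<lambda>i. if i \<in> {1..m} then b i + k i else b i)"
proof (induction m arbitrary: b)
  case 0
  have "fwd \<one>\<^bsub>operator_algebra\<^esub> (delta b) = scale_ell2 1 (delta b)"
    by (simp add: operator_algebra_def scale_ell2_simps)
  then show ?case unfolding moves_def by (simp add: exI[of _ "1::complex"])
next
  case (Suc m)
  interpret star_algebra "operator_algebra :: (nat \<Rightarrow> int) operator_pair cstar"
    by (rule star_algebra_operator_algebra)
  let ?b = "b(Suc m := b (Suc m) + k (Suc m))"
  have "unitary_in operator_algebra (gen_word (unitary_group operator_algebra) (regular_unitary \<theta>) k m)"
    using gen_word_unitary[of n "regular_unitary \<theta>" m k] regular_unitary Suc.prems by simp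
  then have c: "gen_word (unitary_group operator_algebra) (regular_unitary \<theta>) k m \<in> adjoint_pairs"
    by (simp add: unitary_in_def) (simp add: operator_algebra_def)
  have "moves (regular_unitary \<theta> (Suc m) [^]\<^bsub>unitary_group operator_algebra\<^esub> k (Suc m)) b ?b"
    using Suc.prems by (intro moves_regular_pow) simp
  moreover have "moves (gen_word (unitary_group operator_algebra) (regular_unitary \<theta>) k m) ?b
      (\<lambda>i. if i \<in> {1..m} then ?b i + k i else ?b i)"
    using Suc by simp
  moreover have "(\<lambda>i. if i \<in> {1..m} then ?b i + k i else ?b i) = (\<lambda>i. if i \<in> {1..Suc m} then b i + k i else b i)"
    by (auto simp: fun_eq_iff)
  ultimately show ?case using moves_mult[OF c] by simp
qed

text \<open>
  The functional reads off a coordinate of the image of \<open>delta 0\<close> in the regular representation.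
\<close>

lemma nc_torus_coefficient:
  fixes A :: "'b cstar" and k :: "nat \<Rightarrow> int"
  assumes A: "is_nc_torus n \<theta> A W" and k: "\<And>i. i \<notin> {1..n} \<Longrightarrow> k i = 0"
  shows "\<exists>F :: 'b \<Rightarrow> complex.
    (\<forall>x\<in>carrier A. \<forall>y\<in>carrier A. F (x \<oplus>\<^bsub>A\<^esub> y) = F x + F y) \<and>
    (\<forall>c. \<forall>x\<in>carrier A. F (c \<odot>\<^bsub>A\<^esub> x) = c * F x) \<and>
    (\<forall>x\<in>carrier A. cmod (F x) \<le> nrm\<^bsub>A\<^esub> x) \<and>
    cmod (F (gen_word (unitary_group A) W k n)) = 1 \<and>
    (\<forall>k'. (\<forall>i. i \<notin> {1..n} \<longrightarrow> k' i = 0) \<and> k' \<noteq> k \<longrightarrow> F (gen_word (unitary_group A) W k' n) = 0)"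
proof -
  obtain h where h: "star_morphism A (operator_algebra :: (nat \<Rightarrow> int) operator_pair cstar) h"
    "\<And>i. i \<in> {1..n} \<Longrightarrow> h (W i) = regular_unitary \<theta> i"
    using nc_torus_universal[OF A star_algebra_operator_algebra torus_relations_regular] by blast
  interpret h: star_morphism A operator_algebra h by (rule h(1))
  have W: "\<And>i. i \<in> {1..n} \<Longrightarrow> unitary_in A (W i)"
    using A unfolding is_nc_torus_def torus_relations_def by blast
  define F where "F x = Rep_ell2 (fwd (h x) (delta (\<lambda>_. 0))) k" for x
  have word: "\<exists>c. cmod c = 1 \<and> F (gen_word (unitary_group A) W k' n) = c * (if k' = k then 1 else 0)"
    if k': "\<And>i. i \<notin> {1..n} \<Longrightarrow> k' i = 0" for k'
  proof -
    \<comment> \<open>Exponents vanish off \<open>{1..n}\<close>, so the word carries the basis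
      vector at the origin to the one at \<open>k'\<close> itself, and distinct exponents reach
      distinct basis vectors.\<close>
    have "(\<lambda>i. if i \<in> {1..n} then 0 + k' i else 0) = k'" using k' by (auto simp: fun_eq_iff)
    then have "moves (gen_word (unitary_group operator_algebra) (regular_unitary \<theta>) k' n) (\<lambda>_. 0) k'"
      using moves_gen_word[of n k' "\<lambda>_. 0"] by simp
    then obtain c where c: "cmod c = 1"
      "fwd (gen_word (unitary_group operator_algebra) (regular_unitary \<theta>) k' n) (delta (\<lambda>_. 0)) =
        scale_ell2 c (delta k')" unfolding moves_def by blast
    have "h (gen_word (unitary_group A) W k' n) =
        gen_word (unitary_group operator_algebra) (regular_unitary \<theta>) k' n"
      by (rule h.hom_gen_word[OF W h(2) order_refl])
    then have "F (gen_word (unitary_group A) W k' n) = c * (if k' = k then 1 else 0)"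
      using c(2) by (auto simp: F_def scale_ell2.rep_eq delta.rep_eq)
    then show ?thesis using c(1) by blast
  qed
  show ?thesis
  proof (intro exI[of _ F] conjI ballI allI impI; (elim conjE)?)
    show "F (x \<oplus>\<^bsub>A\<^esub> y) = F x + F y" if "x \<in> carrier A" "y \<in> carrier A" for x y
      unfolding F_def h.hom_add[OF that] by (simp add: operator_algebra_def blinfun.add_left plus_ell2.rep_eq)
    show "F (c \<odot>\<^bsub>A\<^esub> x) = c * F x" if "x \<in> carrier A" for c x
      unfolding F_def h.hom_smult[OF that] by (simp add: operator_algebra_def scale_ell2.rep_eq)
    show "cmod (F x) \<le> nrm\<^bsub>A\<^esub> x" if "x \<in> carrier A" for x
    proof -
      let ?d = "delta (\<lambda>_. 0) :: (nat \<Rightarrow> int) ell2"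
      have "cmod (F x) \<le> norm (fwd (h x) ?d)" unfolding F_def by (rule norm_coord_ell2)
      also have "\<dots> \<le> norm (fst (h x)) * norm ?d" by (rule norm_blinfun)
      also have "\<dots> = nrm\<^bsub>operator_algebra\<^esub> (h x)" by (simp add: norm_delta operator_algebra_def)
      also have "\<dots> \<le> nrm\<^bsub>A\<^esub> x" by (rule h.hom_nrm_le[OF that])
      finally show ?thesis .
    qed
    obtain c where "cmod c = 1" "F (gen_word (unitary_group A) W k n) = c * (if k = k then 1 else 0)"
      using word[of k] k by blast
    then show "cmod (F (gen_word (unitary_group A) W k n)) = 1" by simp
    show "F (gen_word (unitary_group A) W k' n) = 0" if "\<forall>i. i \<notin> {1..n} \<longrightarrow> k' i = 0" "k' \<noteq> k" for k'
      using word[of k'] that by auto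
  qed
qed

end

section \<open>Linear combinations\<close>

definition lin_comb :: "'a cstar \<Rightarrow> ('g \<Rightarrow> 'a) \<Rightarrow> 'g set \<Rightarrow> ('g \<Rightarrow> complex) \<Rightarrow> 'a" where
  "lin_comb A m S c = finsum A (\<lambda>g. c g \<odot>\<^bsub>A\<^esub> m g) S"

context star_algebra
begin

context
  fixes m :: "'g \<Rightarrow> 'a"
  assumes m: "\<And>g. m g \<in> carrier A"
begin

lemma lin_comb_closed: "lin_comb A m S c \<in> carrier A"
  unfolding lin_comb_def by (rule finsum_closed) (simp add: m)

lemma lin_comb_empty: "lin_comb A m {} c = \<zero>"
  by (simp add: lin_comb_def)

lemma lin_comb_insert:
  "\<lbrakk>finite S; g \<notin> S\<rbrakk> \<Longrightarrow> lin_comb A m (insert g S) c = c g \<odot> m g \<oplus> lin_comb A m S c"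
  unfolding lin_comb_def by (rule finsum_insert) (simp_all add: m)

lemma lin_comb_cong: "(\<And>g. g \<in> S \<Longrightarrow> c g = d g) \<Longrightarrow> lin_comb A m S c = lin_comb A m S d"
  unfolding lin_comb_def by (rule finsum_cong') (simp_all add: m)

lemma lin_comb_add: "lin_comb A m S c \<oplus> lin_comb A m S d = lin_comb A m S (\<lambda>g. c g + d g)"
  unfolding lin_comb_def by (simp add: m smult_add_left finsum_addf)

lemma lin_comb_zero: "finite S \<Longrightarrow> lin_comb A m S (\<lambda>_. 0) = \<zero>"
  by (induction S rule: finite_induct) (simp_all add: lin_comb_empty lin_comb_insert m)

lemma lin_comb_single:
  assumes "finite S" "g \<in> S"
  shows "lin_comb A m S (\<lambda>h. if h = g then a else 0) = a \<odot> m g"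
proof -
  have "lin_comb A m (S - {g}) (\<lambda>h. if h = g then a else 0) = lin_comb A m (S - {g}) (\<lambda>_. 0)"
    by (rule lin_comb_cong) auto
  then show ?thesis
    using lin_comb_insert[of "S - {g}" g "\<lambda>h. if h = g then a else 0"] assms
    by (simp add: insert_absorb lin_comb_zero m)
qed

lemma lin_comb_induct [consumes 1, case_names zero add]:
  assumes "finite S" "P \<zero>"
    and "\<And>x g a. \<lbrakk>g \<in> S; x \<in> carrier A; P x\<rbrakk> \<Longrightarrow> P (a \<odot> m g \<oplus> x)"
  shows "P (lin_comb A m S c)"
proof -
  have "P (lin_comb A m R c)" if "finite R" "R \<subseteq> S" for R
    using that
    by (induction R rule: finite_induct) (simp_all add: lin_comb_empty lin_comb_insert assms lin_comb_closed)
  then show ?thesis using assms(1) by blast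
qed

lemma nrm_lin_comb_le:
  assumes "finite S" "\<And>g. g \<in> S \<Longrightarrow> nrm (m g) \<le> 1"
  shows "nrm (lin_comb A m S c) \<le> (\<Sum>g\<in>S. cmod (c g))"
  using assms
proof (induction S rule: finite_induct)
  case (insert g S)
  have "nrm (lin_comb A m (insert g S) c) \<le> nrm (c g \<odot> m g) + nrm (lin_comb A m S c)"
    using insert by (simp add: lin_comb_insert nrm_triangle m lin_comb_closed)
  also have "nrm (c g \<odot> m g) \<le> cmod (c g)"
    using mult_left_mono[of "nrm (m g)" 1 "cmod (c g)"] insert by (simp add: nrm_smult m)
  also have "nrm (lin_comb A m S c) \<le> (\<Sum>g\<in>S. cmod (c g))" using insert by simp
  finally show ?case using insert by simp
qed (simp add: lin_comb_empty)

definition span_of :: "'g set \<Rightarrow> 'a set" where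
  "span_of S = range (lin_comb A m S)"

lemma span_of_closed: "span_of S \<subseteq> carrier A"
  by (auto simp: span_of_def lin_comb_closed)

lemma span_of_add: "\<lbrakk>x \<in> span_of S; y \<in> span_of S\<rbrakk> \<Longrightarrow> x \<oplus> y \<in> span_of S"
  by (auto simp: span_of_def lin_comb_add)

lemma span_of_zero: "finite S \<Longrightarrow> \<zero> \<in> span_of S"
  unfolding span_of_def by (metis lin_comb_zero rangeI)

lemma span_of_single: "\<lbrakk>finite S; g \<in> S\<rbrakk> \<Longrightarrow> a \<odot> m g \<in> span_of S"
  unfolding span_of_def by (metis lin_comb_single rangeI)

lemma span_of_induct [consumes 2, case_names zero add]:
  assumes "x \<in> span_of S" "finite S" "P \<zero>"
    and "\<And>x g a. \<lbrakk>g \<in> S; x \<in> carrier A; P x\<rbrakk> \<Longrightarrow> P (a \<odot> m g \<oplus> x)"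
  shows "P x"
  using assms lin_comb_induct[of S P] unfolding span_of_def by blast

lemma span_of_mono:
  assumes "x \<in> span_of S" "S \<subseteq> R" "finite R"
  shows "x \<in> span_of R"
  using assms(1) finite_subset[OF assms(2,3)]
proof (induction x rule: span_of_induct)
  case (add x g a)
  then show ?case using assms by (intro span_of_add span_of_single) auto
qed (use assms in \<open>simp add: span_of_zero\<close>)

lemma span_of_smult:
  assumes "x \<in> span_of S" "finite S"
  shows "c \<odot> x \<in> span_of S"
  using assms
proof (induction x rule: span_of_induct)
  case (add x g a)
  have "c \<odot> (a \<odot> m g \<oplus> x) = (c * a) \<odot> m g \<oplus> c \<odot> x"
    using add by (simp add: smult_add_right smult_smult m)
  then show ?case using add assms by (simp add: span_of_add span_of_single)
qed (use assms in \<open>simp add: span_of_zero\<close>)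

lemma span_of_mult:
  assumes x: "x \<in> span_of S" and y: "y \<in> span_of T" and fin: "finite S" "finite T" "finite R"
    and mult: "\<And>g h. \<lbrakk>g \<in> S; h \<in> T\<rbrakk> \<Longrightarrow> \<exists>k\<in>R. m g \<otimes> m h = m k"
  shows "x \<otimes> y \<in> span_of R"
  using x fin(1)
proof (induction x rule: span_of_induct)
  case zero
  show ?case using y span_of_closed[of T] fin by (auto simp: span_of_zero)
next
  case (add x g a)
  have "m g \<otimes> y \<in> span_of R"
    using y fin(2)
  proof (induction y rule: span_of_induct)
    case zero
    show ?case using fin by (simp add: span_of_zero m)
  next
    case (add y h b)
    obtain k where k: "k \<in> R" "m g \<otimes> m h = m k" using mult[OF \<open>g \<in> S\<close> \<open>h \<in> T\<close>] by blast
    have "m g \<otimes> (b \<odot> m h \<oplus> y) = b \<odot> m k \<oplus> m g \<otimes> y"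
      using add by (simp add: r_distr smult_mult_right m k)
    then show ?case using add k fin by (simp add: span_of_add span_of_single)
  qed
  then have "a \<odot> (m g \<otimes> y) \<in> span_of R" using fin by (intro span_of_smult)
  moreover have "(a \<odot> m g \<oplus> x) \<otimes> y = a \<odot> (m g \<otimes> y) \<oplus> x \<otimes> y"
    using add y span_of_closed[of T] by (auto simp: l_distr smult_mult_left m)
  ultimately show ?case using add by (simp add: span_of_add)
qed

lemma span_of_adj:
  assumes x: "x \<in> span_of S" and fin: "finite S" "finite R"
    and adj: "\<And>g. g \<in> S \<Longrightarrow> \<exists>k\<in>R. adj (m g) = m k"
  shows "adj x \<in> span_of R"
  using x fin(1)
proof (induction x rule: span_of_induct)
  case (add x g a)
  obtain k where k: "k \<in> R" "adj (m g) = m k" using adj[OF \<open>g \<in> S\<close>] by blast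
  have "adj (a \<odot> m g \<oplus> x) = cnj a \<odot> m k \<oplus> adj x"
    using add by (simp add: adj_add adj_smult m k)
  then show ?case using add k fin by (simp add: span_of_add span_of_single)
qed (use fin in \<open>simp add: span_of_zero\<close>)

end

end

section \<open>Growth of boxes of exponents\<close>

definition int_box :: "'i set \<Rightarrow> nat \<Rightarrow> ('i \<Rightarrow> int) set" where
  "int_box P b = {f. (\<forall>i\<in>P. \<bar>f i\<bar> \<le> int b) \<and> (\<forall>i. i \<notin> P \<longrightarrow> f i = 0)}"

lemma int_box_card:
  assumes "finite P"
  shows "finite (int_box P b)" "card (int_box P b) \<le> (2 * b + 1) ^ card P"
proof -
  let ?F = "\<Pi>\<^sub>E i\<in>P. {- int b..int b}"
  have fin: "finite ?F" using assms by (intro finite_PiE) auto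
  have inj: "inj_on (\<lambda>f. restrict f P) (int_box P b)"
  proof (rule inj_onI)
    fix f g assume fg: "f \<in> int_box P b" "g \<in> int_box P b" "restrict f P = restrict g P"
    show "f = g"
    proof
      fix i
      have "restrict f P i = restrict g P i" by (simp only: fg(3))
      then show "f i = g i" using fg(1,2) by (cases "i \<in> P") (auto simp: int_box_def)
    qed
  qed
  have sub: "(\<lambda>f. restrict f P) ` int_box P b \<subseteq> ?F" by (force simp: int_box_def)
  show "finite (int_box P b)" using inj sub fin by (rule inj_on_finite)
  have "card (int_box P b) \<le> card ?F" using inj sub fin by (rule card_inj_on_le)
  also have "card {- int b..int b} = 2 * b + 1" unfolding card_atLeastAtMost_int by arith
  then have "card ?F = (2 * b + 1) ^ card P" using assms by (simp add: card_PiE)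
  finally show "card (int_box P b) \<le> (2 * b + 1) ^ card P" .
qed

text \<open>Central exponents receive the quadratic range because reordering adds products of two
  other exponents. The double product in the square of \<open>r + s\<close> absorbs the cocycle,
  which is at most \<open>r * s\<close>, so sizes add under multiplication of words.\<close>

definition exp_box :: "nat \<Rightarrow> nat \<Rightarrow> exponents set" where
  "exp_box n r = int_box (pairs n) (r\<^sup>2) \<times> int_box {1..n} r"

lemma finite_exp_box: "finite (exp_box n r)"
  unfolding exp_box_def by (intro finite_cartesian_product int_box_card(1) finite_pairs) simp

lemma cocycle_bound:
  assumes "k \<in> int_box {1..n} r" "k' \<in> int_box {1..n} s"
  shows "\<bar>cocycle n k k' p\<bar> \<le> int (r * s)"
proof (cases "p \<in> pairs n")
  case True
  then have "snd p \<in> {1..n}" "fst p \<in> {1..n}" by (auto simp: pairs_def)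
  then have "\<bar>k (snd p)\<bar> \<le> int r" "\<bar>k' (fst p)\<bar> \<le> int s" using assms by (auto simp: int_box_def)
  then have "\<bar>k (snd p)\<bar> * \<bar>k' (fst p)\<bar> \<le> int r * int s" by (intro mult_mono) auto
  then show ?thesis using True by (simp add: cocycle_def abs_mult)
qed (simp add: cocycle_def)

lemma exp_mult_box:
  assumes "g \<in> exp_box n r" "h \<in> exp_box n s"
  shows "exp_mult n g h \<in> exp_box n (r + s)"
proof -
  obtain l k l' k' where gh: "g = (l, k)" "h = (l', k')" by (cases g, cases h)
  have b: "l \<in> int_box (pairs n) (r\<^sup>2)" "k \<in> int_box {1..n} r" "l' \<in> int_box (pairs n) (s\<^sup>2)"
    "k' \<in> int_box {1..n} s"
    using assms by (auto simp: gh exp_box_def)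
  have "\<bar>l p + l' p + cocycle n k k' p\<bar> \<le> int ((r + s)\<^sup>2)" if "p \<in> pairs n" for p
  proof -
    have "\<bar>l p\<bar> \<le> int (r\<^sup>2)" "\<bar>l' p\<bar> \<le> int (s\<^sup>2)" using b that by (auto simp: int_box_def)
    moreover have "int ((r + s)\<^sup>2) = int (r\<^sup>2) + int (s\<^sup>2) + 2 * int (r * s)"
      by (simp add: power2_sum)
    moreover have "0 \<le> int (r * s)" by simp
    ultimately show ?thesis using cocycle_bound[OF b(2,4), of p] by linarith
  qed
  moreover have "\<bar>k i + k' i\<bar> \<le> int (r + s)" if "i \<in> {1..n}" for i
  proof -
    have "\<bar>k i\<bar> \<le> int r" "\<bar>k' i\<bar> \<le> int s" using b that by (auto simp: int_box_def)
    then show ?thesis by simp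
  qed
  moreover have "l p + l' p + cocycle n k k' p = 0" if "p \<notin> pairs n" for p
  proof -
    have "l p = 0" "l' p = 0" using b that unfolding int_box_def by blast+
    then show ?thesis using that by (simp add: cocycle_def)
  qed
  moreover have "k i + k' i = 0" if "i \<notin> {1..n}" for i using b that by (simp add: int_box_def)
  ultimately show ?thesis by (auto simp: gh exp_mult_def exp_box_def int_box_def)
qed

text \<open>The cocycle of \<open>k\<close> with its negative is as large as the central range
  itself, so inverses leave the box; doubling the size multiplies that range by 4 and leaves ample
  room.\<close>

lemma exp_inv_box:
  assumes "g \<in> exp_box n r"
  shows "exp_inv n g \<in> exp_box n (2 * r)"
proof -
  obtain l k where g: "g = (l, k)" by (cases g)
  have b: "l \<in> int_box (pairs n) (r\<^sup>2)" "k \<in> int_box {1..n} r" using assms by (auto simp: g exp_box_def)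
  then have k': "(\<lambda>i. - k i) \<in> int_box {1..n} r" by (simp add: int_box_def)
  have "\<bar>- l p - cocycle n k (\<lambda>i. - k i) p\<bar> \<le> int ((2 * r)\<^sup>2)" if "p \<in> pairs n" for p
  proof -
    have "\<bar>l p\<bar> \<le> int (r\<^sup>2)" using b that by (auto simp: int_box_def)
    moreover have "int ((2 * r)\<^sup>2) = int (r\<^sup>2) + int (r * r) + 2 * int (r * r)"
      by (simp add: power2_eq_square)
    moreover have "0 \<le> int (r * r)" by simp
    ultimately show ?thesis using cocycle_bound[OF b(2) k', of p] by linarith
  qed
  moreover have "\<bar>- k i\<bar> \<le> int (2 * r)" if "i \<in> {1..n}" for i
  proof -
    have "\<bar>k i\<bar> \<le> int r" using b that by (auto simp: int_box_def)
    then show ?thesis by simp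
  qed
  moreover have "- l p - cocycle n k (\<lambda>i. - k i) p = 0" if "p \<notin> pairs n" for p
  proof -
    have "l p = 0" using b that unfolding int_box_def by blast
    then show ?thesis using that by (simp add: cocycle_def)
  qed
  moreover have "- k i = 0" if "i \<notin> {1..n}" for i using b that by (simp add: int_box_def)
  ultimately show ?thesis by (auto simp: g exp_inv_def exp_box_def int_box_def)
qed

lemma int_box_mono:
  assumes "b \<le> d"
  shows "int_box P b \<subseteq> int_box P d"
proof
  fix f assume f: "f \<in> int_box P b"
  have "\<bar>f i\<bar> \<le> int d" if "i \<in> P" for i
  proof -
    have "\<bar>f i\<bar> \<le> int b" using f that by (simp add: int_box_def)
    then show ?thesis using \<open>b \<le> d\<close> by linarith
  qed
  then show "f \<in> int_box P d" using f by (simp add: int_box_def)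
qed

lemma exp_box_mono: "r \<le> s \<Longrightarrow> exp_box n r \<subseteq> exp_box n s"
  unfolding exp_box_def by (intro Sigma_mono int_box_mono power_mono) simp_all

lemma card_exp_box_le:
  obtains D :: nat where
    "\<And>r. real (card (exp_box n r)) \<le> (3 * (real r + 1)\<^sup>2) ^ D"
    "\<And>r. real (card (int_box {1..n} r)) \<le> (3 * (real r + 1)\<^sup>2) ^ D"
proof -
  \<comment> \<open>The total number of coordinates. The base
    \<open>3 * (real r + 1)\<^sup>2\<close> dominates both side lengths, so a single polynomial
    bounds both kinds of boxes.\<close>
  define D where "D = card (pairs n) + n"
  have base: "1 \<le> 3 * (real r + 1)\<^sup>2" "real (2 * r\<^sup>2 + 1) \<le> 3 * (real r + 1)\<^sup>2"
    "real (2 * r + 1) \<le> 3 * (real r + 1)\<^sup>2" for r :: nat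
  proof -
    have "3 * (real r + 1)\<^sup>2 = 3 * (real r)\<^sup>2 + 6 * real r + 3" by (simp add: power2_eq_square algebra_simps)
    then show "1 \<le> 3 * (real r + 1)\<^sup>2" "real (2 * r\<^sup>2 + 1) \<le> 3 * (real r + 1)\<^sup>2"
      "real (2 * r + 1) \<le> 3 * (real r + 1)\<^sup>2" by simp_all
  qed
  have P: "real (card (int_box (pairs n) (r\<^sup>2))) \<le> (3 * (real r + 1)\<^sup>2) ^ card (pairs n)" for r
  proof -
    have "real (card (int_box (pairs n) (r\<^sup>2))) \<le> real ((2 * r\<^sup>2 + 1) ^ card (pairs n))"
      using int_box_card(2)[OF finite_pairs, of n "r\<^sup>2"] by (simp only: of_nat_le_iff)
    also have "\<dots> = real (2 * r\<^sup>2 + 1) ^ card (pairs n)" by (rule of_nat_power)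
    also have "\<dots> \<le> (3 * (real r + 1)\<^sup>2) ^ card (pairs n)" by (intro power_mono base) simp
    finally show ?thesis .
  qed
  have K: "real (card (int_box {1..n} r)) \<le> (3 * (real r + 1)\<^sup>2) ^ n" for r
  proof -
    have "real (card (int_box {1..n} r)) \<le> real ((2 * r + 1) ^ n)"
      using int_box_card(2)[of "{1..n}" r] by (simp only: of_nat_le_iff finite_atLeastAtMost card_atLeastAtMost) simp
    also have "\<dots> = real (2 * r + 1) ^ n" by (rule of_nat_power)
    also have "\<dots> \<le> (3 * (real r + 1)\<^sup>2) ^ n" by (intro power_mono base) simp
    finally show ?thesis .
  qed
  show thesis
  proof (rule that[of D])
    fix r
    show "real (card (exp_box n r)) \<le> (3 * (real r + 1)\<^sup>2) ^ D"
      unfolding exp_box_def card_cartesian_product of_nat_mult D_def power_add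
      by (intro mult_mono P K) auto
    have "(3 * (real r + 1)\<^sup>2) ^ n \<le> (3 * (real r + 1)\<^sup>2) ^ D"
      by (intro power_increasing base) (simp add: D_def)
    then show "real (card (int_box {1..n} r)) \<le> (3 * (real r + 1)\<^sup>2) ^ D" using K[of r] by linarith
  qed
qed

text \<open>Taking \<open>2\<^sup>j\<^sup>+\<^sup>1\<close>-th roots turns the polynomial factor in the size of a box into one tending to 1.\<close>

lemma subexponential_root:
  fixes a :: real and D :: nat
  assumes "a \<ge> 1"
  obtains \<rho> :: "nat \<Rightarrow> real" where
    "\<And>j. \<rho> j \<ge> 1" "\<rho> \<longlonglongrightarrow> 1" "\<And>j. \<rho> j ^ 2 ^ Suc j = (a * 4 ^ j) ^ D"
proof -
  define \<rho> where "\<rho> j = exp (D * (ln a + real j * ln 4) / 2 ^ Suc j)" for j :: nat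
  have "\<rho> j ^ 2 ^ Suc j = (a * 4 ^ j) ^ D" for j
  proof -
    have "\<rho> j ^ 2 ^ Suc j = exp (real (2 ^ Suc j) * (D * (ln a + real j * ln 4) / 2 ^ Suc j))"
      by (simp only: \<rho>_def exp_of_nat_mult)
    also have "real (2 ^ Suc j) * (D * (ln a + real j * ln 4) / 2 ^ Suc j) = D * ln (a * 4 ^ j)"
      using assms by (simp add: ln_mult ln_realpow)
    also have "exp \<dots> = (a * 4 ^ j) ^ D" using assms by (simp add: exp_of_nat_mult)
    finally show ?thesis .
  qed
  moreover have "\<rho> j \<ge> 1" for j using assms by (simp add: \<rho>_def)
  moreover have "(\<lambda>j::nat. exp (D * (ln a + real j * ln 4) / 2 ^ Suc j)) \<longlonglongrightarrow> 1"
    by real_asymp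
  ultimately show thesis using that[of \<rho>] by (simp add: \<rho>_def[abs_def])
qed

section \<open>Fourier coefficients on finite-dimensional tori\<close>

definition character :: "'p set \<Rightarrow> ('p \<Rightarrow> complex) \<Rightarrow> ('p \<Rightarrow> int) \<Rightarrow> complex" where
  "character P \<theta> l = (\<Prod>p\<in>P. \<theta> p powi l p)"

lemma norm_character: "(\<And>p. p \<in> P \<Longrightarrow> cmod (\<theta> p) = 1) \<Longrightarrow> cmod (character P \<theta> l) = 1"
  unfolding character_def prod_norm[symmetric] by (simp add: norm_power_int)

text \<open>For nonzero \<open>d\<close> of modulus below \<open>N\<close> the summands are the
  powers of a nontrivial \<open>N\<close>-th root of unity, and their geometric sum
  vanishes.\<close>

lemma root_of_unity_sum:
  assumes "\<bar>d\<bar> < int N"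
  shows "(\<Sum>j<N. cis (2 * pi * real j * of_int d / N)) = (if d = 0 then of_nat N else 0)"
proof (cases "d = 0")
  case False
  let ?z = "cis (2 * pi * of_int d / N)"
  have N: "N > 0" using assms by auto
  have z: "cis (2 * pi * real j * of_int d / N) = ?z ^ j" for j
    unfolding Complex.DeMoivre by (rule arg_cong[of _ _ cis]) simp
  have "?z \<noteq> 1"
  proof
    assume "?z = 1"
    then have "cos (2 * pi * of_int d / N) = 1" by (simp add: complex_eq_iff)
    then obtain k :: int where "2 * pi * of_int d / N = of_int k * 2 * pi" by (auto simp: cos_one_2pi_int)
    then have "real_of_int d = of_int k * N" using N by (simp add: field_simps)
    then have "real_of_int d = real_of_int (k * int N)" by simp
    then have d: "d = k * int N" by (simp only: of_int_eq_iff)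
    then have "\<bar>k\<bar> \<ge> 1" using False by auto
    then have "\<bar>d\<bar> \<ge> int N" using d by (simp add: abs_mult mult_le_cancel_right1)
    then show False using assms by simp
  qed
  moreover have "?z ^ N = 1"
    unfolding Complex.DeMoivre using N cis_multiple_2pi[of "of_int d"] by (simp add: mult_ac)
  ultimately show ?thesis using False by (simp add: z geometric_sum)
qed simp

text \<open>A coefficient is the average of the trigonometric polynomial against a conjugate
  character, here over a finite grid in place of an integral; an average of values of modulus at
  most \<open>B\<close> has modulus at most \<open>B\<close>.\<close>

lemma fourier_coefficient_bound:
  fixes P :: "'p set"
  assumes P: "finite P" and l0: "l0 \<in> int_box P b"
    and bound: "\<And>\<theta>. \<theta> \<in> (\<Pi>\<^sub>E p\<in>P. sphere 0 1) \<Longrightarrow> cmod (\<Sum>l\<in>int_box P b. a l * character P \<theta> l) \<le> B"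
  shows "cmod (a l0) \<le> B"
proof -
  \<comment> \<open>Exponents in the box differ by at most \<open>2 * b\<close> in each coordinate.
    Being larger than that, \<open>N\<close> makes distinct characters exactly orthogonal on the
    grid of \<open>N\<close>-th roots of unity.\<close>
  define N where "N = 2 * b + 1"
  let ?L = "int_box P b" and ?T = "\<Pi>\<^sub>E p\<in>P. {..<N}"
  define \<theta> where "\<theta> t = (\<lambda>p\<in>P. cis (2 * pi * real (t p) / N))" for t :: "'p \<Rightarrow> nat"
  have \<theta>: "\<theta> t \<in> (\<Pi>\<^sub>E p\<in>P. sphere 0 1)" for t by (auto simp: \<theta>_def)
  have char: "character P (\<theta> t) l * cnj (character P (\<theta> t) l0) =
      (\<Prod>p\<in>P. cis (2 * pi * real (t p) * of_int (l p - l0 p) / N))" for t l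
  proof -
    have "cis (2 * pi * real (t p) / N) powi l p * cnj (cis (2 * pi * real (t p) / N) powi l0 p) =
      cis (2 * pi * real (t p) * of_int (l p - l0 p) / N)" for p
      unfolding cis_power_int cis_cnj cis_mult
      by (rule arg_cong[of _ _ cis]) (simp add: algebra_simps diff_divide_distrib)
    then show ?thesis unfolding character_def cnj_prod prod.distrib[symmetric]
      by (intro prod.cong) (simp_all add: \<theta>_def)
  qed
  have orth: "(\<Sum>t\<in>?T. character P (\<theta> t) l * cnj (character P (\<theta> t) l0)) = (if l = l0 then of_nat (N ^ card P) else 0)"
    if l: "l \<in> ?L" for l
  proof -
    have d: "\<bar>l p - l0 p\<bar> < int N" if "p \<in> P" for p
    proof -
      have "\<bar>l p\<bar> \<le> int b" "\<bar>l0 p\<bar> \<le> int b" using l l0 that by (auto simp: int_box_def)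
      then show ?thesis by (simp add: N_def)
    qed
    have "(\<Sum>t\<in>?T. character P (\<theta> t) l * cnj (character P (\<theta> t) l0)) =
        (\<Prod>p\<in>P. \<Sum>j<N. cis (2 * pi * real j * of_int (l p - l0 p) / N))"
      unfolding char using P by (subst prod_sum_PiE) auto
    also have "\<dots> = (\<Prod>p\<in>P. if l p = l0 p then of_nat N else 0)"
      by (intro prod.cong refl, subst root_of_unity_sum) (use d in auto)
    also have "\<dots> = (if l = l0 then of_nat (N ^ card P) else 0)"
    proof (cases "l = l0")
      case False
      then obtain p where "l p \<noteq> l0 p" by blast
      moreover have "p \<in> P"
      proof (rule ccontr)
        assume "p \<notin> P"
        then have "l p = 0" "l0 p = 0" using l l0 unfolding int_box_def by blast+
        then show False using \<open>l p \<noteq> l0 p\<close> by simp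
      qed
      ultimately show ?thesis using False P by (auto intro!: prod_zero)
    qed simp
    finally show ?thesis .
  qed
  have finL: "finite ?L" using int_box_card(1)[OF P] .
  have "(\<Sum>t\<in>?T. (\<Sum>l\<in>?L. a l * character P (\<theta> t) l) * cnj (character P (\<theta> t) l0)) =
      (\<Sum>l\<in>?L. a l * (\<Sum>t\<in>?T. character P (\<theta> t) l * cnj (character P (\<theta> t) l0)))"
    unfolding sum_distrib_right sum_distrib_left by (subst sum.swap) (simp add: mult.assoc)
  also have "\<dots> = (\<Sum>l\<in>?L. if l = l0 then a l * of_nat (N ^ card P) else 0)"
    by (intro sum.cong refl) (simp add: orth)
  also have "\<dots> = a l0 * of_nat (N ^ card P)" using finL l0 by simp
  finally have "cmod (a l0) * N ^ card P =
      cmod (\<Sum>t\<in>?T. (\<Sum>l\<in>?L. a l * character P (\<theta> t) l) * cnj (character P (\<theta> t) l0))"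
    by (simp add: norm_mult norm_power)
  also have "\<dots> \<le> (\<Sum>t\<in>?T. B)"
  proof (rule sum_norm_le)
    fix t
    have "cmod (character P (\<theta> t) l0) = 1" using \<theta>[of t] by (intro norm_character) (auto simp: PiE_iff)
    then show "cmod ((\<Sum>l\<in>?L. a l * character P (\<theta> t) l) * cnj (character P (\<theta> t) l0)) \<le> B"
      using bound[OF \<theta>[of t]] by (simp add: norm_mult)
  qed
  also have "\<dots> = B * N ^ card P" using P by (simp add: card_PiE)
  finally show ?thesis by (simp add: N_def)
qed

section \<open>The section algebra\<close>

lemma (in star_algebra) nrm_squaring_iterate:
  assumes y: "y \<in> carrier A" "adj y = y"
  shows "((\<lambda>z. z \<otimes> z) ^^ j) y \<in> carrier A" "adj (((\<lambda>z. z \<otimes> z) ^^ j) y) = ((\<lambda>z. z \<otimes> z) ^^ j) y"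
    "nrm (((\<lambda>z. z \<otimes> z) ^^ j) y) = (nrm y) ^ 2 ^ j"
proof (induction j)
  case (Suc j)
  {
    case 1 show ?case using Suc by simp
  next
    case 2 show ?case using Suc by (simp add: adj_mult)
  next
    case 3
    have "(nrm y) ^ 2 ^ Suc j = ((nrm y) ^ 2 ^ j)\<^sup>2" by (simp add: power_mult[symmetric] mult.commute)
    then show ?case using Suc nrm_pow_selfadjoint[OF Suc(1,2)] by simp
  }
qed (use y in simp_all)

lemma (in star_morphism) hom_squaring_iterate:
  "y \<in> carrier A \<Longrightarrow> h (((\<lambda>z. z \<otimes>\<^bsub>A\<^esub> z) ^^ j) y) = ((\<lambda>z. z \<otimes>\<^bsub>B\<^esub> z) ^^ j) (h y)"
proof (induction j)
  case (Suc j)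
  have "((\<lambda>z. z \<otimes>\<^bsub>A\<^esub> z) ^^ j) y \<in> carrier A" by (induction j) (use Suc in simp_all)
  then show ?case using Suc by (simp add: hom_mult)
qed simp

lemma (in star_algebra) scalar_unitary_pow:
  assumes "cmod c = 1"
  shows "(c \<odot> \<one>) [^]\<^bsub>unitary_group A\<^esub> (i::int) = (c powi i) \<odot> \<one>"
proof -
  interpret G: group "unitary_group A" by (rule group_unitary_group)
  have u: "c \<odot> \<one> \<in> carrier (unitary_group A)" using unitary_scalar[OF assms] by simp
  have nat: "(c \<odot> \<one>) [^]\<^bsub>unitary_group A\<^esub> (k::nat) = (c ^ k) \<odot> \<one>" for k
    by (induction k) (simp_all add: smult_mult_left smult_mult_right smult_smult mult.commute)
  show ?thesis
  proof (cases "i \<ge> 0")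
    case True
    then obtain k where "i = int k" using nonneg_int_cases by blast
    then show ?thesis by (simp add: int_pow_int nat)
  next
    case False
    then have "i = - int (nat (- i))" by simp
    then obtain k where k: "i = - int k" by blast
    have "c ^ k * cnj (c ^ k) = 1"
      using assms complex_norm_square[of "c ^ k"] by (simp add: norm_power)
    then have "cnj (c ^ k) = inverse (c ^ k)" by (rule inverse_unique[symmetric])
    moreover have "inv\<^bsub>unitary_group A\<^esub> ((c ^ k) \<odot> \<one>) = adj ((c ^ k) \<odot> \<one>)"
      using assms by (intro inv_unitary_group unitary_scalar) (simp add: norm_power)
    ultimately show ?thesis
      using G.int_pow_neg_int[OF u, of k] by (simp add: k nat adj_smult power_int_minus)
  qed
qed

lemma (in star_algebra) scalar_central_word:
  assumes "\<And>p. p \<in> set qs \<Longrightarrow> cmod (\<theta> p) = 1" "distinct qs"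
  shows "central_word (unitary_group A) (\<lambda>p. \<theta> p \<odot> \<one>) l qs = character (set qs) \<theta> l \<odot> \<one>"
  using assms
proof (induction qs)
  case (Cons q qs)
  then show ?case
    using scalar_unitary_pow[of "\<theta> q" "l q"]
    by (simp add: character_def smult_mult_left smult_smult)
qed (simp add: character_def)

lemma (in star_morphism) hom_central_word:
  assumes "\<And>p. p \<in> set qs \<Longrightarrow> unitary_in A (v p)" "\<And>p. p \<in> set qs \<Longrightarrow> h (v p) = v' p"
  shows "unitary_in A (central_word (unitary_group A) v l qs)"
    "h (central_word (unitary_group A) v l qs) = central_word (unitary_group B) v' l qs"
proof -
  interpret G: group "unitary_group A" by (rule A.group_unitary_group)
  have pow: "unitary_in A (v p [^]\<^bsub>unitary_group A\<^esub> l p)" if "p \<in> set qs" for p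
    using G.int_pow_closed[of "v p" "l p"] assms(1)[OF that] by simp
  have "unitary_in A (central_word (unitary_group A) v l rs) \<and>
      h (central_word (unitary_group A) v l rs) = central_word (unitary_group B) v' l rs"
    if "set rs \<subseteq> set qs" for rs
    using that
  proof (induction rs)
    case (Cons r rs)
    then have r: "r \<in> set qs" by simp
    show ?case
      using Cons pow[OF r] assms(2)[OF r] hom_unitary_pow[OF assms(1)[OF r], of "l r"]
      by (simp add: A.unitary_mult hom_mult A.unitary_closed)
  qed (simp add: A.unitary_one)
  from this[of qs] show "unitary_in A (central_word (unitary_group A) v l qs)"
    "h (central_word (unitary_group A) v l qs) = central_word (unitary_group B) v' l qs" by auto
qed

section \<open>The torus as a compact subset of a function space\<close>

lemma topspace_torus: "topspace (torus n) = (\<Pi>\<^sub>E p\<in>pairs n. sphere 0 1)"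
  by (simp add: torus_def topspace_product_topology)

text \<open>The identity is a continuous bijection from a compact space to a Hausdorff space,
  coordinates off \<open>pairs n\<close> being constantly \<open>undefined\<close>. Afterwards
  compactness, continuity on sets and the metric of the function space are available on the
  torus.\<close>

lemma torus_eq_top_of_set: "torus n = top_of_set (\<Pi>\<^sub>E p\<in>pairs n. sphere 0 1)"
proof -
  let ?S = "\<Pi>\<^sub>E p\<in>pairs n. sphere (0::complex) 1"
  have comp: "compact_space (torus n)"
    unfolding torus_def by (simp add: compact_space_product_topology compact_space_subtopology)
  have "continuous_map (torus n) euclidean (\<lambda>\<theta>. \<theta> p)" for p
  proof (cases "p \<in> pairs n")
    case True
    have "continuous_map (torus n) (top_of_set (sphere 0 1)) (\<lambda>\<theta>. \<theta> p)"
      unfolding torus_def by (rule continuous_map_product_projection[OF True])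
    then show ?thesis using continuous_map_into_fulltopology by blast
  next
    case False
    have "continuous_map (torus n) euclidean (\<lambda>_. undefined :: complex)" by simp
    then show ?thesis
    proof (rule continuous_map_eq)
      show "undefined = \<theta> p" if "\<theta> \<in> topspace (torus n)" for \<theta>
        using PiE_arb[OF that[unfolded topspace_torus] False] by simp
    qed
  qed
  then have "continuous_map (torus n) euclidean (\<lambda>\<theta>. \<theta>)"
    unfolding euclidean_product_topology[symmetric] by (subst continuous_map_componentwise_UNIV) blast
  then have cont: "continuous_map (torus n) (top_of_set ?S) (\<lambda>\<theta>. \<theta>)"
    by (simp add: continuous_map_in_subtopology topspace_torus)
  have "homeomorphic_map (torus n) (top_of_set ?S) (\<lambda>\<theta>. \<theta>)"
    by (rule continuous_imp_homeomorphic_map[OF cont comp])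
      (auto simp: topspace_torus Hausdorff_space_subtopology)
  then have "openin (torus n) U \<longleftrightarrow> openin (top_of_set ?S) U" for U
    using homeomorphic_map_openness_eq[of "torus n" "top_of_set ?S" "\<lambda>\<theta>. \<theta>" U]
      openin_subset[of "torus n" U] openin_subset[of "top_of_set ?S" U]
    by (auto simp: topspace_torus)
  then show ?thesis by (simp add: topology_eq)
qed

lemma compact_torus: "compact (\<Pi>\<^sub>E p\<in>pairs n. sphere (0::complex) 1)"
proof -
  have "compact_space (torus n)"
    unfolding torus_def by (simp add: compact_space_product_topology compact_space_subtopology)
  then have "compactin (top_of_set (\<Pi>\<^sub>E p\<in>pairs n. sphere (0::complex) 1)) (\<Pi>\<^sub>E p\<in>pairs n. sphere 0 1)"
    unfolding torus_eq_top_of_set compact_space_def by (simp only: topspace_euclidean_subtopology)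
  then show ?thesis by (simp only: compactin_subtopology compactin_euclidean_iff)
qed

section \<open>The canonical maps onto the fibres\<close>

locale nilpotent_group_field =
  fixes n :: nat
    and A :: "'a cstar" and U :: "nat \<Rightarrow> 'a" and V :: "nat \<times> nat \<Rightarrow> 'a"
    and \<A> :: "(nat \<times> nat \<Rightarrow> complex) \<Rightarrow> 'b cstar"
    and W :: "(nat \<times> nat \<Rightarrow> complex) \<Rightarrow> nat \<Rightarrow> 'b"
  assumes group_cstar: "is_group_cstar n A U V"
    and fibers: "\<And>\<theta>. \<theta> \<in> topspace (torus n) \<Longrightarrow> is_nc_torus n \<theta> (\<A> \<theta>) (W \<theta>)"
begin

abbreviation "T \<equiv> (\<Pi>\<^sub>E p\<in>pairs n. sphere (0::complex) 1)"
abbreviation "\<pi> \<equiv> (\<lambda>\<theta>. canonical_map n A U V \<theta> (\<A> \<theta>) (W \<theta>))"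

lemma T_norm: "\<theta> \<in> T \<Longrightarrow> p \<in> pairs n \<Longrightarrow> cmod (\<theta> p) = 1"
  by (auto simp: PiE_iff)

lemma fiber: "\<theta> \<in> T \<Longrightarrow> is_nc_torus n \<theta> (\<A> \<theta>) (W \<theta>)"
  using fibers by (simp add: topspace_torus)

lemma star_fiber: "\<theta> \<in> T \<Longrightarrow> star_algebra (\<A> \<theta>)"
  using fiber by (simp add: is_nc_torus_def cstar_algebra_iff_star_algebra)

sublocale A: star_algebra A
  using group_cstar by (simp add: is_group_cstar_def cstar_algebra_iff_star_algebra)

lemma G_rel: "G_relations n A U V"
  using group_cstar by (simp add: is_group_cstar_def)

lemma U_unitary: "i \<in> {1..n} \<Longrightarrow> unitary_in A (U i)"
  and V_unitary: "p \<in> pairs n \<Longrightarrow> unitary_in A (V p)"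
  using G_rel unfolding G_relations_def by blast+

lemma W_unitary: "\<theta> \<in> T \<Longrightarrow> i \<in> {1..n} \<Longrightarrow> unitary_in (\<A> \<theta>) (W \<theta> i)"
  using fiber unfolding is_nc_torus_def torus_relations_def by blast

text \<open>Justifies the definite description. A map exists by the universal property of
  \<open>A\<close>, applied to the torus generators and the scalars, and restricting it makes it
  extensional; it is unique because the generators determine it on the carrier.\<close>

lemma canonical:
  assumes \<theta>: "\<theta> \<in> T"
  shows "star_morphism A (\<A> \<theta>) (\<pi> \<theta>)"
    "\<And>i. i \<in> {1..n} \<Longrightarrow> \<pi> \<theta> (U i) = W \<theta> i"
    "\<And>p. p \<in> pairs n \<Longrightarrow> \<pi> \<theta> (V p) = \<theta> p \<odot>\<^bsub>\<A> \<theta>\<^esub> \<one>\<^bsub>\<A> \<theta>\<^esub>"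
proof -
  interpret B: star_algebra "\<A> \<theta>" by (rule star_fiber[OF \<theta>])
  let ?P = "\<lambda>h. h \<in> star_hom A (\<A> \<theta>) \<and> h \<in> extensional (carrier A) \<and>
    (\<forall>i\<in>{1..n}. h (U i) = W \<theta> i) \<and> (\<forall>p\<in>pairs n. h (V p) = \<theta> p \<odot>\<^bsub>\<A> \<theta>\<^esub> \<one>\<^bsub>\<A> \<theta>\<^esub>)"
  have "torus_relations n \<theta> (\<A> \<theta>) (W \<theta>)" using fiber[OF \<theta>] by (simp add: is_nc_torus_def)
  then have G: "G_relations n (\<A> \<theta>) (W \<theta>) (\<lambda>p. \<theta> p \<odot>\<^bsub>\<A> \<theta>\<^esub> \<one>\<^bsub>\<A> \<theta>\<^esub>)"
    by (rule B.torus_relations_imp_G_relations) (rule T_norm[OF \<theta>])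
  obtain h where h: "star_morphism A (\<A> \<theta>) h" "\<And>i. i \<in> {1..n} \<Longrightarrow> h (U i) = W \<theta> i"
    "\<And>p. p \<in> pairs n \<Longrightarrow> h (V p) = \<theta> p \<odot>\<^bsub>\<A> \<theta>\<^esub> \<one>\<^bsub>\<A> \<theta>\<^esub>"
    using group_cstar_universal[OF group_cstar B.star_algebra_axioms G] by blast
  interpret h: star_morphism A "\<A> \<theta>" h by (rule h(1))
  have mor: "star_morphism A (\<A> \<theta>) g \<longleftrightarrow> g \<in> star_hom A (\<A> \<theta>)" for g
    using A.star_algebra_axioms B.star_algebra_axioms
    by (simp add: star_morphism_def star_morphism_axioms_def)
  have "?P (restrict h (carrier A))"
  proof (intro conjI ballI)
    show "restrict h (carrier A) \<in> star_hom A (\<A> \<theta>)"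
      by (simp add: star_hom_def ring_hom_def h.hom_add h.hom_mult h.hom_smult h.hom_adj)
    show "restrict h (carrier A) (U i) = W \<theta> i" if "i \<in> {1..n}" for i
      using h(2)[OF that] A.unitary_closed[OF U_unitary[OF that]] by simp
    show "restrict h (carrier A) (V p) = \<theta> p \<odot>\<^bsub>\<A> \<theta>\<^esub> \<one>\<^bsub>\<A> \<theta>\<^esub>" if "p \<in> pairs n" for p
      using h(3)[OF that] A.unitary_closed[OF V_unitary[OF that]] by simp
  qed simp
  moreover have "g = g'" if g: "?P g" and g': "?P g'" for g g'
  proof (rule extensionalityI)
    show "g \<in> extensional (carrier A)" "g' \<in> extensional (carrier A)" using g g' by auto
    show "g x = g' x" if "x \<in> carrier A" for x
    proof (rule star_hom_eqI[OF _ _ _ _ that])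
      show "star_morphism A (\<A> \<theta>) g" "star_morphism A (\<A> \<theta>) g'" using g g' mor by auto
      show "cstar_generated A (U ` {1..n} \<union> V ` pairs n)"
        using group_cstar by (simp add: is_group_cstar_def)
      show "g x = g' x" if "x \<in> U ` {1..n} \<union> V ` pairs n" for x using that g g' by auto
    qed
  qed
  ultimately have "\<exists>!h. ?P h" by blast
  from theI'[OF this] have P: "?P (\<pi> \<theta>)" unfolding canonical_map_def .
  then show "star_morphism A (\<A> \<theta>) (\<pi> \<theta>)"
    "\<And>i. i \<in> {1..n} \<Longrightarrow> \<pi> \<theta> (U i) = W \<theta> i"
    "\<And>p. p \<in> pairs n \<Longrightarrow> \<pi> \<theta> (V p) = \<theta> p \<odot>\<^bsub>\<A> \<theta>\<^esub> \<one>\<^bsub>\<A> \<theta>\<^esub>"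
    using mor by blast+
qed

section \<open>Normal forms and their images in the fibres\<close>

definition "ps = (SOME xs. distinct xs \<and> set xs = pairs n)"

lemma ps: "distinct ps" "set ps = pairs n"
  using someI_ex[of "\<lambda>xs. distinct xs \<and> set xs = pairs n"] finite_distinct_list[OF finite_pairs, of n]
  unfolding ps_def by blast+

sublocale N: nilpotent_generators "unitary_group A" n U V ps
proof (rule nilpotent_generators.intro[OF A.group_unitary_group], unfold_locales)
  show "U i \<otimes>\<^bsub>unitary_group A\<^esub> U j = V (i, j) \<otimes>\<^bsub>unitary_group A\<^esub> (U j \<otimes>\<^bsub>unitary_group A\<^esub> U i)"
    if "(i, j) \<in> pairs n" for i j
    using G_rel that unfolding A.G_relations_iff by auto
qed (use G_rel ps in \<open>simp_all add: A.G_relations_iff\<close>)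

abbreviation "word \<equiv> N.word"

lemma word_unitary: "unitary_in A (word g)"
  using N.word_closed by simp

lemma word_carrier: "word g \<in> carrier A"
  by (rule A.unitary_closed[OF word_unitary])

lemma word_mult: "word g \<otimes>\<^bsub>A\<^esub> word h = word (exp_mult n g h)"
  using N.word_mult by simp

lemma word_adj: "adj\<^bsub>A\<^esub> (word g) = word (exp_inv n g)"
  using N.word_inv A.inv_unitary_group[OF word_unitary] by simp

definition torus_word :: "(nat \<times> nat \<Rightarrow> complex) \<Rightarrow> (nat \<Rightarrow> int) \<Rightarrow> 'b" where
  "torus_word \<theta> k = gen_word (unitary_group (\<A> \<theta>)) (W \<theta>) k n"

lemma torus_word_unitary: "\<theta> \<in> T \<Longrightarrow> unitary_in (\<A> \<theta>) (torus_word \<theta> k)"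
  unfolding torus_word_def
  by (rule star_algebra.gen_word_unitary[OF star_fiber _ order_refl]) (simp_all add: W_unitary)

lemma torus_word_carrier: "\<theta> \<in> T \<Longrightarrow> torus_word \<theta> k \<in> carrier (\<A> \<theta>)"
  using torus_word_unitary by (simp add: unitary_in_def)

lemma canonical_word:
  assumes \<theta>: "\<theta> \<in> T"
  shows "\<pi> \<theta> (word g) = character (pairs n) \<theta> (fst g) \<odot>\<^bsub>\<A> \<theta>\<^esub> torus_word \<theta> (snd g)"
proof -
  interpret h: star_morphism A "\<A> \<theta>" "\<pi> \<theta>" by (rule canonical(1)[OF \<theta>])
  let ?c = "central_word (unitary_group A) V (fst g) ps"
  have c: "unitary_in A ?c"
    "\<pi> \<theta> ?c = central_word (unitary_group (\<A> \<theta>)) (\<lambda>p. \<theta> p \<odot>\<^bsub>\<A> \<theta>\<^esub> \<one>\<^bsub>\<A> \<theta>\<^esub>) (fst g) ps"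
    by (rule h.hom_central_word; use V_unitary canonical(3)[OF \<theta>] ps in simp)+
  have x: "unitary_in A (gen_word (unitary_group A) U (snd g) n)"
    by (rule A.gen_word_unitary[OF U_unitary order_refl])
  have "\<pi> \<theta> (word g) = \<pi> \<theta> ?c \<otimes>\<^bsub>\<A> \<theta>\<^esub> \<pi> \<theta> (gen_word (unitary_group A) U (snd g) n)"
    using h.hom_mult A.unitary_closed c(1) x by (simp add: N.word_def)
  also have "\<pi> \<theta> (gen_word (unitary_group A) U (snd g) n) = torus_word \<theta> (snd g)"
    unfolding torus_word_def by (rule h.hom_gen_word[OF U_unitary canonical(2)[OF \<theta>] order_refl])
  also have "\<pi> \<theta> ?c = character (pairs n) \<theta> (fst g) \<odot>\<^bsub>\<A> \<theta>\<^esub> \<one>\<^bsub>\<A> \<theta>\<^esub>"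
    unfolding c(2) using h.B.scalar_central_word[of ps \<theta> "fst g"] T_norm[OF \<theta>] ps by simp
  finally show ?thesis using torus_word_carrier[OF \<theta>] by (simp add: h.B.smult_mult_left)
qed

section \<open>Trigonometric polynomials and their coefficients\<close>

definition Poly :: "nat \<Rightarrow> 'a set" where
  "Poly r = A.span_of word (exp_box n r)"

abbreviation "kbox r \<equiv> int_box {1..n} r"

text \<open>Words that share the exponents \<open>k\<close> become multiples of the same torus word
  in a fibre. Their multiples add up to this trigonometric polynomial in \<open>\<theta>\<close>,
  with central exponents of size at most \<open>r\<^sup>2\<close>.\<close>

definition coeff :: "nat \<Rightarrow> (exponents \<Rightarrow> complex) \<Rightarrow> (nat \<times> nat \<Rightarrow> complex) \<Rightarrow> (nat \<Rightarrow> int) \<Rightarrow> complex" where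
  "coeff r c \<theta> k = (\<Sum>l\<in>int_box (pairs n) (r\<^sup>2). c (l, k) * character (pairs n) \<theta> l)"

lemma finite_kbox: "finite (kbox r)"
  by (rule int_box_card(1)) simp

lemma canonical_lin_comb:
  assumes \<theta>: "\<theta> \<in> T"
  shows "\<pi> \<theta> (lin_comb A word (exp_box n r) c) = lin_comb (\<A> \<theta>) (torus_word \<theta>) (kbox r) (coeff r c \<theta>)"
proof -
  interpret h: star_morphism A "\<A> \<theta>" "\<pi> \<theta>" by (rule canonical(1)[OF \<theta>])
  \<comment> \<open>The contribution of a subset \<open>S\<close> of the box to the coefficient at
    \<open>k\<close>. Growing \<open>S\<close> one exponent at a time avoids rearranging a double
    sum inside the algebra; the rearrangement happens at the end, among complex numbers.\<close>
  let ?d = "\<lambda>S k. \<Sum>g\<in>S. if k = snd g then c g * character (pairs n) \<theta> (fst g) else 0"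
  note tw = torus_word_carrier[OF \<theta>]
  have "\<pi> \<theta> (lin_comb A word S c) = lin_comb (\<A> \<theta>) (torus_word \<theta>) (kbox r) (?d S)"
    if "finite S" "S \<subseteq> exp_box n r" for S
    using that
  proof (induction S rule: finite_induct)
    case empty
    then show ?case
      using h.B.lin_comb_zero[of "torus_word \<theta>", OF tw finite_kbox]
      by (simp add: A.lin_comb_empty word_carrier)
  next
    case (insert g S)
    let ?s = "\<lambda>k. if k = snd g then c g * character (pairs n) \<theta> (fst g) else 0"
    have g: "snd g \<in> kbox r" using insert.prems by (auto simp: exp_box_def)
    have "\<pi> \<theta> (lin_comb A word (insert g S) c) =
        c g \<odot>\<^bsub>\<A> \<theta>\<^esub> \<pi> \<theta> (word g) \<oplus>\<^bsub>\<A> \<theta>\<^esub> \<pi> \<theta> (lin_comb A word S c)"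
      using insert.hyps
      by (simp add: A.lin_comb_insert word_carrier h.hom_add h.hom_smult A.lin_comb_closed)
    also have "c g \<odot>\<^bsub>\<A> \<theta>\<^esub> \<pi> \<theta> (word g) = lin_comb (\<A> \<theta>) (torus_word \<theta>) (kbox r) ?s"
      using h.B.lin_comb_single[of "torus_word \<theta>", OF tw finite_kbox g]
      by (simp add: canonical_word[OF \<theta>] h.B.smult_smult tw)
    also have "\<pi> \<theta> (lin_comb A word S c) = lin_comb (\<A> \<theta>) (torus_word \<theta>) (kbox r) (?d S)"
      using insert by simp
    also have "lin_comb (\<A> \<theta>) (torus_word \<theta>) (kbox r) ?s \<oplus>\<^bsub>\<A> \<theta>\<^esub>
        lin_comb (\<A> \<theta>) (torus_word \<theta>) (kbox r) (?d S) =
        lin_comb (\<A> \<theta>) (torus_word \<theta>) (kbox r) (\<lambda>k. ?s k + ?d S k)"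
      by (rule h.B.lin_comb_add[of "torus_word \<theta>", OF tw])
    also have "(\<lambda>k. ?s k + ?d S k) = ?d (insert g S)" using insert.hyps by (simp add: fun_eq_iff)
    finally show ?case .
  qed
  from this[OF finite_exp_box subset_refl]
  have "\<pi> \<theta> (lin_comb A word (exp_box n r) c) =
      lin_comb (\<A> \<theta>) (torus_word \<theta>) (kbox r) (?d (exp_box n r))" .
  also have "\<dots> = lin_comb (\<A> \<theta>) (torus_word \<theta>) (kbox r) (coeff r c \<theta>)"
  proof (rule h.B.lin_comb_cong[of "torus_word \<theta>", OF tw])
    fix k assume k: "k \<in> kbox r"
    have "?d (exp_box n r) k = (\<Sum>l\<in>int_box (pairs n) (r\<^sup>2). \<Sum>k'\<in>kbox r.
        if k = k' then c (l, k') * character (pairs n) \<theta> l else 0)"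
      unfolding exp_box_def sum.cartesian_product by (rule sum.cong) auto
    also have "\<dots> = coeff r c \<theta> k" using k finite_kbox by (simp add: coeff_def)
    finally show "?d (exp_box n r) k = coeff r c \<theta> k" .
  qed
  finally show ?thesis .
qed

text \<open>The functional belonging to \<open>k\<close> is linear and contractive, annihilates the
  torus words with other exponents from the box and has modulus 1 on the one with exponents
  \<open>k\<close>.\<close>

lemma coeff_le_nrm:
  assumes \<theta>: "\<theta> \<in> T" and k: "k \<in> kbox r"
  shows "cmod (coeff r c \<theta> k) \<le> nrm\<^bsub>\<A> \<theta>\<^esub> (\<pi> \<theta> (lin_comb A word (exp_box n r) c))"
proof -
  interpret B: star_algebra "\<A> \<theta>" by (rule star_fiber[OF \<theta>])
  note tw = torus_word_carrier[OF \<theta>]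
  have k0: "i \<notin> {1..n} \<Longrightarrow> k i = 0" for i using k by (simp add: int_box_def)
  have "\<exists>F :: 'b \<Rightarrow> complex.
    (\<forall>x\<in>carrier (\<A> \<theta>). \<forall>y\<in>carrier (\<A> \<theta>). F (x \<oplus>\<^bsub>\<A> \<theta>\<^esub> y) = F x + F y) \<and>
    (\<forall>c. \<forall>x\<in>carrier (\<A> \<theta>). F (c \<odot>\<^bsub>\<A> \<theta>\<^esub> x) = c * F x) \<and>
    (\<forall>x\<in>carrier (\<A> \<theta>). cmod (F x) \<le> nrm\<^bsub>\<A> \<theta>\<^esub> x) \<and>
    cmod (F (torus_word \<theta> k)) = 1 \<and>
    (\<forall>k'. (\<forall>i. i \<notin> {1..n} \<longrightarrow> k' i = 0) \<and> k' \<noteq> k \<longrightarrow> F (torus_word \<theta> k') = 0)"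
    unfolding torus_word_def
    by (rule nc_torus_coefficient) (use T_norm[OF \<theta>] fiber[OF \<theta>] k0 in auto)
  then obtain F :: "'b \<Rightarrow> complex" where F0:
    "\<forall>x\<in>carrier (\<A> \<theta>). \<forall>y\<in>carrier (\<A> \<theta>). F (x \<oplus>\<^bsub>\<A> \<theta>\<^esub> y) = F x + F y"
    "\<forall>c. \<forall>x\<in>carrier (\<A> \<theta>). F (c \<odot>\<^bsub>\<A> \<theta>\<^esub> x) = c * F x"
    "\<forall>x\<in>carrier (\<A> \<theta>). cmod (F x) \<le> nrm\<^bsub>\<A> \<theta>\<^esub> x"
    "cmod (F (torus_word \<theta> k)) = 1"
    "\<forall>k'. (\<forall>i. i \<notin> {1..n} \<longrightarrow> k' i = 0) \<and> k' \<noteq> k \<longrightarrow> F (torus_word \<theta> k') = 0"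
    by (elim exE conjE)
  have F: "\<And>x y. \<lbrakk>x \<in> carrier (\<A> \<theta>); y \<in> carrier (\<A> \<theta>)\<rbrakk> \<Longrightarrow> F (x \<oplus>\<^bsub>\<A> \<theta>\<^esub> y) = F x + F y"
    "\<And>c x. x \<in> carrier (\<A> \<theta>) \<Longrightarrow> F (c \<odot>\<^bsub>\<A> \<theta>\<^esub> x) = c * F x"
    "\<And>x. x \<in> carrier (\<A> \<theta>) \<Longrightarrow> cmod (F x) \<le> nrm\<^bsub>\<A> \<theta>\<^esub> x"
    "cmod (F (torus_word \<theta> k)) = 1"
    "\<And>k'. \<lbrakk>\<forall>i. i \<notin> {1..n} \<longrightarrow> k' i = 0; k' \<noteq> k\<rbrakk> \<Longrightarrow> F (torus_word \<theta> k') = 0"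
    using F0 by blast+
  have Fzero: "F \<zero>\<^bsub>\<A> \<theta>\<^esub> = 0" using F(2)[of "\<zero>\<^bsub>\<A> \<theta>\<^esub>" 0] by simp
  have lin: "F (lin_comb (\<A> \<theta>) (torus_word \<theta>) S d) = (\<Sum>k'\<in>S. d k' * F (torus_word \<theta> k'))" if "finite S" for S d
    using that
    by (induction S rule: finite_induct)
      (simp_all add: B.lin_comb_empty[of "torus_word \<theta>", OF tw] B.lin_comb_insert[of "torus_word \<theta>", OF tw]
        Fzero F(1,2) tw B.lin_comb_closed[of "torus_word \<theta>", OF tw])
  have "F (\<pi> \<theta> (lin_comb A word (exp_box n r) c)) =
      (\<Sum>k'\<in>kbox r. coeff r c \<theta> k' * F (torus_word \<theta> k'))"
    unfolding canonical_lin_comb[OF \<theta>] by (rule lin[OF finite_kbox])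
  also have "\<dots> = (\<Sum>k'\<in>kbox r. if k' = k then coeff r c \<theta> k * F (torus_word \<theta> k) else 0)"
  proof (rule sum.cong)
    fix k' assume "k' \<in> kbox r"
    then have "F (torus_word \<theta> k') = 0" if "k' \<noteq> k"
      using that unfolding int_box_def by (intro F(5)) blast
    then show "coeff r c \<theta> k' * F (torus_word \<theta> k') =
        (if k' = k then coeff r c \<theta> k * F (torus_word \<theta> k) else 0)" by simp
  qed simp
  also have "\<dots> = coeff r c \<theta> k * F (torus_word \<theta> k)" using k finite_kbox by simp
  finally have "cmod (coeff r c \<theta> k) = cmod (F (\<pi> \<theta> (lin_comb A word (exp_box n r) c)))"
    by (simp add: norm_mult F(4))
  also have "\<dots> \<le> nrm\<^bsub>\<A> \<theta>\<^esub> (\<pi> \<theta> (lin_comb A word (exp_box n r) c))"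
    by (rule F(3)) (simp add: canonical_lin_comb[OF \<theta>] B.lin_comb_closed[of "torus_word \<theta>", OF tw])
  finally show ?thesis .
qed

lemma nrm_le_sum_coeff:
  assumes \<theta>: "\<theta> \<in> T"
  shows "nrm\<^bsub>\<A> \<theta>\<^esub> (\<pi> \<theta> (lin_comb A word (exp_box n r) c)) \<le> (\<Sum>k\<in>kbox r. cmod (coeff r c \<theta> k))"
proof -
  interpret B: star_algebra "\<A> \<theta>" by (rule star_fiber[OF \<theta>])
  show ?thesis
    unfolding canonical_lin_comb[OF \<theta>]
    by (rule B.nrm_lin_comb_le[of "torus_word \<theta>", OF torus_word_carrier[OF \<theta>] finite_kbox])
      (rule B.unitary_nrm_le[OF torus_word_unitary[OF \<theta>]])
qed

text \<open>Each coefficient function is bounded by \<open>B\<close> fibre by fibre, hence so are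
  its Fourier coefficients, which are the coefficients of \<open>x\<close>. As words are unitary,
  the norm is at most the sum of their moduli. The loss of a factor, the number of terms, is
  repaired by taking powers.\<close>

lemma nrm_Poly_le:
  fixes B :: real
  assumes x: "x \<in> Poly r" and B: "\<And>\<theta>. \<theta> \<in> T \<Longrightarrow> nrm\<^bsub>\<A> \<theta>\<^esub> (\<pi> \<theta> x) \<le> B"
  shows "nrm\<^bsub>A\<^esub> x \<le> real (card (exp_box n r)) * B"
proof -
  obtain c where c: "x = lin_comb A word (exp_box n r) c"
    using x unfolding Poly_def A.span_of_def[of word, OF word_carrier] by blast
  have "cmod (c g) \<le> B" if g: "g \<in> exp_box n r" for g
  proof -
    obtain l k where lk: "g = (l, k)" "l \<in> int_box (pairs n) (r\<^sup>2)" "k \<in> kbox r"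
      using g by (auto simp: exp_box_def)
    have "cmod (c (l, k)) \<le> B"
    proof (rule fourier_coefficient_bound[OF finite_pairs lk(2)])
      fix \<theta> assume \<theta>: "\<theta> \<in> T"
      show "cmod (\<Sum>l\<in>int_box (pairs n) (r\<^sup>2). c (l, k) * character (pairs n) \<theta> l) \<le> B"
        using coeff_le_nrm[OF \<theta> lk(3), of c] B[OF \<theta>] by (simp add: c coeff_def)
    qed
    then show ?thesis by (simp add: lk)
  qed
  then have "(\<Sum>g\<in>exp_box n r. cmod (c g)) \<le> real (card (exp_box n r)) * B"
    using sum_bounded_above[of "exp_box n r" "\<lambda>g. cmod (c g)" B] by simp
  moreover have "nrm\<^bsub>A\<^esub> x \<le> (\<Sum>g\<in>exp_box n r. cmod (c g))"
    unfolding c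
    by (rule A.nrm_lin_comb_le[of word, OF word_carrier finite_exp_box]) (rule A.unitary_nrm_le[OF word_unitary])
  ultimately show ?thesis by linarith
qed

end

context nilpotent_group_field
begin

lemma T_nonempty: "(\<lambda>p\<in>pairs n. 1) \<in> T"
  by auto

lemma nrm_canonical_le: "\<theta> \<in> T \<Longrightarrow> a \<in> carrier A \<Longrightarrow> nrm\<^bsub>\<A> \<theta>\<^esub> (\<pi> \<theta> a) \<le> nrm\<^bsub>A\<^esub> a"
  by (rule star_morphism.hom_nrm_le[OF canonical(1)])

lemma Poly_carrier: "Poly r \<subseteq> carrier A"
  unfolding Poly_def by (rule A.span_of_closed[of word, OF word_carrier])

lemma Poly_mono: "r \<le> s \<Longrightarrow> x \<in> Poly r \<Longrightarrow> x \<in> Poly s"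
  unfolding Poly_def
  by (rule A.span_of_mono[of word, OF word_carrier _ exp_box_mono finite_exp_box])

lemma Poly_add: "x \<in> Poly r \<Longrightarrow> y \<in> Poly r \<Longrightarrow> x \<oplus>\<^bsub>A\<^esub> y \<in> Poly r"
  unfolding Poly_def by (rule A.span_of_add[of word, OF word_carrier])

lemma Poly_smult: "x \<in> Poly r \<Longrightarrow> c \<odot>\<^bsub>A\<^esub> x \<in> Poly r"
  unfolding Poly_def by (rule A.span_of_smult[of word, OF word_carrier _ finite_exp_box])

lemma Poly_mult: "x \<in> Poly r \<Longrightarrow> y \<in> Poly s \<Longrightarrow> x \<otimes>\<^bsub>A\<^esub> y \<in> Poly (r + s)"
  unfolding Poly_def
proof (rule A.span_of_mult[of word, OF word_carrier _ _ finite_exp_box finite_exp_box finite_exp_box])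
  show "\<exists>k\<in>exp_box n (r + s). word g \<otimes>\<^bsub>A\<^esub> word h = word k" 
    if "g \<in> exp_box n r" "h \<in> exp_box n s" for g h
    using word_mult exp_mult_box[OF that] by blast
qed

lemma Poly_adj: "x \<in> Poly r \<Longrightarrow> adj\<^bsub>A\<^esub> x \<in> Poly (2 * r)"
  unfolding Poly_def
proof (rule A.span_of_adj[of word, OF word_carrier _ finite_exp_box finite_exp_box])
  show "\<exists>k\<in>exp_box n (2 * r). adj\<^bsub>A\<^esub> (word g) = word k" if "g \<in> exp_box n r" for g
    using word_adj exp_inv_box[OF that] by blast
qed

lemma word_Poly: "g \<in> exp_box n r \<Longrightarrow> word g \<in> Poly r"
  using A.span_of_single[of word, OF word_carrier finite_exp_box, of g n r 1] word_carrier
  unfolding Poly_def by simp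

lemma Poly_dense: "A.cl (\<Union>r. Poly r) = carrier A"
proof -
  let ?Q = "\<Union>r. Poly r"
  have Q: "?Q \<subseteq> carrier A" using Poly_carrier by blast
  have "cstar_subalgebra (A.cl ?Q) A"
  proof (rule A.cl_subalgebra[OF Q])
    have "word (\<lambda>_. 0, \<lambda>_. 0) \<in> Poly 0" by (rule word_Poly) (simp add: exp_box_def int_box_def)
    then show "\<one>\<^bsub>A\<^esub> \<in> ?Q" using N.word_zero by auto
    show "x \<oplus>\<^bsub>A\<^esub> y \<in> ?Q" if xy: "x \<in> ?Q" "y \<in> ?Q" for x y
    proof -
      obtain r s where rs: "x \<in> Poly r" "y \<in> Poly s" using xy by blast
      have "x \<oplus>\<^bsub>A\<^esub> y \<in> Poly (max r s)"
        by (rule Poly_add; rule Poly_mono[OF _ rs(1)] Poly_mono[OF _ rs(2)]) simp_all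
      then show ?thesis by blast
    qed
    show "x \<otimes>\<^bsub>A\<^esub> y \<in> ?Q" if "x \<in> ?Q" "y \<in> ?Q" for x y using that Poly_mult by blast
    show "adj\<^bsub>A\<^esub> x \<in> ?Q" if "x \<in> ?Q" for x using that Poly_adj by blast
    show "c \<odot>\<^bsub>A\<^esub> x \<in> A.cl ?Q" if "x \<in> ?Q" for c x
      using that Poly_smult A.cl_superset[OF Q] by blast
  qed
  moreover have "U ` {1..n} \<union> V ` pairs n \<subseteq> A.cl ?Q"
  proof -
    have "U i \<in> Poly 1" if "i \<in> {1..n}" for i
      using word_Poly[of "(\<lambda>_. 0, \<lambda>j. if j = i then 1 else 0)" 1] N.word_u[OF that] that
      by (simp add: exp_box_def int_box_def)
    moreover have "V p \<in> Poly 1" if "p \<in> pairs n" for p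
      using word_Poly[of "(\<lambda>q. if q = p then 1 else 0, \<lambda>_. 0)" 1] N.word_v[OF that] that
      by (auto simp: exp_box_def int_box_def)
    ultimately show ?thesis using A.cl_superset[OF Q] by blast
  qed
  ultimately show ?thesis
    using group_cstar unfolding is_group_cstar_def cstar_generated_def by blast
qed

lemma Poly_approx:
  assumes "x \<in> carrier A" "e > 0"
  obtains r q where "q \<in> Poly r" "nrm\<^bsub>A\<^esub> (q \<ominus>\<^bsub>A\<^esub> x) < e"
  using assms Poly_dense unfolding A.cl_def by blast

subsection \<open>The norm as a supremum over the fibres\<close>

text \<open>The iterated square of \<open>adj x\<close> times \<open>x\<close> is self-adjoint at
  every stage, so each squaring squares the norm exactly, in \<open>A\<close> and in every fibre.
  The first product already contributes one doubling, hence the exponents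
  \<open>2 ^ Suc j\<close>.\<close>

definition square_power :: "'a \<Rightarrow> nat \<Rightarrow> 'a" where
  "square_power x j = ((\<lambda>z. z \<otimes>\<^bsub>A\<^esub> z) ^^ j) (adj\<^bsub>A\<^esub> x \<otimes>\<^bsub>A\<^esub> x)"

text \<open>The size starts at \<open>2 * r + r\<close>, since taking adjoints doubles it, and
  doubles with every squaring.\<close>

lemma square_power_Poly: "x \<in> Poly r \<Longrightarrow> square_power x j \<in> Poly (3 * r * 2 ^ j)"
proof (induction j)
  case 0
  have "adj\<^bsub>A\<^esub> x \<otimes>\<^bsub>A\<^esub> x \<in> Poly (2 * r + r)" using 0 by (intro Poly_mult Poly_adj)
  then show ?case by (simp add: square_power_def)
next
  case (Suc j)
  have "square_power x j \<otimes>\<^bsub>A\<^esub> square_power x j \<in> Poly (3 * r * 2 ^ j + 3 * r * 2 ^ j)"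
    using Suc by (intro Poly_mult) auto
  then show ?case by (simp add: square_power_def mult.assoc mult_2[symmetric] mult.left_commute)
qed

lemma nrm_square_power:
  assumes x: "x \<in> carrier A"
  shows "nrm\<^bsub>A\<^esub> (square_power x j) = (nrm\<^bsub>A\<^esub> x) ^ 2 ^ Suc j"
proof -
  have "nrm\<^bsub>A\<^esub> (square_power x j) = (nrm\<^bsub>A\<^esub> (adj\<^bsub>A\<^esub> x \<otimes>\<^bsub>A\<^esub> x)) ^ 2 ^ j"
    unfolding square_power_def using x by (intro A.nrm_squaring_iterate) (simp_all add: A.adj_mult)
  then show ?thesis using x by (simp add: A.cstar_identity power_mult)
qed

lemma nrm_canonical_square_power:
  assumes \<theta>: "\<theta> \<in> T" and x: "x \<in> carrier A"
  shows "nrm\<^bsub>\<A> \<theta>\<^esub> (\<pi> \<theta> (square_power x j)) = (nrm\<^bsub>\<A> \<theta>\<^esub> (\<pi> \<theta> x)) ^ 2 ^ Suc j"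
proof -
  interpret h: star_morphism A "\<A> \<theta>" "\<pi> \<theta>" by (rule canonical(1)[OF \<theta>])
  let ?y = "adj\<^bsub>\<A> \<theta>\<^esub> (\<pi> \<theta> x) \<otimes>\<^bsub>\<A> \<theta>\<^esub> \<pi> \<theta> x"
  have "\<pi> \<theta> (square_power x j) = ((\<lambda>z. z \<otimes>\<^bsub>\<A> \<theta>\<^esub> z) ^^ j) ?y"
    unfolding square_power_def using x by (simp add: h.hom_squaring_iterate h.hom_mult h.hom_adj)
  then have "nrm\<^bsub>\<A> \<theta>\<^esub> (\<pi> \<theta> (square_power x j)) = (nrm\<^bsub>\<A> \<theta>\<^esub> ?y) ^ 2 ^ j"
    using x h.B.nrm_squaring_iterate(3)[of ?y j] by (simp add: h.B.adj_mult)
  then show ?thesis using x by (simp add: h.B.cstar_identity power_mult)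
qed

lemma box_growth:
  "\<exists>\<rho> :: nat \<Rightarrow> real. (\<forall>j. \<rho> j \<ge> 1) \<and> \<rho> \<longlonglongrightarrow> 1 \<and>
    (\<forall>j. real (card (exp_box n (3 * r * 2 ^ j))) \<le> \<rho> j ^ 2 ^ Suc j) \<and>
    (\<forall>j. real (card (kbox (3 * r * 2 ^ j))) \<le> \<rho> j ^ 2 ^ Suc j)"
proof -
  obtain D where D: "\<And>r. real (card (exp_box n r)) \<le> (3 * (real r + 1)\<^sup>2) ^ D"
    "\<And>r. real (card (kbox r)) \<le> (3 * (real r + 1)\<^sup>2) ^ D"
    using card_exp_box_le[of n] by blast
  \<comment> \<open>Size plus one is at most \<open>3 * real r + 1\<close> times
    \<open>2 ^ j\<close>; squaring it gives \<open>4 ^ j\<close>, and \<open>a\<close> collects the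
    factors independent of \<open>j\<close>.\<close>
  define a where "a = 3 * (3 * real r + 1)\<^sup>2"
  have "1 \<le> (3 * real r + 1)\<^sup>2" by (intro one_le_power) simp
  then have a: "a \<ge> 1" unfolding a_def by linarith
  obtain \<rho> :: "nat \<Rightarrow> real" where \<rho>: "\<And>j. \<rho> j \<ge> 1" "\<rho> \<longlonglongrightarrow> 1"
    "\<And>j. \<rho> j ^ 2 ^ Suc j = (a * 4 ^ j) ^ D"
    using subexponential_root[OF a, of D] by blast
  have "(3 * (real (3 * r * 2 ^ j) + 1)\<^sup>2) ^ D \<le> (a * 4 ^ j) ^ D" for j
  proof -
    have "real (3 * r * 2 ^ j) + 1 \<le> (3 * real r + 1) * 2 ^ j" by (simp add: algebra_simps)
    then have "(real (3 * r * 2 ^ j) + 1)\<^sup>2 \<le> ((3 * real r + 1) * 2 ^ j)\<^sup>2" by (intro power_mono) auto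
    also have "\<dots> = (3 * real r + 1)\<^sup>2 * 4 ^ j"
      by (simp add: power_mult_distrib power2_eq_square flip: power_mult_distrib)
    finally have "3 * (real (3 * r * 2 ^ j) + 1)\<^sup>2 \<le> a * 4 ^ j" by (simp add: a_def)
    then show ?thesis by (intro power_mono) auto
  qed
  then have le: "(3 * (real (3 * r * 2 ^ j) + 1)\<^sup>2) ^ D \<le> \<rho> j ^ 2 ^ Suc j" for j
    by (simp only: \<rho>(3))
  show ?thesis
    by (intro exI[of _ \<rho>] conjI allI \<rho>(1,2) order_trans[OF D(1) le] order_trans[OF D(2) le])
qed

lemma power_le_cancel:
  fixes u w :: real
  assumes "u ^ 2 ^ Suc j \<le> w ^ 2 ^ Suc j" "0 \<le> w"
  shows "u \<le> w"
proof -
  have "(2::nat) ^ Suc j = Suc (2 ^ Suc j - 1)" by simp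
  then show ?thesis using assms power_le_imp_le_base[of u "2 ^ Suc j - 1" w] by metis
qed

lemma nrm_Poly_le_sup:
  assumes x: "x \<in> Poly r" and B: "\<And>\<theta>. \<theta> \<in> T \<Longrightarrow> nrm\<^bsub>\<A> \<theta>\<^esub> (\<pi> \<theta> x) \<le> B"
  shows "nrm\<^bsub>A\<^esub> x \<le> B"
proof -
  have xc: "x \<in> carrier A" using x Poly_carrier by blast
  obtain \<rho> :: "nat \<Rightarrow> real" where \<rho>: "\<And>j. \<rho> j \<ge> 1" "\<rho> \<longlonglongrightarrow> 1"
    "\<And>j. real (card (exp_box n (3 * r * 2 ^ j))) \<le> \<rho> j ^ 2 ^ Suc j"
    "\<And>j. real (card (kbox (3 * r * 2 ^ j))) \<le> \<rho> j ^ 2 ^ Suc j"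
    using box_growth[of r] by (elim exE conjE) blast
  have nn: "0 \<le> nrm\<^bsub>\<A> \<theta>\<^esub> (\<pi> \<theta> x)" if "\<theta> \<in> T" for \<theta>
    using star_algebra.nrm_nonneg[OF star_fiber[OF that]]
      star_morphism.hom_closed[OF canonical(1)[OF that] xc] by blast
  have B0: "0 \<le> B" by (rule order_trans[OF nn[OF T_nonempty] B[OF T_nonempty]])
  have "nrm\<^bsub>A\<^esub> x \<le> \<rho> j * B" for j
  proof (rule power_le_cancel[of _ j])
    have "(nrm\<^bsub>A\<^esub> x) ^ 2 ^ Suc j \<le> card (exp_box n (3 * r * 2 ^ j)) * B ^ 2 ^ Suc j"
    proof -
      have "nrm\<^bsub>\<A> \<theta>\<^esub> (\<pi> \<theta> (square_power x j)) \<le> B ^ 2 ^ Suc j" if "\<theta> \<in> T" for \<theta>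
        unfolding nrm_canonical_square_power[OF that xc] by (intro power_mono B nn that)
      from nrm_Poly_le[OF square_power_Poly[OF x] this] show ?thesis
        unfolding nrm_square_power[OF xc] .
    qed
    also have "\<dots> \<le> \<rho> j ^ 2 ^ Suc j * B ^ 2 ^ Suc j" by (intro mult_right_mono \<rho>(3)) (simp add: B0)
    finally show "(nrm\<^bsub>A\<^esub> x) ^ 2 ^ Suc j \<le> (\<rho> j * B) ^ 2 ^ Suc j" by (simp only: power_mult_distrib)
    show "0 \<le> \<rho> j * B" using B0 \<rho>(1)[of j] by simp
  qed
  moreover have "(\<lambda>j. \<rho> j * B) \<longlonglongrightarrow> 1 * B" by (intro tendsto_mult \<rho>(2) tendsto_const)
  ultimately show ?thesis by (intro LIMSEQ_le_const[where X = "\<lambda>j. \<rho> j * B"]) auto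
qed

lemma nrm_le_sup:
  assumes x: "x \<in> carrier A" and B: "\<And>\<theta>. \<theta> \<in> T \<Longrightarrow> nrm\<^bsub>\<A> \<theta>\<^esub> (\<pi> \<theta> x) \<le> B"
  shows "nrm\<^bsub>A\<^esub> x \<le> B"
proof (rule field_le_epsilon)
  fix e :: real assume e: "e > 0"
  obtain r q where q: "q \<in> Poly r" "nrm\<^bsub>A\<^esub> (q \<ominus>\<^bsub>A\<^esub> x) < e / 2" using Poly_approx[OF x half_gt_zero[OF e]] by blast
  have qc: "q \<in> carrier A" using q(1) Poly_carrier by blast
  have "nrm\<^bsub>A\<^esub> q \<le> B + e / 2"
  proof (rule nrm_Poly_le_sup[OF q(1)])
    fix \<theta> assume \<theta>: "\<theta> \<in> T"
    interpret h: star_morphism A "\<A> \<theta>" "\<pi> \<theta>" by (rule canonical(1)[OF \<theta>])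
    have "nrm\<^bsub>\<A> \<theta>\<^esub> (\<pi> \<theta> q \<ominus>\<^bsub>\<A> \<theta>\<^esub> \<pi> \<theta> x) \<le> nrm\<^bsub>A\<^esub> (q \<ominus>\<^bsub>A\<^esub> x)"
      using h.hom_nrm_le[of "q \<ominus>\<^bsub>A\<^esub> x"] qc x by (simp add: h.hom_diff)
    then show "nrm\<^bsub>\<A> \<theta>\<^esub> (\<pi> \<theta> q) \<le> B + e / 2"
      using h.B.nrm_diff_le[OF h.hom_closed[OF qc] h.hom_closed[OF x]] B[OF \<theta>] q(2) by linarith
  qed
  then show "nrm\<^bsub>A\<^esub> x \<le> B + e" using A.nrm_diff_le[OF qc x] q(2) by linarith
qed

subsection \<open>Continuity of the norm along the field\<close>

lemma continuous_coeff: "continuous_on T (\<lambda>\<theta>. coeff r c \<theta> k)"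
proof -
  have "continuous_on T (\<lambda>\<theta>. \<theta> p powi i)" if p: "p \<in> pairs n" for p and i :: int
  proof (rule continuous_on_power_int)
    show "continuous_on T (\<lambda>\<theta>. \<theta> p)"
      by (rule continuous_on_subset[OF continuous_on_product_coordinates]) simp
    have "\<theta> p \<noteq> 0" if "\<theta> \<in> T" for \<theta> using T_norm[OF that p] by auto
    then show "0 \<le> i \<or> (\<forall>\<theta>\<in>T. \<theta> p \<noteq> 0)" by blast
  qed
  then show ?thesis unfolding coeff_def character_def
    by (intro continuous_on_sum continuous_on_mult continuous_on_const continuous_on_prod)
qed

text \<open>In a fibre, the sum \<open>F j\<close> of the moduli of the coefficients of
  \<open>square_power x j\<close> is continuous in \<open>\<theta>\<close> and lies between the norm
  of the image and that norm times the number of torus words. Its root \<open>G j\<close> therefore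
  lies between the norm of the image of \<open>x\<close> and \<open>\<rho> j\<close> times that
  norm. The convergence is uniform because \<open>nrm x\<close> bounds these norms in all
  fibres.\<close>

lemma continuous_nrm_Poly:
  assumes x: "x \<in> Poly r"
  shows "continuous_on T (\<lambda>\<theta>. nrm\<^bsub>\<A> \<theta>\<^esub> (\<pi> \<theta> x))"
proof -
  have xc: "x \<in> carrier A" using x Poly_carrier by blast
  obtain \<rho> :: "nat \<Rightarrow> real" where \<rho>: "\<And>j. \<rho> j \<ge> 1" "\<rho> \<longlonglongrightarrow> 1"
    "\<And>j. real (card (exp_box n (3 * r * 2 ^ j))) \<le> \<rho> j ^ 2 ^ Suc j"
    "\<And>j. real (card (kbox (3 * r * 2 ^ j))) \<le> \<rho> j ^ 2 ^ Suc j"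
    using box_growth[of r] by (elim exE conjE) blast
  have "\<forall>j. \<exists>c. square_power x j = lin_comb A word (exp_box n (3 * r * 2 ^ j)) c"
    using square_power_Poly[OF x] unfolding Poly_def A.span_of_def[of word, OF word_carrier] by blast
  then obtain c where c: "\<And>j. square_power x j = lin_comb A word (exp_box n (3 * r * 2 ^ j)) (c j)"
    by metis
  define F where "F j \<theta> = (\<Sum>k\<in>kbox (3 * r * 2 ^ j). cmod (coeff (3 * r * 2 ^ j) (c j) \<theta> k))" for j \<theta>
  define G where "G j \<theta> = root (2 ^ Suc j) (F j \<theta>)" for j \<theta>
  have F0: "0 \<le> F j \<theta>" for j \<theta> unfolding F_def by (intro sum_nonneg) simp
  have Gp: "G j \<theta> ^ 2 ^ Suc j = F j \<theta>" "0 \<le> G j \<theta>" for j \<theta>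
    unfolding G_def using F0 by (simp_all del: power_Suc)
  have bounds: "nrm\<^bsub>\<A> \<theta>\<^esub> (\<pi> \<theta> x) \<le> G j \<theta> \<and> G j \<theta> \<le> \<rho> j * nrm\<^bsub>\<A> \<theta>\<^esub> (\<pi> \<theta> x)"
    if \<theta>: "\<theta> \<in> T" for \<theta> j
  proof
    have nn: "0 \<le> nrm\<^bsub>\<A> \<theta>\<^esub> (\<pi> \<theta> x)"
      using star_algebra.nrm_nonneg[OF star_fiber[OF that]]
        star_morphism.hom_closed[OF canonical(1)[OF that] xc] by blast
    show "nrm\<^bsub>\<A> \<theta>\<^esub> (\<pi> \<theta> x) \<le> G j \<theta>"
      by (rule power_le_cancel[of _ j])
        (use nrm_le_sum_coeff[OF \<theta>, of "3 * r * 2 ^ j" "c j"] in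
          \<open>simp_all only: Gp F_def c[symmetric] nrm_canonical_square_power[OF \<theta> xc]\<close>)
    show "G j \<theta> \<le> \<rho> j * nrm\<^bsub>\<A> \<theta>\<^esub> (\<pi> \<theta> x)"
    proof (rule power_le_cancel[of _ j])
      have "F j \<theta> \<le> card (kbox (3 * r * 2 ^ j)) * nrm\<^bsub>\<A> \<theta>\<^esub> (\<pi> \<theta> (square_power x j))"
        unfolding F_def c by (rule sum_bounded_above) (rule coeff_le_nrm[OF \<theta>])
      also have "\<dots> \<le> \<rho> j ^ 2 ^ Suc j * (nrm\<^bsub>\<A> \<theta>\<^esub> (\<pi> \<theta> x)) ^ 2 ^ Suc j"
        unfolding nrm_canonical_square_power[OF \<theta> xc] using nn by (intro mult_right_mono \<rho>(4)) simp
      finally show "G j \<theta> ^ 2 ^ Suc j \<le> (\<rho> j * nrm\<^bsub>\<A> \<theta>\<^esub> (\<pi> \<theta> x)) ^ 2 ^ Suc j"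
        by (simp only: Gp power_mult_distrib)
      show "0 \<le> \<rho> j * nrm\<^bsub>\<A> \<theta>\<^esub> (\<pi> \<theta> x)" using nn \<rho>(1)[of j] by simp
    qed
  qed
  have "uniform_limit T G (\<lambda>\<theta>. nrm\<^bsub>\<A> \<theta>\<^esub> (\<pi> \<theta> x)) sequentially"
  proof (rule uniform_limitI)
    fix e :: real assume e: "e > 0"
    have "(\<lambda>j. (\<rho> j - 1) * nrm\<^bsub>A\<^esub> x) \<longlonglongrightarrow> (1 - 1) * nrm\<^bsub>A\<^esub> x"
      by (intro tendsto_mult tendsto_diff \<rho>(2) tendsto_const)
    then have "\<forall>\<^sub>F j in sequentially. (\<rho> j - 1) * nrm\<^bsub>A\<^esub> x < e" using e by (intro order_tendstoD) simp_all
    then show "\<forall>\<^sub>F j in sequentially. \<forall>\<theta>\<in>T. dist (G j \<theta>) (nrm\<^bsub>\<A> \<theta>\<^esub> (\<pi> \<theta> x)) < e"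
    proof eventually_elim
      case (elim j)
      show ?case
      proof
        fix \<theta> assume \<theta>: "\<theta> \<in> T"
        have "(\<rho> j - 1) * nrm\<^bsub>\<A> \<theta>\<^esub> (\<pi> \<theta> x) \<le> (\<rho> j - 1) * nrm\<^bsub>A\<^esub> x"
          using \<rho>(1)[of j] by (intro mult_left_mono nrm_canonical_le[OF \<theta> xc]) simp
        then have "\<rho> j * nrm\<^bsub>\<A> \<theta>\<^esub> (\<pi> \<theta> x) - nrm\<^bsub>\<A> \<theta>\<^esub> (\<pi> \<theta> x) < e" using elim by (simp add: left_diff_distrib)
        then show "dist (G j \<theta>) (nrm\<^bsub>\<A> \<theta>\<^esub> (\<pi> \<theta> x)) < e"
          using bounds[OF \<theta>, of j] by (simp add: dist_real_def abs_less_iff)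
      qed
    qed
  qed
  moreover have "continuous_on T (G j)" for j
    unfolding G_def F_def
    by (intro continuous_on_real_root continuous_on_sum continuous_on_norm continuous_coeff)
  ultimately show ?thesis by (intro uniform_limit_theorem[where F = sequentially and f = G]) auto
qed

lemma continuous_nrm:
  assumes x: "x \<in> carrier A"
  shows "continuous_on T (\<lambda>\<theta>. nrm\<^bsub>\<A> \<theta>\<^esub> (\<pi> \<theta> x))"
proof -
  have "\<forall>j. \<exists>q. (\<exists>r. q \<in> Poly r) \<and> nrm\<^bsub>A\<^esub> (q \<ominus>\<^bsub>A\<^esub> x) < 1 / real (Suc j)"
  proof
    fix j :: nat
    show "\<exists>q. (\<exists>r. q \<in> Poly r) \<and> nrm\<^bsub>A\<^esub> (q \<ominus>\<^bsub>A\<^esub> x) < 1 / real (Suc j)"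
      using Poly_approx[OF x, of "1 / real (Suc j)"] by (metis of_nat_0_less_iff zero_less_Suc zero_less_divide_1_iff)
  qed
  then obtain q where q: "\<And>j. \<exists>r. q j \<in> Poly r" "\<And>j. nrm\<^bsub>A\<^esub> (q j \<ominus>\<^bsub>A\<^esub> x) < 1 / real (Suc j)" by metis
  have qc: "q j \<in> carrier A" for j using q(1)[of j] Poly_carrier by blast
  have "uniform_limit T (\<lambda>j \<theta>. nrm\<^bsub>\<A> \<theta>\<^esub> (\<pi> \<theta> (q j))) (\<lambda>\<theta>. nrm\<^bsub>\<A> \<theta>\<^esub> (\<pi> \<theta> x)) sequentially"
  proof (rule uniform_limitI)
    fix e :: real assume e: "e > 0"
    have "\<forall>\<^sub>F j in sequentially. 1 / real (Suc j) < e"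
      using LIMSEQ_Suc[OF lim_1_over_n[where 'a=real]] e by (intro order_tendstoD)
    then show "\<forall>\<^sub>F j in sequentially. \<forall>\<theta>\<in>T. dist (nrm\<^bsub>\<A> \<theta>\<^esub> (\<pi> \<theta> (q j))) (nrm\<^bsub>\<A> \<theta>\<^esub> (\<pi> \<theta> x)) < e"
    proof eventually_elim
      case (elim j)
      show ?case
      proof
        fix \<theta> assume \<theta>: "\<theta> \<in> T"
        interpret h: star_morphism A "\<A> \<theta>" "\<pi> \<theta>" by (rule canonical(1)[OF \<theta>])
        have "nrm\<^bsub>\<A> \<theta>\<^esub> (\<pi> \<theta> (q j) \<ominus>\<^bsub>\<A> \<theta>\<^esub> \<pi> \<theta> x) \<le> nrm\<^bsub>A\<^esub> (q j \<ominus>\<^bsub>A\<^esub> x)"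
          using h.hom_nrm_le[of "q j \<ominus>\<^bsub>A\<^esub> x"] qc x by (simp add: h.hom_diff)
        then show "dist (nrm\<^bsub>\<A> \<theta>\<^esub> (\<pi> \<theta> (q j))) (nrm\<^bsub>\<A> \<theta>\<^esub> (\<pi> \<theta> x)) < e"
          using h.B.nrm_diff_le[OF h.hom_closed[OF qc] h.hom_closed[OF x], of j] q(2)[of j] elim
          unfolding dist_real_def by linarith
      qed
    qed
  qed
  moreover have "continuous_on T (\<lambda>\<theta>. nrm\<^bsub>\<A> \<theta>\<^esub> (\<pi> \<theta> (q j)))" for j
    using q(1)[of j] continuous_nrm_Poly by blast
  ultimately show ?thesis by (intro uniform_limit_theorem[where F = sequentially and f = "\<lambda>j \<theta>. nrm\<^bsub>\<A> \<theta>\<^esub> (\<pi> \<theta> (q j))"]) auto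
qed

subsection \<open>Uniform limits and central functions\<close>

text \<open>By \<open>nrm_le_sup\<close> an estimate in all fibres is an estimate in
  \<open>A\<close>, so approximants that are uniformly Cauchy over the fibres converge in
  \<open>A\<close>; contractivity identifies the image of the limit.\<close>

lemma lift_uniform_limit:
  assumes s: "\<And>\<theta>. \<theta> \<in> T \<Longrightarrow> s \<theta> \<in> carrier (\<A> \<theta>)" and a: "\<And>j. a j \<in> carrier A"
    and approx: "\<And>j \<theta>. \<theta> \<in> T \<Longrightarrow> nrm\<^bsub>\<A> \<theta>\<^esub> (\<pi> \<theta> (a j) \<ominus>\<^bsub>\<A> \<theta>\<^esub> s \<theta>) \<le> (1 / 2) ^ j"
  shows "\<exists>z\<in>carrier A. \<forall>\<theta>\<in>T. \<pi> \<theta> z = s \<theta>"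
proof -
  have step: "nrm\<^bsub>A\<^esub> (a (Suc j) \<ominus>\<^bsub>A\<^esub> a j) \<le> 2 * (1 / 2) ^ j" for j
  proof (rule nrm_le_sup)
    fix \<theta> assume \<theta>: "\<theta> \<in> T"
    interpret h: star_morphism A "\<A> \<theta>" "\<pi> \<theta>" by (rule canonical(1)[OF \<theta>])
    have "nrm\<^bsub>\<A> \<theta>\<^esub> (\<pi> \<theta> (a (Suc j)) \<ominus>\<^bsub>\<A> \<theta>\<^esub> \<pi> \<theta> (a j)) \<le>
        nrm\<^bsub>\<A> \<theta>\<^esub> (\<pi> \<theta> (a (Suc j)) \<ominus>\<^bsub>\<A> \<theta>\<^esub> s \<theta>) + nrm\<^bsub>\<A> \<theta>\<^esub> (s \<theta> \<ominus>\<^bsub>\<A> \<theta>\<^esub> \<pi> \<theta> (a j))"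
      by (rule h.B.nrm_triangle_middle) (use a s[OF \<theta>] in auto)
    also have "nrm\<^bsub>\<A> \<theta>\<^esub> (s \<theta> \<ominus>\<^bsub>\<A> \<theta>\<^esub> \<pi> \<theta> (a j)) = nrm\<^bsub>\<A> \<theta>\<^esub> (\<pi> \<theta> (a j) \<ominus>\<^bsub>\<A> \<theta>\<^esub> s \<theta>)"
      by (rule h.B.nrm_minus_commute) (use a s[OF \<theta>] in auto)
    finally have "nrm\<^bsub>\<A> \<theta>\<^esub> (\<pi> \<theta> (a (Suc j)) \<ominus>\<^bsub>\<A> \<theta>\<^esub> \<pi> \<theta> (a j)) \<le> (1 / 2) ^ Suc j + (1 / 2) ^ j"
      using approx[OF \<theta>, of "Suc j"] approx[OF \<theta>, of j] by linarith
    also have "\<dots> \<le> 2 * (1 / 2) ^ j" by simp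
    finally show "nrm\<^bsub>\<A> \<theta>\<^esub> (\<pi> \<theta> (a (Suc j) \<ominus>\<^bsub>A\<^esub> a j)) \<le> 2 * (1 / 2) ^ j"
      using a by (simp add: h.hom_diff)
  qed (use a in simp)
  obtain z where z: "A.tends a z" by (rule A.geometric_tends[OF a step]) auto
  show ?thesis
  proof (intro bexI[of _ z] ballI)
    show "z \<in> carrier A" by (rule A.tends_carrier(1)[OF z])
    fix \<theta> assume \<theta>: "\<theta> \<in> T"
    interpret h: star_morphism A "\<A> \<theta>" "\<pi> \<theta>" by (rule canonical(1)[OF \<theta>])
    have "h.B.tends (\<lambda>j. \<pi> \<theta> (a j)) (s \<theta>)"
      by (rule h.B.tendsI[where f = "\<lambda>j. (1 / 2) ^ j"])
        (use a s[OF \<theta>] approx[OF \<theta>] in \<open>auto intro: LIMSEQ_realpow_zero\<close>)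
    then show "\<pi> \<theta> z = s \<theta>" by (rule h.B.tends_unique[OF h.hom_tends[OF z]])
  qed
qed

text \<open>An element of \<open>A\<close> that acts as the scalar \<open>f \<theta>\<close> in each
  fibre. Real functions are enough: truncations and partitions of unity are real, and the
  approximation theorem is the one for real functions.\<close>

definition central :: "((nat \<times> nat \<Rightarrow> complex) \<Rightarrow> real) \<Rightarrow> 'a \<Rightarrow> bool" where
  "central f z \<longleftrightarrow> z \<in> carrier A \<and>
     (\<forall>\<theta>\<in>T. \<pi> \<theta> z = of_real (f \<theta>) \<odot>\<^bsub>\<A> \<theta>\<^esub> \<one>\<^bsub>\<A> \<theta>\<^esub>)"

lemma central_const: "central (\<lambda>_. c) (of_real c \<odot>\<^bsub>A\<^esub> \<one>\<^bsub>A\<^esub>)"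
  unfolding central_def
proof (intro conjI ballI)
  fix \<theta> assume \<theta>: "\<theta> \<in> T"
  interpret h: star_morphism A "\<A> \<theta>" "\<pi> \<theta>" by (rule canonical(1)[OF \<theta>])
  show "\<pi> \<theta> (of_real c \<odot>\<^bsub>A\<^esub> \<one>\<^bsub>A\<^esub>) = of_real c \<odot>\<^bsub>\<A> \<theta>\<^esub> \<one>\<^bsub>\<A> \<theta>\<^esub>" by (simp add: h.hom_smult)
qed simp

lemma central_add:
  assumes f: "central f z" and g: "central g w"
  shows "central (\<lambda>\<theta>. f \<theta> + g \<theta>) (z \<oplus>\<^bsub>A\<^esub> w)"
  unfolding central_def
proof (intro conjI ballI)
  fix \<theta> assume \<theta>: "\<theta> \<in> T"
  interpret h: star_morphism A "\<A> \<theta>" "\<pi> \<theta>" by (rule canonical(1)[OF \<theta>])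
  show "\<pi> \<theta> (z \<oplus>\<^bsub>A\<^esub> w) = of_real (f \<theta> + g \<theta>) \<odot>\<^bsub>\<A> \<theta>\<^esub> \<one>\<^bsub>\<A> \<theta>\<^esub>"
    using f g \<theta> unfolding central_def by (simp add: h.hom_add h.B.smult_add_left)
qed (use f g in \<open>simp add: central_def\<close>)

lemma central_mult:
  assumes f: "central f z" and g: "central g w"
  shows "central (\<lambda>\<theta>. f \<theta> * g \<theta>) (z \<otimes>\<^bsub>A\<^esub> w)"
  unfolding central_def
proof (intro conjI ballI)
  fix \<theta> assume \<theta>: "\<theta> \<in> T"
  interpret h: star_morphism A "\<A> \<theta>" "\<pi> \<theta>" by (rule canonical(1)[OF \<theta>])
  show "\<pi> \<theta> (z \<otimes>\<^bsub>A\<^esub> w) = of_real (f \<theta> * g \<theta>) \<odot>\<^bsub>\<A> \<theta>\<^esub> \<one>\<^bsub>\<A> \<theta>\<^esub>"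
    using f g \<theta> unfolding central_def by (simp add: h.hom_mult h.B.smult_mult_left h.B.smult_smult)
qed (use f g in \<open>simp add: central_def\<close>)

lemma central_Re_Im:
  assumes p: "p \<in> pairs n"
  shows "central (\<lambda>\<theta>. Re (\<theta> p)) ((1 / 2) \<odot>\<^bsub>A\<^esub> (V p \<oplus>\<^bsub>A\<^esub> adj\<^bsub>A\<^esub> (V p)))" (is "central _ ?z")
    "central (\<lambda>\<theta>. Im (\<theta> p)) ((- \<i> / 2) \<odot>\<^bsub>A\<^esub> (V p \<ominus>\<^bsub>A\<^esub> adj\<^bsub>A\<^esub> (V p)))" (is "central _ ?w")
proof -
  have V: "V p \<in> carrier A" by (rule A.unitary_closed[OF V_unitary[OF p]])
  have "\<pi> \<theta> ?z = of_real (Re (\<theta> p)) \<odot>\<^bsub>\<A> \<theta>\<^esub> \<one>\<^bsub>\<A> \<theta>\<^esub> \<and>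
      \<pi> \<theta> ?w = of_real (Im (\<theta> p)) \<odot>\<^bsub>\<A> \<theta>\<^esub> \<one>\<^bsub>\<A> \<theta>\<^esub>" if \<theta>: "\<theta> \<in> T" for \<theta>
  proof -
    interpret h: star_morphism A "\<A> \<theta>" "\<pi> \<theta>" by (rule canonical(1)[OF \<theta>])
    have "1 / 2 * (\<theta> p + cnj (\<theta> p)) = of_real (Re (\<theta> p))"
      "- \<i> / 2 * (\<theta> p - cnj (\<theta> p)) = of_real (Im (\<theta> p))" by (simp_all add: complex_eq_iff)
    moreover have "\<pi> \<theta> (V p) = \<theta> p \<odot>\<^bsub>\<A> \<theta>\<^esub> \<one>\<^bsub>\<A> \<theta>\<^esub>" by (rule canonical(3)[OF \<theta> p])
    ultimately show ?thesis
      using V by (simp add: h.hom_smult h.hom_add h.hom_diff h.hom_adj h.B.adj_smult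
          h.B.smult_add_left[symmetric] h.B.smult_diff_left[symmetric] h.B.smult_smult)
  qed
  then show "central (\<lambda>\<theta>. Re (\<theta> p)) ?z" "central (\<lambda>\<theta>. Im (\<theta> p)) ?w"
    using V by (simp_all add: central_def)
qed

text \<open>The functions realized form an algebra with constants. It separates points, since the
  real and imaginary parts of the coordinates come from \<open>V p\<close> and its adjoint;
  approximants with error \<open>(1 / 2) ^ j\<close> then lift to a limit.\<close>

lemma central_exists:
  assumes f: "continuous_on T f"
  obtains z where "central f z"
proof -
  have approx: "\<exists>g. (continuous_on T g \<and> (\<exists>z. central g z)) \<and> (\<forall>\<theta>\<in>T. \<bar>f \<theta> - g \<theta>\<bar> < e)"
    if "e > 0" for e
  proof (rule Stone_Weierstrass_HOL[OF compact_torus _ _ _ _ _ f that])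
    show "continuous_on T (\<lambda>_. c) \<and> (\<exists>z. central (\<lambda>_. c) z)" for c using central_const by auto
    show "continuous_on T g" if "continuous_on T g \<and> (\<exists>z. central g z)" for g using that by simp
    show "continuous_on T (\<lambda>\<theta>. g \<theta> + h \<theta>) \<and> (\<exists>z. central (\<lambda>\<theta>. g \<theta> + h \<theta>) z)"
      "continuous_on T (\<lambda>\<theta>. g \<theta> * h \<theta>) \<and> (\<exists>z. central (\<lambda>\<theta>. g \<theta> * h \<theta>) z)"
      if "(continuous_on T g \<and> (\<exists>z. central g z)) \<and> continuous_on T h \<and> (\<exists>z. central h z)" for g h
      using that central_add central_mult by (blast intro: continuous_on_add continuous_on_mult)+
    show "\<exists>g. (continuous_on T g \<and> (\<exists>z. central g z)) \<and> g \<theta> \<noteq> g \<theta>'"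
      if t: "\<theta> \<in> T \<and> \<theta>' \<in> T \<and> \<theta> \<noteq> \<theta>'" for \<theta> \<theta>'
    proof -
      obtain p where p: "p \<in> pairs n" "\<theta> p \<noteq> \<theta>' p" using t PiE_ext[of \<theta> "pairs n" _ \<theta>'] by blast
      have c: "continuous_on T (\<lambda>\<theta>. \<theta> p)"
        by (rule continuous_on_subset[OF continuous_on_product_coordinates]) simp
      show ?thesis
      proof (cases "Re (\<theta> p) = Re (\<theta>' p)")
        case True
        then have "Im (\<theta> p) \<noteq> Im (\<theta>' p)" using p by (simp add: complex_eq_iff)
        then show ?thesis
          using central_Re_Im(2)[OF p(1)] c
          by (intro exI[of _ "\<lambda>\<theta>. Im (\<theta> p)"]) (auto intro: continuous_on_Im)
      next
        case False
        then show ?thesis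
          using central_Re_Im(1)[OF p(1)] c
          by (intro exI[of _ "\<lambda>\<theta>. Re (\<theta> p)"]) (auto intro: continuous_on_Re)
      qed
    qed
  qed
  have "\<forall>j. \<exists>g z. central g z \<and> (\<forall>\<theta>\<in>T. \<bar>f \<theta> - g \<theta>\<bar> < (1 / 2) ^ j)"
    using approx[of "(1 / 2) ^ _"] by (meson half_gt_zero_iff zero_less_one zero_less_power)
  then obtain g a where ga: "\<And>j. central (g j) (a j)" "\<And>j \<theta>. \<theta> \<in> T \<Longrightarrow> \<bar>f \<theta> - g j \<theta>\<bar> < (1 / 2) ^ j" by metis
  have "\<exists>z\<in>carrier A. \<forall>\<theta>\<in>T. \<pi> \<theta> z = of_real (f \<theta>) \<odot>\<^bsub>\<A> \<theta>\<^esub> \<one>\<^bsub>\<A> \<theta>\<^esub>"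
  proof (rule lift_uniform_limit)
    show "of_real (f \<theta>) \<odot>\<^bsub>\<A> \<theta>\<^esub> \<one>\<^bsub>\<A> \<theta>\<^esub> \<in> carrier (\<A> \<theta>)" if "\<theta> \<in> T" for \<theta>
    proof -
      interpret B: star_algebra "\<A> \<theta>" by (rule star_fiber[OF that])
      show ?thesis by simp
    qed
    show "a j \<in> carrier A" for j using ga(1)[of j] by (simp add: central_def)
    show "nrm\<^bsub>\<A> \<theta>\<^esub> (\<pi> \<theta> (a j) \<ominus>\<^bsub>\<A> \<theta>\<^esub> of_real (f \<theta>) \<odot>\<^bsub>\<A> \<theta>\<^esub> \<one>\<^bsub>\<A> \<theta>\<^esub>) \<le> (1 / 2) ^ j"
      if \<theta>: "\<theta> \<in> T" for j \<theta>
    proof -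
      interpret B: star_algebra "\<A> \<theta>" by (rule star_fiber[OF \<theta>])
      have "\<pi> \<theta> (a j) = of_real (g j \<theta>) \<odot>\<^bsub>\<A> \<theta>\<^esub> \<one>\<^bsub>\<A> \<theta>\<^esub>" using ga(1)[of j] \<theta> by (simp add: central_def)
      then have "nrm\<^bsub>\<A> \<theta>\<^esub> (\<pi> \<theta> (a j) \<ominus>\<^bsub>\<A> \<theta>\<^esub> of_real (f \<theta>) \<odot>\<^bsub>\<A> \<theta>\<^esub> \<one>\<^bsub>\<A> \<theta>\<^esub>) =
          cmod (of_real (g j \<theta> - f \<theta>)) * nrm\<^bsub>\<A> \<theta>\<^esub> \<one>\<^bsub>\<A> \<theta>\<^esub>"
        by (simp add: B.smult_diff_left[symmetric] B.nrm_smult flip: of_real_diff)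
      also have "\<dots> \<le> \<bar>g j \<theta> - f \<theta>\<bar> * 1"
        unfolding norm_of_real by (intro mult_left_mono B.nrm_one_le) simp
      finally show ?thesis using ga(2)[OF \<theta>, of j] by (simp add: abs_minus_commute)
    qed
  qed
  then show thesis using that unfolding central_def by blast
qed

end

context nilpotent_group_field
begin

lemma central_action:
  assumes "central f z" "a \<in> carrier A" "\<theta> \<in> T"
  shows "\<pi> \<theta> (z \<otimes>\<^bsub>A\<^esub> a) = of_real (f \<theta>) \<odot>\<^bsub>\<A> \<theta>\<^esub> \<pi> \<theta> a"
proof -
  interpret h: star_morphism A "\<A> \<theta>" "\<pi> \<theta>" by (rule canonical(1)[OF assms(3)])
  show ?thesis using assms by (simp add: central_def h.hom_mult h.B.smult_mult_left)
qed

subsection \<open>Fullness\<close>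

lemma canonical_dense:
  assumes \<theta>: "\<theta> \<in> T" and b: "b \<in> carrier (\<A> \<theta>)" and e: "e > 0"
  shows "\<exists>a\<in>carrier A. nrm\<^bsub>\<A> \<theta>\<^esub> (\<pi> \<theta> a \<ominus>\<^bsub>\<A> \<theta>\<^esub> b) < e"
proof -
  interpret h: star_morphism A "\<A> \<theta>" "\<pi> \<theta>" by (rule canonical(1)[OF \<theta>])
  let ?Q = "\<pi> \<theta> ` carrier A"
  have Q: "?Q \<subseteq> carrier (\<A> \<theta>)" by auto
  have "cstar_subalgebra (h.B.cl ?Q) (\<A> \<theta>)"
  proof (rule h.B.cl_subalgebra[OF Q])
    show "\<one>\<^bsub>\<A> \<theta>\<^esub> \<in> ?Q" by (rule image_eqI[of _ _ "\<one>\<^bsub>A\<^esub>"]) simp_all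
    fix x assume "x \<in> ?Q"
    then obtain a where a: "a \<in> carrier A" "x = \<pi> \<theta> a" by blast
    show "adj\<^bsub>\<A> \<theta>\<^esub> x \<in> ?Q" by (rule image_eqI[of _ _ "adj\<^bsub>A\<^esub> a"]) (use a in \<open>simp_all add: h.hom_adj\<close>)
    have "c \<odot>\<^bsub>\<A> \<theta>\<^esub> x \<in> ?Q" for c
      by (rule image_eqI[of _ _ "c \<odot>\<^bsub>A\<^esub> a"]) (use a in \<open>simp_all add: h.hom_smult\<close>)
    then show "c \<odot>\<^bsub>\<A> \<theta>\<^esub> x \<in> h.B.cl ?Q" for c using h.B.cl_superset[OF Q] by blast
    fix y assume "y \<in> ?Q"
    then obtain a' where a': "a' \<in> carrier A" "y = \<pi> \<theta> a'" by blast
    show "x \<oplus>\<^bsub>\<A> \<theta>\<^esub> y \<in> ?Q"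
      by (rule image_eqI[of _ _ "a \<oplus>\<^bsub>A\<^esub> a'"]) (use a a' in \<open>simp_all add: h.hom_add\<close>)
    show "x \<otimes>\<^bsub>\<A> \<theta>\<^esub> y \<in> ?Q"
      by (rule image_eqI[of _ _ "a \<otimes>\<^bsub>A\<^esub> a'"]) (use a a' in \<open>simp_all add: h.hom_mult\<close>)
  qed
  moreover have "W \<theta> ` {1..n} \<subseteq> h.B.cl ?Q"
  proof
    fix w assume "w \<in> W \<theta> ` {1..n}"
    then obtain i where i: "i \<in> {1..n}" "w = W \<theta> i" by blast
    have "w \<in> ?Q"
      by (rule image_eqI[of _ _ "U i"]) (use i canonical(2)[OF \<theta>] A.unitary_closed[OF U_unitary] in simp_all)
    then show "w \<in> h.B.cl ?Q" using h.B.cl_superset[OF Q] by blast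
  qed
  ultimately have "h.B.cl ?Q = carrier (\<A> \<theta>)"
    using fiber[OF \<theta>] unfolding is_nc_torus_def cstar_generated_def by blast
  then show ?thesis using b e unfolding h.B.cl_def by blast
qed

text \<open>
  Multiplying by the central function \<open>c / max c \<parallel>\<pi>\<^sub>s d\<parallel>\<close> brings the norm of \<open>d\<close> down to \<open>c\<close>
  without changing \<open>d\<close> in the fibres where its norm is at most \<open>c\<close> already.
\<close>

lemma central_truncation:
  assumes \<theta>: "\<theta> \<in> T" and d: "d \<in> carrier A" and c: "c > 0" "nrm\<^bsub>\<A> \<theta>\<^esub> (\<pi> \<theta> d) \<le> c"
  shows "\<exists>e\<in>carrier A. nrm\<^bsub>A\<^esub> e \<le> c \<and> \<pi> \<theta> e = \<pi> \<theta> d"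
proof -
  define f where "f s = c / max c (nrm\<^bsub>\<A> s\<^esub> (\<pi> s d))" for s
  have pos: "0 < max c (nrm\<^bsub>\<A> s\<^esub> (\<pi> s d))" for s using c(1) by (simp add: less_max_iff_disj)
  have ne: "max c (nrm\<^bsub>\<A> s\<^esub> (\<pi> s d)) \<noteq> 0" for s using less_imp_neq[OF pos[of s]] by (rule not_sym)
  have "continuous_on T f"
    unfolding f_def
    by (intro continuous_on_divide continuous_on_const continuous_on_max continuous_nrm[OF d] ballI ne)
  then obtain z where z: "central f z" using central_exists by blast
  have zc: "z \<in> carrier A" using z by (simp add: central_def)
  have "nrm\<^bsub>A\<^esub> (z \<otimes>\<^bsub>A\<^esub> d) \<le> c"
  proof (rule nrm_le_sup)
    fix s assume s: "s \<in> T"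
    interpret h: star_morphism A "\<A> s" "\<pi> s" by (rule canonical(1)[OF s])
    have f0: "0 \<le> f s" unfolding f_def using c(1) pos[of s] by simp
    have "f s * nrm\<^bsub>\<A> s\<^esub> (\<pi> s d) \<le> f s * max c (nrm\<^bsub>\<A> s\<^esub> (\<pi> s d))"
      using f0 by (intro mult_left_mono) auto
    also have "\<dots> = c" unfolding f_def using pos[of s] by simp
    finally show "nrm\<^bsub>\<A> s\<^esub> (\<pi> s (z \<otimes>\<^bsub>A\<^esub> d)) \<le> c"
      using f0 d by (simp add: central_action[OF z d s] h.B.nrm_smult)
  qed (use zc d in simp)
  moreover have "\<pi> \<theta> (z \<otimes>\<^bsub>A\<^esub> d) = \<pi> \<theta> d"
  proof -
    interpret h: star_morphism A "\<A> \<theta>" "\<pi> \<theta>" by (rule canonical(1)[OF \<theta>])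
    have "f \<theta> = 1" unfolding f_def using c by (simp add: max_absorb1)
    then show ?thesis using d by (simp add: central_action[OF z d \<theta>])
  qed
  ultimately show ?thesis using zc d by blast
qed

text \<open>Differences of successive approximate preimages are small in the fibre but possibly
  large in \<open>A\<close>. Truncation replaces each by an element with the same image whose norm
  in \<open>A\<close> is small too; the corrected partial sums \<open>S\<close> keep the images of
  the \<open>a j\<close> and converge in \<open>A\<close>.\<close>

lemma canonical_surj:
  assumes \<theta>: "\<theta> \<in> T" and b: "b \<in> carrier (\<A> \<theta>)"
  shows "\<exists>a\<in>carrier A. \<pi> \<theta> a = b"
proof -
  interpret h: star_morphism A "\<A> \<theta>" "\<pi> \<theta>" by (rule canonical(1)[OF \<theta>])
  have "\<forall>j::nat. \<exists>a. a \<in> carrier A \<and> nrm\<^bsub>\<A> \<theta>\<^esub> (\<pi> \<theta> a \<ominus>\<^bsub>\<A> \<theta>\<^esub> b) < (1 / 2) ^ j"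
    using canonical_dense[OF \<theta> b] by (simp add: Bex_def)
  then obtain a where a: "\<And>j. a j \<in> carrier A"
    "\<And>j::nat. nrm\<^bsub>\<A> \<theta>\<^esub> (\<pi> \<theta> (a j) \<ominus>\<^bsub>\<A> \<theta>\<^esub> b) < (1 / 2) ^ j" by metis
  have d: "nrm\<^bsub>\<A> \<theta>\<^esub> (\<pi> \<theta> (a (Suc j) \<ominus>\<^bsub>A\<^esub> a j)) \<le> 2 * (1 / 2) ^ j" for j
  proof -
    have "nrm\<^bsub>\<A> \<theta>\<^esub> (\<pi> \<theta> (a (Suc j)) \<ominus>\<^bsub>\<A> \<theta>\<^esub> \<pi> \<theta> (a j)) \<le>
        nrm\<^bsub>\<A> \<theta>\<^esub> (\<pi> \<theta> (a (Suc j)) \<ominus>\<^bsub>\<A> \<theta>\<^esub> b) + nrm\<^bsub>\<A> \<theta>\<^esub> (b \<ominus>\<^bsub>\<A> \<theta>\<^esub> \<pi> \<theta> (a j))"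
      by (rule h.B.nrm_triangle_middle) (use a b in auto)
    also have "nrm\<^bsub>\<A> \<theta>\<^esub> (b \<ominus>\<^bsub>\<A> \<theta>\<^esub> \<pi> \<theta> (a j)) = nrm\<^bsub>\<A> \<theta>\<^esub> (\<pi> \<theta> (a j) \<ominus>\<^bsub>\<A> \<theta>\<^esub> b)"
      by (rule h.B.nrm_minus_commute) (use a b in auto)
    finally have "nrm\<^bsub>\<A> \<theta>\<^esub> (\<pi> \<theta> (a (Suc j)) \<ominus>\<^bsub>\<A> \<theta>\<^esub> \<pi> \<theta> (a j)) \<le> (1 / 2) ^ Suc j + (1 / 2) ^ j"
      using a(2)[of "Suc j"] a(2)[of j] by linarith
    also have "\<dots> \<le> 2 * (1 / 2) ^ j" by simp
    finally show ?thesis using a by (simp add: h.hom_diff)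
  qed
  have "\<forall>j. \<exists>e. e \<in> carrier A \<and> nrm\<^bsub>A\<^esub> e \<le> 2 * (1 / 2) ^ j \<and> \<pi> \<theta> e = \<pi> \<theta> (a (Suc j) \<ominus>\<^bsub>A\<^esub> a j)"
    using central_truncation[OF \<theta> _ _ d] a by (simp add: Bex_def)
  then obtain e where e: "\<And>j. e j \<in> carrier A" "\<And>j. nrm\<^bsub>A\<^esub> (e j) \<le> 2 * (1 / 2) ^ j"
    "\<And>j. \<pi> \<theta> (e j) = \<pi> \<theta> (a (Suc j) \<ominus>\<^bsub>A\<^esub> a j)" by metis
  define S where "S = rec_nat (a 0) (\<lambda>j z. z \<oplus>\<^bsub>A\<^esub> e j)"
  have S: "S 0 = a 0" "\<And>j. S (Suc j) = S j \<oplus>\<^bsub>A\<^esub> e j" by (simp_all add: S_def)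
  have Sc: "S j \<in> carrier A" for j by (induction j) (simp_all add: S a e)
  have S\<pi>: "\<pi> \<theta> (S j) = \<pi> \<theta> (a j)" for j
  proof (induction j)
    case (Suc j)
    have "\<pi> \<theta> (S (Suc j)) = \<pi> \<theta> (a j) \<oplus>\<^bsub>\<A> \<theta>\<^esub> (\<pi> \<theta> (a (Suc j)) \<ominus>\<^bsub>\<A> \<theta>\<^esub> \<pi> \<theta> (a j))"
      using Suc Sc e a by (simp add: S h.hom_add h.hom_diff)
    also have "\<dots> = \<pi> \<theta> (a (Suc j))"
      using a h.B.a_lcomm[of "\<pi> \<theta> (a j)" "\<pi> \<theta> (a (Suc j))" "\<ominus>\<^bsub>\<A> \<theta>\<^esub> (\<pi> \<theta> (a j))"]
      by (simp add: h.B.minus_eq h.B.r_neg)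
    finally show ?case .
  qed (simp add: S)
  have step: "nrm\<^bsub>A\<^esub> (S (Suc j) \<ominus>\<^bsub>A\<^esub> S j) \<le> 2 * (1 / 2) ^ j" for j
  proof -
    have "S (Suc j) \<ominus>\<^bsub>A\<^esub> S j = e j"
      using Sc e(1) A.a_lcomm[of "S j" "e j" "\<ominus>\<^bsub>A\<^esub> (S j)"] by (simp add: S A.minus_eq A.a_assoc A.r_neg)
    then show ?thesis using e(2)[of j] by simp
  qed
  obtain l where l: "A.tends S l" by (rule A.geometric_tends[OF Sc step]) auto
  have "h.B.tends (\<lambda>j. \<pi> \<theta> (S j)) b"
    by (rule h.B.tendsI[where f = "\<lambda>j. (1 / 2) ^ j"])
      (use a b Sc less_imp_le[OF a(2)] in \<open>auto simp: S\<pi> intro: LIMSEQ_realpow_zero\<close>)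
  then have "\<pi> \<theta> l = b" by (rule h.B.tends_unique[OF h.hom_tends[OF l]])
  then show ?thesis using A.tends_carrier(1)[OF l] by blast
qed

subsection \<open>Sections that are locally approximable\<close>

text \<open>The total weight is kept as a parameter because subfamilies of a partition of unity do
  not sum to 1; this is what lets the induction on \<open>D\<close> run. Where a weight vanishes its
  summand contributes nothing, so the approximants need to be good only on the supports.\<close>

lemma weighted_approximation:
  assumes x: "\<And>s. s \<in> T \<Longrightarrow> x s \<in> carrier (\<A> s)" and D: "finite D"
    and g: "\<And>t. t \<in> D \<Longrightarrow> continuous_on T (g t)" "\<And>t s. \<lbrakk>t \<in> D; s \<in> T\<rbrakk> \<Longrightarrow> 0 \<le> g t s"
    and a: "\<And>t. t \<in> D \<Longrightarrow> a t \<in> carrier A"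
    and near: "\<And>t s. \<lbrakk>t \<in> D; s \<in> T; g t s \<noteq> 0\<rbrakk> \<Longrightarrow> nrm\<^bsub>\<A> s\<^esub> (\<pi> s (a t) \<ominus>\<^bsub>\<A> s\<^esub> x s) \<le> e"
  shows "\<exists>y\<in>carrier A. \<forall>s\<in>T.
    nrm\<^bsub>\<A> s\<^esub> (\<pi> s y \<ominus>\<^bsub>\<A> s\<^esub> of_real (\<Sum>t\<in>D. g t s) \<odot>\<^bsub>\<A> s\<^esub> x s) \<le> (\<Sum>t\<in>D. g t s) * e"
  using D g a near
proof (induction D rule: finite_induct)
  case empty
  have "nrm\<^bsub>\<A> s\<^esub> (\<pi> s \<zero>\<^bsub>A\<^esub> \<ominus>\<^bsub>\<A> s\<^esub> 0 \<odot>\<^bsub>\<A> s\<^esub> x s) = 0" if s: "s \<in> T" for s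
  proof -
    interpret h: star_morphism A "\<A> s" "\<pi> s" by (rule canonical(1)[OF s])
    show ?thesis using x[OF s] by (simp add: h.B.minus_eq)
  qed
  then show ?case by (intro bexI[of _ "\<zero>\<^bsub>A\<^esub>"]) simp_all
next
  case (insert t D)
  have "\<exists>y\<in>carrier A. \<forall>s\<in>T.
    nrm\<^bsub>\<A> s\<^esub> (\<pi> s y \<ominus>\<^bsub>\<A> s\<^esub> of_real (\<Sum>t\<in>D. g t s) \<odot>\<^bsub>\<A> s\<^esub> x s) \<le> (\<Sum>t\<in>D. g t s) * e"
    by (rule insert.IH) (use insert.prems in auto)
  then obtain y where y: "y \<in> carrier A" "\<And>s. s \<in> T \<Longrightarrow>
    nrm\<^bsub>\<A> s\<^esub> (\<pi> s y \<ominus>\<^bsub>\<A> s\<^esub> of_real (\<Sum>t\<in>D. g t s) \<odot>\<^bsub>\<A> s\<^esub> x s) \<le> (\<Sum>t\<in>D. g t s) * e" by blast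
  have "continuous_on T (g t)" by (rule insert.prems(1)) simp
  then obtain z where z: "central (g t) z" using central_exists by blast
  have zc: "z \<in> carrier A" using z by (simp add: central_def)
  have at: "a t \<in> carrier A" using insert.prems(3) by simp
  show ?case
  proof (intro bexI[of _ "z \<otimes>\<^bsub>A\<^esub> a t \<oplus>\<^bsub>A\<^esub> y"] ballI)
    fix s assume s: "s \<in> T"
    interpret h: star_morphism A "\<A> s" "\<pi> s" by (rule canonical(1)[OF s])
    let ?G = "\<Sum>t\<in>D. g t s"
    note c = h.hom_closed[OF y(1)] h.hom_closed[OF at] x[OF s]
    have g0: "0 \<le> g t s" using insert.prems(2)[of t s] s by simp
    have sum: "(\<Sum>t\<in>insert t D. g t s) = g t s + ?G" using insert.hyps by simp
    have "\<pi> s (z \<otimes>\<^bsub>A\<^esub> a t \<oplus>\<^bsub>A\<^esub> y) \<ominus>\<^bsub>\<A> s\<^esub> of_real (g t s + ?G) \<odot>\<^bsub>\<A> s\<^esub> x s =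
        of_real (g t s) \<odot>\<^bsub>\<A> s\<^esub> (\<pi> s (a t) \<ominus>\<^bsub>\<A> s\<^esub> x s) \<oplus>\<^bsub>\<A> s\<^esub>
        (\<pi> s y \<ominus>\<^bsub>\<A> s\<^esub> of_real ?G \<odot>\<^bsub>\<A> s\<^esub> x s)"
      using c zc at y(1)
      by (simp add: h.hom_add central_action[OF z at s] h.B.smult_add_left h.B.smult_add_right
          h.B.smult_a_inv h.B.minus_eq h.B.minus_add h.B.a_ac del: of_real_sum)
    then have "nrm\<^bsub>\<A> s\<^esub> (\<pi> s (z \<otimes>\<^bsub>A\<^esub> a t \<oplus>\<^bsub>A\<^esub> y) \<ominus>\<^bsub>\<A> s\<^esub> of_real (g t s + ?G) \<odot>\<^bsub>\<A> s\<^esub> x s) \<le>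
        nrm\<^bsub>\<A> s\<^esub> (of_real (g t s) \<odot>\<^bsub>\<A> s\<^esub> (\<pi> s (a t) \<ominus>\<^bsub>\<A> s\<^esub> x s)) +
        nrm\<^bsub>\<A> s\<^esub> (\<pi> s y \<ominus>\<^bsub>\<A> s\<^esub> of_real ?G \<odot>\<^bsub>\<A> s\<^esub> x s)"
      using h.B.nrm_triangle c by (simp del: of_real_sum)
    also have "nrm\<^bsub>\<A> s\<^esub> (of_real (g t s) \<odot>\<^bsub>\<A> s\<^esub> (\<pi> s (a t) \<ominus>\<^bsub>\<A> s\<^esub> x s)) \<le> g t s * e"
    proof (cases "g t s = 0")
      case False
      then show ?thesis
        using insert.prems(4)[of t s] s g0 c by (simp add: h.B.nrm_smult mult_left_mono)
    qed (use c in simp)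
    also have "nrm\<^bsub>\<A> s\<^esub> (\<pi> s y \<ominus>\<^bsub>\<A> s\<^esub> of_real ?G \<odot>\<^bsub>\<A> s\<^esub> x s) \<le> ?G * e" by (rule y(2)[OF s])
    finally show "nrm\<^bsub>\<A> s\<^esub> (\<pi> s (z \<otimes>\<^bsub>A\<^esub> a t \<oplus>\<^bsub>A\<^esub> y) \<ominus>\<^bsub>\<A> s\<^esub>
        of_real (\<Sum>t\<in>insert t D. g t s) \<odot>\<^bsub>\<A> s\<^esub> x s) \<le> (\<Sum>t\<in>insert t D. g t s) * e"
      unfolding sum by (simp add: distrib_right)
  qed (use zc at y in simp)
qed

lemma uniform_approximation:
  assumes x: "\<And>s. s \<in> T \<Longrightarrow> x s \<in> carrier (\<A> s)" and e: "e > 0"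
    and local: "\<And>t. t \<in> T \<Longrightarrow> \<exists>y\<in>carrier A. \<exists>\<delta>>0. \<forall>s\<in>T. dist s t < \<delta> \<longrightarrow>
      nrm\<^bsub>\<A> s\<^esub> (\<pi> s y \<ominus>\<^bsub>\<A> s\<^esub> x s) \<le> e"
  shows "\<exists>y\<in>carrier A. \<forall>s\<in>T. nrm\<^bsub>\<A> s\<^esub> (\<pi> s y \<ominus>\<^bsub>\<A> s\<^esub> x s) \<le> e"
proof -
  have "\<forall>t\<in>T. \<exists>y \<delta>. y \<in> carrier A \<and> \<delta> > 0 \<and>
      (\<forall>s\<in>T. dist s t < \<delta> \<longrightarrow> nrm\<^bsub>\<A> s\<^esub> (\<pi> s y \<ominus>\<^bsub>\<A> s\<^esub> x s) \<le> e)"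
    using local by blast
  then obtain a \<delta> where a: "\<And>t. t \<in> T \<Longrightarrow> a t \<in> carrier A" and \<delta>: "\<And>t. t \<in> T \<Longrightarrow> \<delta> t > 0"
    and near: "\<And>t s. \<lbrakk>t \<in> T; s \<in> T; dist s t < \<delta> t\<rbrakk> \<Longrightarrow> nrm\<^bsub>\<A> s\<^esub> (\<pi> s (a t) \<ominus>\<^bsub>\<A> s\<^esub> x s) \<le> e"
    by metis
  have "T \<subseteq> (\<Union>t\<in>T. ball t (\<delta> t))" using \<delta> by auto
  then obtain D where D: "D \<subseteq> T" "finite D" "T \<subseteq> (\<Union>t\<in>D. ball t (\<delta> t))"
    by (rule compactE_image[OF compact_torus open_ball])
  \<comment> \<open>A cone of height \<open>\<delta> t\<close> that is positive exactly on the ball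
    around \<open>t\<close>. Since finitely many balls cover the torus, the sum of the cones is
    positive, and division by it gives a partition of unity subordinate to the cover.\<close>
  define f where "f t s = max 0 (\<delta> t - dist s t)" for t s
  define g where "g t s = f t s / (\<Sum>t\<in>D. f t s)" for t s
  have fc: "continuous_on T (f t)" for t
    unfolding f_def by (intro continuous_intros)
  have f0: "0 \<le> f t s" for t s by (simp add: f_def)
  have pos: "0 < (\<Sum>t\<in>D. f t s)" if s: "s \<in> T" for s
  proof -
    obtain t where t: "t \<in> D" "s \<in> ball t (\<delta> t)" using D(3) s by blast
    then have "0 < f t s" by (simp add: f_def dist_commute)
    then show ?thesis using t(1) f0 by (intro sum_pos2[OF D(2)])
  qed
  have "\<exists>y\<in>carrier A. \<forall>s\<in>T.
    nrm\<^bsub>\<A> s\<^esub> (\<pi> s y \<ominus>\<^bsub>\<A> s\<^esub> of_real (\<Sum>t\<in>D. g t s) \<odot>\<^bsub>\<A> s\<^esub> x s) \<le> (\<Sum>t\<in>D. g t s) * e"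
  proof (rule weighted_approximation[OF x D(2)])
    have ne: "(\<Sum>t\<in>D. f t s) \<noteq> 0" if "s \<in> T" for s using less_imp_neq[OF pos[OF that]] by (rule not_sym)
    show "continuous_on T (g t)" for t
      unfolding g_def by (intro continuous_on_divide continuous_on_sum fc ballI ne)
    show "0 \<le> g t s" for t s unfolding g_def by (intro divide_nonneg_nonneg sum_nonneg f0)
    show "a t \<in> carrier A" if "t \<in> D" for t using a D(1) that by blast
    show "nrm\<^bsub>\<A> s\<^esub> (\<pi> s (a t) \<ominus>\<^bsub>\<A> s\<^esub> x s) \<le> e" if "t \<in> D" "s \<in> T" "g t s \<noteq> 0" for t s
    proof (rule near)
      show "dist s t < \<delta> t" using that(3) by (auto simp: g_def f_def max_def split: if_splits)
    qed (use that D(1) in auto)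
  qed
  moreover have "(\<Sum>t\<in>D. g t s) = 1" if "s \<in> T" for s
    unfolding g_def using pos[OF that] by (simp flip: sum_divide_distrib)
  ultimately obtain y where y: "y \<in> carrier A"
    "\<And>s. s \<in> T \<Longrightarrow> nrm\<^bsub>\<A> s\<^esub> (\<pi> s y \<ominus>\<^bsub>\<A> s\<^esub> of_real 1 \<odot>\<^bsub>\<A> s\<^esub> x s) \<le> 1 * e"
    by (metis (no_types, lifting))
  have "nrm\<^bsub>\<A> s\<^esub> (\<pi> s y \<ominus>\<^bsub>\<A> s\<^esub> x s) \<le> e" if s: "s \<in> T" for s
  proof -
    interpret B: star_algebra "\<A> s" by (rule star_fiber[OF s])
    show ?thesis using y(2)[OF s] x[OF s] by simp
  qed
  then show ?thesis using y(1) by blast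
qed

text \<open>Neighbourhoods contain metric balls because the torus has the subspace topology;
  compactness turns local approximation into uniform approximation with error
  \<open>(1 / 2) ^ j\<close> for each \<open>j\<close>, and the uniform limit lifts.\<close>

lemma local_approximation_lifts:
  assumes x: "\<And>s. s \<in> T \<Longrightarrow> x s \<in> carrier (\<A> s)"
    and local: "\<And>t e. \<lbrakk>t \<in> T; e > 0\<rbrakk> \<Longrightarrow> \<exists>y\<in>carrier A. \<exists>N. openin (torus n) N \<and> t \<in> N \<and>
      (\<forall>s\<in>N. nrm\<^bsub>\<A> s\<^esub> (x s \<ominus>\<^bsub>\<A> s\<^esub> \<pi> s y) < e)"
  shows "\<exists>y\<in>carrier A. \<forall>s\<in>T. \<pi> s y = x s"
proof -
  have "\<exists>y\<in>carrier A. \<forall>s\<in>T. nrm\<^bsub>\<A> s\<^esub> (\<pi> s y \<ominus>\<^bsub>\<A> s\<^esub> x s) \<le> e" if e: "e > 0" for e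
  proof (rule uniform_approximation[OF x e])
    fix t assume t: "t \<in> T"
    obtain y N where y: "y \<in> carrier A" "openin (torus n) N" "t \<in> N"
      "\<forall>s\<in>N. nrm\<^bsub>\<A> s\<^esub> (x s \<ominus>\<^bsub>\<A> s\<^esub> \<pi> s y) < e" using local[OF t e] by blast
    obtain \<delta> where \<delta>: "\<delta> > 0" "\<And>s. s \<in> T \<Longrightarrow> dist s t < \<delta> \<Longrightarrow> s \<in> N"
      using y(2)[unfolded torus_eq_top_of_set openin_euclidean_subtopology_iff, THEN conjunct2,
          THEN bspec, OF y(3)] by auto
    have "nrm\<^bsub>\<A> s\<^esub> (\<pi> s y \<ominus>\<^bsub>\<A> s\<^esub> x s) \<le> e" if s: "s \<in> T" "dist s t < \<delta>" for s
    proof -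
      interpret h: star_morphism A "\<A> s" "\<pi> s" by (rule canonical(1)[OF s(1)])
      have "nrm\<^bsub>\<A> s\<^esub> (x s \<ominus>\<^bsub>\<A> s\<^esub> \<pi> s y) < e" using y(4) \<delta>(2)[OF s] by blast
      then show ?thesis using h.B.nrm_minus_commute[OF x[OF s(1)] h.hom_closed[OF y(1)]] by simp
    qed
    then show "\<exists>y\<in>carrier A. \<exists>\<delta>>0. \<forall>s\<in>T. dist s t < \<delta> \<longrightarrow> nrm\<^bsub>\<A> s\<^esub> (\<pi> s y \<ominus>\<^bsub>\<A> s\<^esub> x s) \<le> e"
      using y(1) \<delta>(1) by blast
  qed
  then have "\<forall>j::nat. \<exists>y. y \<in> carrier A \<and> (\<forall>s\<in>T. nrm\<^bsub>\<A> s\<^esub> (\<pi> s y \<ominus>\<^bsub>\<A> s\<^esub> x s) \<le> (1 / 2) ^ j)"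
    by (simp add: Bex_def)
  then obtain a where "\<And>j. a j \<in> carrier A"
    "\<And>j s. s \<in> T \<Longrightarrow> nrm\<^bsub>\<A> s\<^esub> (\<pi> s (a j) \<ominus>\<^bsub>\<A> s\<^esub> x s) \<le> (1 / 2) ^ j" by metis
  with x show ?thesis by (rule lift_uniform_limit)
qed

subsection \<open>The field and its algebra\<close>

abbreviation "tilde \<equiv> (\<lambda>a. \<lambda>\<theta>\<in>topspace (torus n). \<pi> \<theta> a)"

lemma full_field: "full_continuous_field (torus n) \<A> (tilde ` carrier A)"
proof -
  have lift: "(\<lambda>\<theta>\<in>topspace (torus n). f \<theta>) \<in> tilde ` carrier A"
    if "a \<in> carrier A" "\<And>\<theta>. \<theta> \<in> T \<Longrightarrow> f \<theta> = \<pi> \<theta> a" for a f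
    by (rule image_eqI[of _ _ a]) (use that in \<open>auto simp: topspace_torus intro!: restrict_ext\<close>)
  have val: "tilde a \<theta> = \<pi> \<theta> a" if "\<theta> \<in> T" for a \<theta> using that by (simp add: topspace_torus)
  show ?thesis
  proof (intro full_continuous_field.intro continuous_field.intro full_continuous_field_axioms.intro)
    show "compact_space (torus n)" "Hausdorff_space (torus n)"
      using compact_torus
      by (simp_all add: torus_eq_top_of_set compact_space_subtopology Hausdorff_space_subtopology)
    show "cstar_algebra (\<A> t)" if "t \<in> topspace (torus n)" for t
      using star_fiber[of t] that by (simp add: topspace_torus cstar_algebra_iff_star_algebra)
    show "tilde ` carrier A \<subseteq> sections (torus n) \<A>"
      unfolding sections_def topspace_torus
      by (intro image_subsetI restrict_PiE_iff[THEN iffD2] ballI star_morphism.hom_closed[OF canonical(1)])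
    show "(\<lambda>t\<in>topspace (torus n). \<zero>\<^bsub>\<A> t\<^esub>) \<in> tilde ` carrier A"
      by (rule lift[of "\<zero>\<^bsub>A\<^esub>"]) (simp_all add: star_morphism.hom_zero[OF canonical(1)])
  next
    fix x assume "x \<in> tilde ` carrier A"
    then obtain a where a: "a \<in> carrier A" "x = tilde a" by blast
    show "(\<lambda>t\<in>topspace (torus n). c \<odot>\<^bsub>\<A> t\<^esub> x t) \<in> tilde ` carrier A" for c
      by (rule lift[of "c \<odot>\<^bsub>A\<^esub> a"]) (use a val star_morphism.hom_smult[OF canonical(1)] in auto)
    show "(\<lambda>t\<in>topspace (torus n). adj\<^bsub>\<A> t\<^esub> (x t)) \<in> tilde ` carrier A"
      by (rule lift[of "adj\<^bsub>A\<^esub> a"]) (use a val star_morphism.hom_adj[OF canonical(1)] in auto)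
    show "continuous_map (torus n) euclideanreal (\<lambda>t. nrm\<^bsub>\<A> t\<^esub> (x t))"
      unfolding torus_eq_top_of_set continuous_map_iff_continuous
      by (rule continuous_on_eq[OF continuous_nrm[OF a(1)]]) (simp add: a topspace_torus)
    fix y assume "y \<in> tilde ` carrier A"
    then obtain b where b: "b \<in> carrier A" "y = tilde b" by blast
    show "(\<lambda>t\<in>topspace (torus n). x t \<oplus>\<^bsub>\<A> t\<^esub> y t) \<in> tilde ` carrier A"
      by (rule lift[of "a \<oplus>\<^bsub>A\<^esub> b"]) (use a b val star_morphism.hom_add[OF canonical(1)] in auto)
    show "(\<lambda>t\<in>topspace (torus n). x t \<otimes>\<^bsub>\<A> t\<^esub> y t) \<in> tilde ` carrier A"
      by (rule lift[of "a \<otimes>\<^bsub>A\<^esub> b"]) (use a b val star_morphism.hom_mult[OF canonical(1)] in auto)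
  next
    fix t b and e :: real
    assume t: "t \<in> topspace (torus n)" and b: "b \<in> carrier (\<A> t)" and e: "e > 0"
    then obtain a where "a \<in> carrier A" "nrm\<^bsub>\<A> t\<^esub> (\<pi> t a \<ominus>\<^bsub>\<A> t\<^esub> b) < e"
      using canonical_dense[of t b e] by (auto simp: topspace_torus)
    then show "\<exists>x\<in>tilde ` carrier A. nrm\<^bsub>\<A> t\<^esub> (x t \<ominus>\<^bsub>\<A> t\<^esub> b) < e"
      using t by (intro bexI[of _ "tilde a"]) auto
  next
    fix t assume t: "t \<in> topspace (torus n)"
    show "(\<lambda>x. x t) ` (tilde ` carrier A) = carrier (\<A> t)"
    proof
      show "(\<lambda>x. x t) ` (tilde ` carrier A) \<subseteq> carrier (\<A> t)"
        using t star_morphism.hom_closed[OF canonical(1)] by (auto simp: topspace_torus)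
      show "carrier (\<A> t) \<subseteq> (\<lambda>x. x t) ` (tilde ` carrier A)"
      proof
        fix b assume "b \<in> carrier (\<A> t)"
        then obtain a where a: "a \<in> carrier A" "\<pi> t a = b"
          using canonical_surj[of t b] t by (auto simp: topspace_torus)
        show "b \<in> (\<lambda>x. x t) ` (tilde ` carrier A)"
          by (rule image_eqI[of _ _ "tilde a"]) (use a t in auto)
      qed
    qed
  next
    fix x assume x: "x \<in> sections (torus n) \<A>"
      and local: "\<And>t e. \<lbrakk>t \<in> topspace (torus n); e > 0\<rbrakk> \<Longrightarrow> \<exists>y\<in>tilde ` carrier A. \<exists>N.
        openin (torus n) N \<and> t \<in> N \<and> (\<forall>s\<in>N. nrm\<^bsub>\<A> s\<^esub> (x s \<ominus>\<^bsub>\<A> s\<^esub> y s) < e)"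
    have xc: "x s \<in> carrier (\<A> s)" if "s \<in> T" for s
      using x that unfolding sections_def topspace_torus by auto
    have "\<exists>y\<in>carrier A. \<forall>s\<in>T. \<pi> s y = x s"
    proof (rule local_approximation_lifts[OF xc])
      fix t and e :: real assume t: "t \<in> T" and e: "e > 0"
      then have "t \<in> topspace (torus n)" by (simp add: topspace_torus)
      from local[OF this e] obtain a N where a: "a \<in> carrier A" "openin (torus n) N" "t \<in> N"
        "\<forall>s\<in>N. nrm\<^bsub>\<A> s\<^esub> (x s \<ominus>\<^bsub>\<A> s\<^esub> tilde a s) < e" by blast
      have "nrm\<^bsub>\<A> s\<^esub> (x s \<ominus>\<^bsub>\<A> s\<^esub> \<pi> s a) < e" if "s \<in> N" for s
        using a(4) that openin_subset[OF a(2)] by (auto simp: subset_iff)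
      then show "\<exists>y\<in>carrier A. \<exists>N. openin (torus n) N \<and> t \<in> N \<and>
          (\<forall>s\<in>N. nrm\<^bsub>\<A> s\<^esub> (x s \<ominus>\<^bsub>\<A> s\<^esub> \<pi> s y) < e)" using a(1-3) by blast
    qed
    then obtain y where y: "y \<in> carrier A" "\<And>s. s \<in> T \<Longrightarrow> \<pi> s y = x s" by blast
    have "x = (\<lambda>\<theta>\<in>topspace (torus n). x \<theta>)"
      using x unfolding sections_def by (simp add: PiE_restrict)
    then show "x \<in> tilde ` carrier A" using lift[OF y(1), of x] y(2) by simp
  qed
qed

text \<open>Contractivity bounds the fibre norms by \<open>nrm a\<close>, so the supremum is a
  genuine one over a bounded nonempty set; it is itself a bound for all fibres, and
  \<open>nrm_le_sup\<close> gives the other inequality.\<close>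

lemma nrm_eq_SUP:
  assumes a: "a \<in> carrier A"
  shows "(SUP \<theta>\<in>topspace (torus n). nrm\<^bsub>\<A> \<theta>\<^esub> (tilde a \<theta>)) = nrm\<^bsub>A\<^esub> a"
proof -
  have eq: "(SUP \<theta>\<in>topspace (torus n). nrm\<^bsub>\<A> \<theta>\<^esub> (tilde a \<theta>)) = (SUP \<theta>\<in>T. nrm\<^bsub>\<A> \<theta>\<^esub> (\<pi> \<theta> a))"
    unfolding topspace_torus by (rule SUP_cong) simp_all
  show ?thesis unfolding eq
  proof (rule antisym)
    show "(SUP \<theta>\<in>T. nrm\<^bsub>\<A> \<theta>\<^esub> (\<pi> \<theta> a)) \<le> nrm\<^bsub>A\<^esub> a"
      using T_nonempty by (intro cSUP_least nrm_canonical_le a) blast+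
    show "nrm\<^bsub>A\<^esub> a \<le> (SUP \<theta>\<in>T. nrm\<^bsub>\<A> \<theta>\<^esub> (\<pi> \<theta> a))"
    proof (rule nrm_le_sup[OF a])
      have "bdd_above ((\<lambda>\<theta>. nrm\<^bsub>\<A> \<theta>\<^esub> (\<pi> \<theta> a)) ` T)"
        using nrm_canonical_le[OF _ a] by (intro bdd_aboveI2)
      then show "nrm\<^bsub>\<A> \<theta>\<^esub> (\<pi> \<theta> a) \<le> (SUP \<theta>\<in>T. nrm\<^bsub>\<A> \<theta>\<^esub> (\<pi> \<theta> a))" if "\<theta> \<in> T" for \<theta>
        using that by (rule cSUP_upper[rotated])
    qed
  qed
qed

lemma inj_tilde: "inj_on tilde (carrier A)"
proof (rule inj_onI)
  fix a b assume ab: "a \<in> carrier A" "b \<in> carrier A" "tilde a = tilde b"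
  have "nrm\<^bsub>A\<^esub> (a \<ominus>\<^bsub>A\<^esub> b) \<le> 0"
  proof (rule nrm_le_sup)
    fix \<theta> assume \<theta>: "\<theta> \<in> T"
    interpret h: star_morphism A "\<A> \<theta>" "\<pi> \<theta>" by (rule canonical(1)[OF \<theta>])
    have "\<pi> \<theta> a = \<pi> \<theta> b" using fun_cong[OF ab(3), of \<theta>] \<theta> by (simp add: topspace_torus)
    then show "nrm\<^bsub>\<A> \<theta>\<^esub> (\<pi> \<theta> (a \<ominus>\<^bsub>A\<^esub> b)) \<le> 0" using ab(1,2) by (simp add: h.hom_diff h.B.minus_eq h.B.r_neg)
  qed (use ab in simp)
  then have "nrm\<^bsub>A\<^esub> (a \<ominus>\<^bsub>A\<^esub> b) = 0" using A.nrm_nonneg[of "a \<ominus>\<^bsub>A\<^esub> b"] ab by (intro antisym) auto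
  then show "a = b" using ab by (simp add: A.nrm_eq_0_iff)
qed

lemma tilde_operations:
  assumes "a \<in> carrier A" "b \<in> carrier A"
  shows "tilde (a \<oplus>\<^bsub>A\<^esub> b) = tilde a \<oplus>\<^bsub>field_algebra (torus n) \<A> \<Gamma>\<^esub> tilde b"
    "tilde (a \<otimes>\<^bsub>A\<^esub> b) = tilde a \<otimes>\<^bsub>field_algebra (torus n) \<A> \<Gamma>\<^esub> tilde b"
    "tilde (c \<odot>\<^bsub>A\<^esub> a) = c \<odot>\<^bsub>field_algebra (torus n) \<A> \<Gamma>\<^esub> tilde a"
    "tilde (adj\<^bsub>A\<^esub> a) = adj\<^bsub>field_algebra (torus n) \<A> \<Gamma>\<^esub> (tilde a)"
    "tilde \<one>\<^bsub>A\<^esub> = \<one>\<^bsub>field_algebra (torus n) \<A> \<Gamma>\<^esub>"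
    "tilde \<zero>\<^bsub>A\<^esub> = \<zero>\<^bsub>field_algebra (torus n) \<A> \<Gamma>\<^esub>"
  using assms
  by (auto simp: field_algebra_def topspace_torus star_morphism.hom_add[OF canonical(1)]
      star_morphism.hom_mult[OF canonical(1)] star_morphism.hom_smult[OF canonical(1)]
      star_morphism.hom_adj[OF canonical(1)] star_morphism.hom_one[OF canonical(1)]
      star_morphism.hom_zero[OF canonical(1)] intro!: restrict_ext)

text \<open>The C*-axioms for the sections, completeness included, are inherited from
  \<open>A\<close> along \<open>\<psi>\<close>, the inverse of \<open>tilde\<close>, which respects
  all operations and is isometric by \<open>nrm_eq_SUP\<close>.\<close>

lemma field_algebra_isomorphic:
  defines "F \<equiv> field_algebra (torus n) \<A> (tilde ` carrier A)"
  shows "star_algebra F" "tilde \<in> star_iso A F"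
proof -
  have carrier: "carrier F = tilde ` carrier A" by (simp add: F_def field_algebra_def)
  define \<psi> where "\<psi> = inv_into (carrier A) tilde"
  have \<psi>: "\<psi> (tilde a) = a" if "a \<in> carrier A" for a unfolding \<psi>_def by (rule inv_into_f_f[OF inj_tilde that])
  note ops = tilde_operations[where \<Gamma> = "tilde ` carrier A", folded F_def, symmetric]
  have sub: "cstar_subalgebra (carrier A) A" by (simp add: cstar_subalgebra_def)
  have "star_morphism F A \<psi>"
  proof (rule star_algebra_transport[OF A.star_algebra_axioms])
    show "inj_on \<psi> (carrier F)" unfolding carrier \<psi>_def by (rule inj_on_inv_into) simp
    have "\<psi> ` carrier F = carrier A" unfolding carrier image_image by (simp add: \<psi>)
    then show "cstar_subalgebra (\<psi> ` carrier F) A" using sub by simp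
    show "\<one>\<^bsub>F\<^esub> \<in> carrier F" "\<psi> \<one>\<^bsub>F\<^esub> = \<one>\<^bsub>A\<^esub>" "\<zero>\<^bsub>F\<^esub> \<in> carrier F" "\<psi> \<zero>\<^bsub>F\<^esub> = \<zero>\<^bsub>A\<^esub>"
      using ops(5,6)[OF A.one_closed A.one_closed] \<psi> carrier by auto
    fix x assume "x \<in> carrier F"
    then obtain a where a: "a \<in> carrier A" "x = tilde a" unfolding carrier by blast
    show "c \<odot>\<^bsub>F\<^esub> x \<in> carrier F" "\<psi> (c \<odot>\<^bsub>F\<^esub> x) = c \<odot>\<^bsub>A\<^esub> \<psi> x" for c
      using a ops(3)[OF a(1) a(1), of c] \<psi> carrier by auto
    show "adj\<^bsub>F\<^esub> x \<in> carrier F" "\<psi> (adj\<^bsub>F\<^esub> x) = adj\<^bsub>A\<^esub> (\<psi> x)"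
      using a ops(4)[OF a(1) a(1)] \<psi> carrier by auto
    show "nrm\<^bsub>F\<^esub> x = nrm\<^bsub>A\<^esub> (\<psi> x)"
      using a nrm_eq_SUP[OF a(1)] \<psi> by (simp add: F_def field_algebra_def)
    fix y assume "y \<in> carrier F"
    then obtain b where b: "b \<in> carrier A" "y = tilde b" unfolding carrier by blast
    show "x \<oplus>\<^bsub>F\<^esub> y \<in> carrier F" "\<psi> (x \<oplus>\<^bsub>F\<^esub> y) = \<psi> x \<oplus>\<^bsub>A\<^esub> \<psi> y"
      using a b ops(1)[OF a(1) b(1)] \<psi> carrier by auto
    show "x \<otimes>\<^bsub>F\<^esub> y \<in> carrier F" "\<psi> (x \<otimes>\<^bsub>F\<^esub> y) = \<psi> x \<otimes>\<^bsub>A\<^esub> \<psi> y"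
      using a b ops(2)[OF a(1) b(1)] \<psi> carrier by auto
  qed
  then show "star_algebra F" by (rule star_morphism.axioms)
  have "bij_betw tilde (carrier A) (carrier F)"
    unfolding carrier using inj_tilde by (rule inj_on_imp_bij_betw)
  moreover have "tilde \<in> star_hom A F"
    unfolding star_hom_def ring_hom_def
    using ops(1,2) ops(3,4)[OF _ A.one_closed] ops(5)[OF A.one_closed A.one_closed]
    by (simp add: carrier)
  ultimately show "tilde \<in> star_iso A F" by (simp add: star_iso_def)
qed

end

theorem theorem1p1:
  fixes n :: nat
    and A :: "'a cstar" and U :: "nat \<Rightarrow> 'a" and V :: "nat \<times> nat \<Rightarrow> 'a"
    and \<A> :: "(nat \<times> nat \<Rightarrow> complex) \<Rightarrow> 'b cstar"
    and W :: "(nat \<times> nat \<Rightarrow> complex) \<Rightarrow> nat \<Rightarrow> 'b"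
  defines "T \<equiv> torus n"
    and "\<pi> \<equiv> (\<lambda>\<theta>. canonical_map n A U V \<theta> (\<A> \<theta>) (W \<theta>))"
  defines "tilde \<equiv> (\<lambda>a. \<lambda>\<theta>\<in>topspace T. \<pi> \<theta> a)"
  assumes "n \<ge> 2"
    and "is_group_cstar n A U V"
    and "\<And>\<theta>. \<theta> \<in> topspace T \<Longrightarrow> is_nc_torus n \<theta> (\<A> \<theta>) (W \<theta>)"
  shows "full_continuous_field T \<A> (tilde ` carrier A) \<and>
         cstar_algebra (field_algebra T \<A> (tilde ` carrier A)) \<and>
         tilde \<in> star_iso A (field_algebra T \<A> (tilde ` carrier A))"
proof -
  interpret nilpotent_group_field n A U V \<A> W
    using assms(5,6) by (intro nilpotent_group_field.intro) (simp_all add: T_def)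
  show ?thesis
    using full_field field_algebra_isomorphic
    unfolding tilde_def T_def \<pi>_def cstar_algebra_iff_star_algebra by blast
qed

end
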